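(* Let $N\ge 1$, let $\Omega\subset\mathbb{R}^N$ be a bounded domain, and let $1<p<\infty$. Let $\mathbf{a}\colon\Omega\times\mathbb{R}^N\to\mathbb{R}^N$ be a Carathéodory function for which there are a function $\Phi\colon\Omega\times\mathbb{R}^N\to\mathbb{R}$ and constants $0<\alpha\le\beta$ such that: (a) $\mathbf{a}(x,\xi)=\nabla_\xi\Phi(x,\xi)$, and $\Phi(x,0)=0$ for a.e. $x\in\Omega$; (b) $\frac{\alpha}{p}|\xi|^p\le\Phi(x,\xi)\le\frac{\beta}{p}|\xi|^p$ for a.e. $x\in\Omega$ and all $\xi\in\mathbb{R}^N$; (c) the map $\xi\mapsto\Phi(x,\xi)$ is strictly convex for a.e. $x\in\Omega$. Let $\ell\in\{0,\infty\}$ and let $f\colon\mathbb{R}\to\mathbb{R}$ be a continuous function with $f(0)\ge 0$; put $F(s)=\int_0^s f(t)\,\mathrm{d}t$ for $s\ge 0$. Suppose that there exists a sequence $\{\alpha_n\}\subset(0,\infty)$ such that $\alpha_n\to\ell$ and $f(\alpha_n)=0$ for every $n\in\mathbb{N}$, and that there exists a sequence $\{\gamma_n\}\subset(0,\infty)$ with $\gamma_n\to\ell$ such that $$\frac{F(\gamma_n)}{\gamma_n^p}\to L^+\in(0,\infty]\qquad\text{and}\qquad -\min_{t\in[0,\gamma_n]}F(t)\le M\,F(\gamma_n)\ \text{ for every } n, \text{ for some constant } M\ge 0.$$ Then there exists $\overline{\lambda}\in[0,\infty)$ such that, for every $\lambda>\overline{\lambda}$, the problem $$-\operatorname{div}(\mathbf{a}(x,\nabla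 u))=\lambda f(u)\ \text{ in }\Omega,\qquad u=0\ \text{ on }\partial\Omega,$$ has a sequence $\{u_n\}$ of nonnegative and nontrivial bounded solutions such that $\|u_n\|_{L^\infty(\Omega)}\to\ell$. Furthermore, if $L^+=\infty$, then this holds with $\overline{\lambda}=0$.
   Context: Carathéodory means measurable in $x$ for every fixed $\xi$ and continuous in $\xi$ for almost every fixed $x$. Bounded solutions are understood in the weak sense: $u\in W^{1,p}_0(\Omega)\cap L^\infty(\Omega)$ with $\int_\Omega\mathbf{a}(x,\nabla u)\cdot\nabla\varphi=\lambda\int_\Omega f(u)\varphi$ for all $\varphi\in W^{1,p}_0(\Omega)\cap L^\infty(\Omega)$. Nontrivial means not identically zero. *)

theory Defs
  imports "HOL-Analysis.Analysis" "HOL-Probability.Essential_Supremum"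
begin

definition caratheodory_function ::
    "'a::euclidean_space set \<Rightarrow> ('a \<Rightarrow> 'b::topological_space \<Rightarrow> 'c::topological_space) \<Rightarrow> bool" where
  "caratheodory_function \<Omega> a \<longleftrightarrow>
     (\<forall>\<xi>. (\<lambda>x. a x \<xi>) \<in> borel_measurable (lebesgue_on \<Omega>)) \<and>
     (AE x in lebesgue_on \<Omega>. continuous_on UNIV (a x))"

definition strictly_convex_on :: "'a::real_vector set \<Rightarrow> ('a \<Rightarrow> real) \<Rightarrow> bool" where
  "strictly_convex_on S f \<longleftrightarrow>
     convex S \<and>
     (\<forall>t x y. 0 < t \<longrightarrow> t < 1 \<longrightarrow> x \<in> S \<longrightarrow> y \<in> S \<longrightarrow> x \<noteq> y \<longrightarrow>
        f ((1 - t) *\<^sub>R x + t *\<^sub>R y) < (1 - t) * f x + t * f y)"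

definition grad :: "('a::real_inner \<Rightarrow> real) \<Rightarrow> 'a \<Rightarrow> 'a" where
  "grad f x = (THE D. GDERIV f x :> D)"

(* The class C^k on the whole space, by recursion on the partial derivatives. *)
primrec Ck :: "nat \<Rightarrow> ('a::euclidean_space \<Rightarrow> real) \<Rightarrow> bool" where
  "Ck 0 f \<longleftrightarrow> continuous_on UNIV f"
| "Ck (Suc k) f \<longleftrightarrow>
     (\<forall>x. f differentiable (at x)) \<and> (\<forall>b\<in>Basis. Ck k (\<lambda>x. grad f x \<bullet> b))"

(* C_c^infinity(\<Omega>); its elements are extended by zero to the whole space. *)
definition test_functions :: "'a::euclidean_space set \<Rightarrow> ('a \<Rightarrow> real) set" where
  "test_functions \<Omega> =
     {\<phi>. (\<forall>k. Ck k \<phi>) \<and> compact (closure {x. \<phi> x \<noteq> 0}) \<and> closure {x. \<phi> x \<noteq> 0} \<subseteq> \<Omega>}"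

(* Elements of the function spaces below are representatives, not equivalence classes modulo
   null sets; their values outside \<Omega> play no role. *)

definition Lp_space ::
    "'a::euclidean_space set \<Rightarrow> real \<Rightarrow> ('a \<Rightarrow> 'b::{real_normed_vector, second_countable_topology}) set" where
  "Lp_space \<Omega> p =
     {u \<in> borel_measurable (lebesgue_on \<Omega>). integrable (lebesgue_on \<Omega>) (\<lambda>x. norm (u x) powr p)}"

definition Linf_norm :: "'a::euclidean_space set \<Rightarrow> ('a \<Rightarrow> real) \<Rightarrow> ereal" where
  "Linf_norm \<Omega> u = esssup (lebesgue_on \<Omega>) (\<lambda>x. ereal \<bar>u x\<bar>)"

definition Linf_space :: "'a::euclidean_space set \<Rightarrow> ('a \<Rightarrow> real) set" where
  "Linf_space \<Omega> = {u \<in> borel_measurable (lebesgue_on \<Omega>). Linf_norm \<Omega> u < \<infinity>}"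

definition locally_integrable ::
    "'a::euclidean_space set \<Rightarrow> ('a \<Rightarrow> 'b::euclidean_space) \<Rightarrow> bool" where
  "locally_integrable \<Omega> u \<longleftrightarrow>
     (\<forall>K. compact K \<longrightarrow> K \<subseteq> \<Omega> \<longrightarrow> u absolutely_integrable_on K)"

(* Both sides of the integration by parts formula are vector-valued integrals; componentwise
   this is the usual definition of the weak partial derivatives. *)
definition has_weak_grad ::
    "'a::euclidean_space set \<Rightarrow> ('a \<Rightarrow> real) \<Rightarrow> ('a \<Rightarrow> 'a) \<Rightarrow> bool" where
  "has_weak_grad \<Omega> u g \<longleftrightarrow>
     locally_integrable \<Omega> u \<and> locally_integrable \<Omega> g \<and>
     (\<forall>\<phi>\<in>test_functions \<Omega>.
        (LINT x|lebesgue_on \<Omega>. u x *\<^sub>R grad \<phi> x) = - (LINT x|lebesgue_on \<Omega>. \<phi> x *\<^sub>R g x))"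

(* A weak gradient is unique up to null sets; one representative is chosen. *)
definition weak_grad :: "'a::euclidean_space set \<Rightarrow> ('a \<Rightarrow> real) \<Rightarrow> 'a \<Rightarrow> 'a" where
  "weak_grad \<Omega> u = (SOME g. has_weak_grad \<Omega> u g)"

definition W1p :: "'a::euclidean_space set \<Rightarrow> real \<Rightarrow> ('a \<Rightarrow> real) set" where
  "W1p \<Omega> p = {u \<in> Lp_space \<Omega> p. \<exists>g. has_weak_grad \<Omega> u g \<and> g \<in> Lp_space \<Omega> p}"

definition W1p_norm :: "'a::euclidean_space set \<Rightarrow> real \<Rightarrow> ('a \<Rightarrow> real) \<Rightarrow> real" where
  "W1p_norm \<Omega> p u =
     ((LINT x|lebesgue_on \<Omega>. \<bar>u x\<bar> powr p) +
      (LINT x|lebesgue_on \<Omega>. norm (weak_grad \<Omega> u x) powr p)) powr (1 / p)"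

(* The closure of the test functions in W^{1,p}. *)
definition W1p_0 :: "'a::euclidean_space set \<Rightarrow> real \<Rightarrow> ('a \<Rightarrow> real) set" where
  "W1p_0 \<Omega> p =
     {u \<in> W1p \<Omega> p. \<forall>\<epsilon>>0. \<exists>\<phi>\<in>test_functions \<Omega>. W1p_norm \<Omega> p (\<lambda>x. u x - \<phi> x) < \<epsilon>}"

(* Bounded weak solutions of -div a(x, grad u) = lam f(u) in \<Omega>, u = 0 on the boundary.
   The Bochner integral of a non-integrable function is 0 by convention, hence the explicit
   integrability requirements. *)
definition bounded_solution ::
    "'a::euclidean_space set \<Rightarrow> real \<Rightarrow> ('a \<Rightarrow> 'a \<Rightarrow> 'a) \<Rightarrow> (real \<Rightarrow> real) \<Rightarrow> real \<Rightarrow> ('a \<Rightarrow> real) \<Rightarrow> bool" where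
  "bounded_solution \<Omega> p a f lam u \<longleftrightarrow>
     u \<in> W1p_0 \<Omega> p \<inter> Linf_space \<Omega> \<and>
     (\<forall>\<phi> \<in> W1p_0 \<Omega> p \<inter> Linf_space \<Omega>.
        integrable (lebesgue_on \<Omega>) (\<lambda>x. a x (weak_grad \<Omega> u x) \<bullet> weak_grad \<Omega> \<phi> x) \<and>
        integrable (lebesgue_on \<Omega>) (\<lambda>x. f (u x) * \<phi> x) \<and>
        (LINT x|lebesgue_on \<Omega>. a x (weak_grad \<Omega> u x) \<bullet> weak_grad \<Omega> \<phi> x) =
          lam * (LINT x|lebesgue_on \<Omega>. f (u x) * \<phi> x))"

definition primitive :: "(real \<Rightarrow> real) \<Rightarrow> real \<Rightarrow> real" where
  "primitive f s = integral {0..s} f"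

definition has_solution_sequence ::
    "'a::euclidean_space set \<Rightarrow> real \<Rightarrow> ('a \<Rightarrow> 'a \<Rightarrow> 'a) \<Rightarrow> (real \<Rightarrow> real) \<Rightarrow> real \<Rightarrow> ereal \<Rightarrow> bool" where
  "has_solution_sequence \<Omega> p a f lam l \<longleftrightarrow>
     (\<exists>u :: nat \<Rightarrow> 'a \<Rightarrow> real.
        (\<forall>n. bounded_solution \<Omega> p a f lam (u n) \<and>
             (AE x in lebesgue_on \<Omega>. u n x \<ge> 0) \<and>
             \<not> (AE x in lebesgue_on \<Omega>. u n x = 0)) \<and>
        (\<lambda>n. Linf_norm \<Omega> (u n)) \<longlonglongrightarrow> l)"

end

theory Submission
  imports Defs "HOL-Complex_Analysis.Great_Picard"
begin

text \<open>
  Let \<open>F\<close> be the primitive of \<open>f\<close> and \<open>\<mu>\<close> the measure of \<open>\<Omega>\<close>. The solutions are found as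
  global minimisers of truncated functionals. Given a zero \<open>z > 0\<close> of \<open>f\<close>, let \<open>G\<close> be the primitive of
  \<open>s \<mapsto> f (max 0 (min z s))\<close> and minimise \<open>I(u) = \<integral> \<Phi>(x, \<nabla>u) - \<lambda> \<integral> G(u)\<close>. Because \<open>\<Phi>(x, \<cdot>)\<close> is
  convex with minimum at the origin, and because \<open>f 0 \<ge> 0\<close> and \<open>f z = 0\<close> give
  \<open>G s \<le> G (max 0 (min z s))\<close>, truncating a competitor to \<open>[0, z]\<close> does not increase \<open>I\<close>. So there
  is a minimiser \<open>u\<close> with values in \<open>[0, z]\<close>, where \<open>G' = f\<close>, and its Euler-Lagrange equation is the
  original problem (\<open>exists_bounded_solution\<close>).

  That \<open>u\<close> is nonzero, and large when it has to be, comes from comparing \<open>u\<close> with \<open>\<gamma>\<kappa>\<close> for \<open>\<gamma> \<le> z\<close>,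
  where \<open>\<kappa>\<close> is a smooth cutoff equal to one on a compact set \<open>T\<close> that fills almost all of \<open>\<Omega>\<close>. The
  lower bound of \<open>F\<close> on \<open>[0, \<gamma>]\<close> by \<open>- M F(\<gamma>)\<close> controls what happens outside \<open>T\<close>, and the result is
  \<open>- \<lambda> \<integral> F(u) \<le> \<gamma>^p (A - \<lambda> (\<mu>/2) F(\<gamma>)/\<gamma>^p)\<close> with \<open>A = \<beta>/p \<integral> |\<nabla>\<kappa>|^p\<close>. As soon as
  \<open>\<lambda> > A / (\<mu> L / 2)\<close>, which is every \<open>\<lambda> > 0\<close> if \<open>L = \<infinity>\<close>, the right-hand side is at most \<open>- \<delta> \<gamma>^p\<close> for
  all late \<open>\<gamma>\<close>. If \<open>l = 0\<close>, this shows that the minimisers below \<open>z \<rightarrow> 0\<close> are not zero. If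
  \<open>l = \<infinity>\<close>, the integrals of \<open>F(u)\<close> tend to infinity along the zeros, which forces the suprema of
  the minimisers to infinity because \<open>F\<close> is bounded on bounded sets (\<open>solution_sequence_exists\<close>).

  The minimiser is found by the direct method among test functions, without weak topologies. A
  minimising sequence is clamped to \<open>[0, z]\<close> by a smooth function (\<open>smooth_clamp_exists\<close>) and has an
  almost everywhere convergent subsequence (\<open>bounded_gradient_compactness\<close>). Its gradients need
  not converge, so it is replaced by functions that nearly minimise \<open>\<integral> |\<nabla>v|^p\<close> in a decreasing
  sequence of convex sets of almost optimal competitors (\<open>nested_midpoint_minimizers\<close>); uniform
  convexity (\<open>norm_powr_uniformly_convex\<close>) makes the gradients of these Cauchy in \<open>L^p\<close>. In the
  Euler-Lagrange equation, convexity of \<open>\<Phi>(x, \<cdot>)\<close> bounds the difference quotients of the energy by an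
  integrable function (\<open>\<Phi>_quotient_bound\<close>).
\<close>

section \<open>Smooth functions\<close>

lemma GDERIV_unique:
  assumes "GDERIV f x :> D" "GDERIV f x :> E"
  shows "D = E"
proof -
  have "(\<lambda>h. h \<bullet> D) = (\<lambda>h. h \<bullet> E)"
    using assms unfolding gderiv_def by (rule has_derivative_unique)
  then have "\<forall>h. h \<bullet> D = h \<bullet> E" unfolding fun_eq_iff .
  then show ?thesis by (rule vector_eq_ldot[THEN iffD1])
qed

lemma grad_eqI:
  assumes "GDERIV f x :> D" shows "grad f x = D"
  unfolding grad_def
proof (rule the_equality)
  show "E = D" if "GDERIV f x :> E" for E
    by (rule GDERIV_unique[OF that assms])
qed (rule assms)

lemma GDERIV_grad:
  fixes f :: "'a::euclidean_space \<Rightarrow> real"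
  assumes "f differentiable (at x)"
  shows "GDERIV f x :> grad f x"
proof -
  obtain f' where f': "(f has_derivative f') (at x)"
    using assms unfolding differentiable_def by blast
  interpret linear f' by (rule has_derivative_linear[OF f'])
  have "f' h = h \<bullet> (\<Sum>b\<in>Basis. f' b *\<^sub>R b)" for h
  proof -
    have "f' h = f' (\<Sum>b\<in>Basis. (h \<bullet> b) *\<^sub>R b)" by (simp add: euclidean_representation)
    also have "\<dots> = (\<Sum>b\<in>Basis. (h \<bullet> b) * f' b)" by (simp add: sum scale)
    also have "\<dots> = h \<bullet> (\<Sum>b\<in>Basis. f' b *\<^sub>R b)"
      by (simp add: inner_sum_right mult.commute)
    finally show ?thesis .
  qed
  then have "f' = (\<lambda>h. h \<bullet> (\<Sum>b\<in>Basis. f' b *\<^sub>R b))" by (rule ext)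
  with f' have D: "GDERIV f x :> (\<Sum>b\<in>Basis. f' b *\<^sub>R b)"
    unfolding gderiv_def by (rule back_subst[where P = "\<lambda>g. (f has_derivative g) (at x)"])
  show ?thesis unfolding grad_eqI[OF D] by (rule D)
qed

lemma Ck_SucI:
  assumes "\<And>x. GDERIV f x :> g x" "\<And>b. b \<in> Basis \<Longrightarrow> Ck k (\<lambda>x. g x \<bullet> b)"
  shows "Ck (Suc k) f"
proof (rule Ck.simps(2)[THEN iffD2], intro conjI allI ballI)
  fix x :: 'a
  show "f differentiable (at x)"
    unfolding differentiable_def by (intro exI) (rule assms(1)[of x, unfolded gderiv_def])
next
  fix b :: 'a assume b: "b \<in> Basis"
  have g: "grad f = g" by (intro ext grad_eqI assms(1))
  show "Ck k (\<lambda>x. grad f x \<bullet> b)"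
    unfolding g by (rule assms(2)[OF b])
qed

lemma Ck_SucD1: "Ck (Suc k) f \<Longrightarrow> f differentiable (at x)"
  by (rule Ck.simps(2)[THEN iffD1, THEN conjunct1, THEN spec])

lemma Ck_SucD2: "Ck (Suc k) f \<Longrightarrow> b \<in> Basis \<Longrightarrow> Ck k (\<lambda>x. grad f x \<bullet> b)"
  by (rule Ck.simps(2)[THEN iffD1, THEN conjunct2, THEN bspec])

lemma Ck_Suc_GDERIV: "Ck (Suc k) f \<Longrightarrow> GDERIV f x :> grad f x"
  by (rule GDERIV_grad[OF Ck_SucD1])

lemma Ck_SucD: "Ck (Suc k) f \<Longrightarrow> Ck k f"
proof (induction k arbitrary: f)
  case 0
  show ?case unfolding Ck.simps(1)
    by (intro continuous_at_imp_continuous_on ballI differentiable_imp_continuous_within Ck_SucD1[OF 0])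
next
  case (Suc k)
  show ?case
    by (rule Ck_SucI[OF Ck_Suc_GDERIV[OF Suc.prems]]) (rule Suc.IH[OF Ck_SucD2[OF Suc.prems]])
qed

lemma Ck_const: "Ck k (\<lambda>_. c)"
proof (induction k arbitrary: c)
  case (Suc k)
  show ?case by (rule Ck_SucI[where g = "\<lambda>_. 0"]) (auto simp: GDERIV_const Suc)
qed auto

lemma Ck_add: "Ck k f \<Longrightarrow> Ck k g \<Longrightarrow> Ck k (\<lambda>x. f x + g x)"
proof (induction k arbitrary: f g)
  case (Suc k)
  show ?case
    by (rule Ck_SucI[where g = "\<lambda>x. grad f x + grad g x"])
      (use Suc in \<open>simp_all add: inner_add_left GDERIV_add GDERIV_grad\<close>)
qed (simp add: continuous_on_add)

lemma Ck_mult: "Ck k f \<Longrightarrow> Ck k g \<Longrightarrow> Ck k (\<lambda>x. f x * g x)"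
proof (induction k arbitrary: f g)
  case (Suc k)
  have "Ck k f" "Ck k g" using Suc.prems Ck_SucD by blast+
  with Suc show ?case
    by (intro Ck_SucI[where g = "\<lambda>x. f x *\<^sub>R grad g x + g x *\<^sub>R grad f x"])
      (simp_all add: inner_add_left GDERIV_mult GDERIV_grad Ck_add)
qed (simp add: continuous_on_mult)

lemma Ck_inner: "Ck k (\<lambda>x. x \<bullet> c)"
proof (cases k)
  case (Suc k)
  show ?thesis unfolding Suc
    by (rule Ck_SucI[where g = "\<lambda>_. c"]) (auto simp: Ck_const gderiv_def intro!: derivative_eq_intros)
qed (simp add: continuous_on_inner)

lemma Ck_sum: "finite A \<Longrightarrow> (\<And>i. i \<in> A \<Longrightarrow> Ck k (f i)) \<Longrightarrow> Ck k (\<lambda>x. \<Sum>i\<in>A. f i x)"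
  by (induction A rule: finite_induct) (auto intro: Ck_const Ck_add)

lemma Ck_compose:
  fixes h :: "real \<Rightarrow> real"
  shows "Ck k h \<Longrightarrow> Ck k f \<Longrightarrow> Ck k (\<lambda>x. h (f x))"
proof (induction k arbitrary: f h)
  case (Suc k)
  have f: "Ck k f" using Suc.prems Ck_SucD by blast
  have h': "Ck k (grad h)" using Suc.prems(1) by simp
  show ?case
  proof (rule Ck_SucI[where g = "\<lambda>x. grad h (f x) *\<^sub>R grad f x"])
    show "GDERIV (\<lambda>x. h (f x)) x :> grad h (f x) *\<^sub>R grad f x" for x
      using Ck_Suc_GDERIV[OF Suc.prems(1)] Ck_Suc_GDERIV[OF Suc.prems(2)]
      by (intro GDERIV_DERIV_compose) auto
    show "Ck k (\<lambda>x. (grad h (f x) *\<^sub>R grad f x) \<bullet> b)" if "b \<in> Basis" for b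
    proof -
      have "Ck k (\<lambda>x. grad f x \<bullet> b)" using Suc.prems(2) that by simp
      from Ck_mult[OF Suc.IH[OF h' f] this] show ?thesis by simp
    qed
  qed
next
  case 0
  then show ?case
    by (simp add: continuous_on_compose2[of UNIV h UNIV f])
qed

definition smooth :: "('a::euclidean_space \<Rightarrow> real) \<Rightarrow> bool" where
  "smooth f \<longleftrightarrow> (\<forall>k. Ck k f)"

lemma smooth_const [intro!]: "smooth (\<lambda>_. c)"
  by (simp add: smooth_def Ck_const)

lemma smooth_inner [intro!]: "smooth (\<lambda>x. x \<bullet> c)"
  by (simp add: smooth_def Ck_inner)

lemma smooth_ident [intro!]: "smooth (\<lambda>x::real. x)"
  using smooth_inner[of "1::real"] by simp

lemma smooth_add [intro!]: "smooth f \<Longrightarrow> smooth g \<Longrightarrow> smooth (\<lambda>x. f x + g x)"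
  by (simp add: smooth_def Ck_add)

lemma smooth_mult [intro!]: "smooth f \<Longrightarrow> smooth g \<Longrightarrow> smooth (\<lambda>x. f x * g x)"
  by (simp add: smooth_def Ck_mult)

lemma smooth_diff [intro!]:
  assumes "smooth f" "smooth g" shows "smooth (\<lambda>x. f x - g x)"
  using smooth_add[OF assms(1) smooth_mult[OF smooth_const[of "-1"] assms(2)]] by simp

lemma smooth_sum: "finite A \<Longrightarrow> (\<And>i. i \<in> A \<Longrightarrow> smooth (f i)) \<Longrightarrow> smooth (\<lambda>x. \<Sum>i\<in>A. f i x)"
  by (simp add: smooth_def Ck_sum)

lemma smooth_compose:
  fixes h :: "real \<Rightarrow> real"
  shows "smooth h \<Longrightarrow> smooth f \<Longrightarrow> smooth (\<lambda>x. h (f x))"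
  by (simp add: smooth_def Ck_compose)

lemma smooth_GDERIV: "smooth f \<Longrightarrow> GDERIV f x :> grad f x"
  unfolding smooth_def using Ck_Suc_GDERIV by blast

lemma smooth_continuous: "smooth f \<Longrightarrow> continuous_on S f"
  unfolding smooth_def using Ck.simps(1) continuous_on_subset by blast

lemma smooth_grad_continuous:
  assumes "smooth f" shows "continuous_on S (grad f)"
proof -
  have "Ck (Suc 0) f" using assms by (simp only: smooth_def)
  then have "continuous_on S (\<lambda>x. grad f x \<bullet> b)" if "b \<in> Basis" for b
    using that continuous_on_subset by fastforce
  then show ?thesis by (rule continuous_on_componentwise[THEN iffD2, rule_format])
qed

lemma smooth_antideriv:
  fixes H :: "real \<Rightarrow> real"
  assumes "\<And>x. (H has_real_derivative h x) (at x)" "smooth h"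
  shows "smooth H"
  unfolding smooth_def
proof
  fix k
  have "Ck (Suc k) H"
    by (rule Ck_SucI[where g = h]) (use assms in \<open>auto simp: smooth_def\<close>)
  then show "Ck k H" by (rule Ck_SucD)
qed

subsection \<open>Smooth steps on the real line\<close>

text \<open>
  The function \<open>exp (- 1 / x)\<close>, continued by zero. The polynomial factor in \<open>1 / x\<close> makes the family
  closed under differentiation, so smoothness can be proved for all members at once.
\<close>

definition flat :: "real poly \<Rightarrow> real \<Rightarrow> real" where
  "flat P x = (if x > 0 then poly P (1 / x) * exp (- (1 / x)) else 0)"

text \<open>
  With \<open>y = 1 / x\<close> this is the behaviour of the difference quotients of \<open>flat\<close> at the origin.
\<close>

lemma poly_times_exp_minus_tendsto_0: "((\<lambda>y. poly P y * exp (- y)) \<longlongrightarrow> (0::real)) at_top"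
proof -
  have "((\<lambda>y::real. coeff P i * (y ^ i / exp y)) \<longlongrightarrow> coeff P i * 0) at_top" for i
    by (intro tendsto_intros tendsto_power_div_exp_0)
  then have "((\<lambda>y. \<Sum>i\<le>degree P. coeff P i * (y ^ i / exp y)) \<longlongrightarrow> (\<Sum>i\<le>degree P. coeff P i * 0)) at_top"
    by (intro tendsto_sum)
  then show ?thesis by (simp add: poly_altdef exp_minus sum_distrib_right sum_divide_distrib field_simps)
qed

lemma flat_has_derivative:
  "(flat P has_real_derivative flat ([:0, 0, 1:] * (P - pderiv P)) x) (at x)"
proof -
  consider "x > 0" | "x < 0" | "x = 0" by linarith
  then show ?thesis
  proof cases
    case 1
    have *: "((\<lambda>x. poly P (1 / x) * exp (- (1 / x))) has_real_derivative
        flat ([:0, 0, 1:] * (P - pderiv P)) x) (at x)"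
      using 1 by (auto intro!: derivative_eq_intros poly_DERIV[THEN DERIV_chain2]
          simp: flat_def field_simps power2_eq_square)
    show ?thesis
      by (rule DERIV_cong_ev[OF refl _ refl, THEN iffD2, OF _ *])
        (use 1 eventually_gt_at_top in \<open>auto simp: flat_def eventually_nhds intro!: exI[of _ "{0<..}"]\<close>)
  next
    case 2
    have *: "((\<lambda>x. 0) has_real_derivative flat ([:0, 0, 1:] * (P - pderiv P)) x) (at x)"
      using 2 by (auto simp: flat_def)
    show ?thesis
      by (rule DERIV_cong_ev[OF refl _ refl, THEN iffD2, OF _ *])
        (use 2 in \<open>auto simp: flat_def eventually_nhds intro!: exI[of _ "{..<0}"]\<close>)
  next
    case 3
    have "((\<lambda>y. poly (pCons 0 P) y * exp (- y)) \<longlongrightarrow> 0) at_top"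
      by (rule poly_times_exp_minus_tendsto_0)
    then have "((\<lambda>x. poly (pCons 0 P) (inverse x) * exp (- inverse x)) \<longlongrightarrow> 0) (at_right 0)"
      by (rule filterlim_compose[OF _ filterlim_inverse_at_top_right])
    moreover have "\<forall>\<^sub>F h in at_right 0. poly (pCons 0 P) (inverse h) * exp (- inverse h) = flat P h / h"
      using eventually_at_right_less by (rule eventually_mono) (auto simp: flat_def field_simps)
    ultimately have r: "((\<lambda>h. flat P h / h) \<longlongrightarrow> 0) (at_right 0)"
      by (rule Lim_transform_eventually)
    have "\<forall>\<^sub>F h in at_left 0. flat P h / h = 0"
      unfolding eventually_at_left_field by (auto simp: flat_def intro!: exI[of _ "-1"])
    then have l: "((\<lambda>h. flat P h / h) \<longlongrightarrow> 0) (at_left 0)"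
      by (rule tendsto_eventually)
    have "((\<lambda>h. flat P h / h) \<longlongrightarrow> 0) (at 0)"
      using filterlim_split_at[OF l r] .
    then show ?thesis using 3 by (simp add: DERIV_def flat_def)
  qed
qed

lemma smooth_flat: "smooth (flat P)"
proof -
  have "Ck k (flat P)" for k
  proof (induction k arbitrary: P)
    case 0
    have "isCont (flat P) x" for x
      by (rule DERIV_isCont[OF flat_has_derivative])
    then show ?case by (simp add: continuous_at_imp_continuous_on)
  next
    case (Suc k)
    show ?case
    proof (rule Ck_SucI)
      show "GDERIV (flat P) x :> flat ([:0, 0, 1:] * (P - pderiv P)) x" for x
        unfolding gderiv_deriv by (rule flat_has_derivative)
      show "Ck k (\<lambda>x. flat ([:0, 0, 1:] * (P - pderiv P)) x \<bullet> b)" if "b \<in> Basis" for b :: real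
        using Suc[of "[:0, 0, 1:] * (P - pderiv P)"] that by simp
    qed
  qed
  then show ?thesis by (simp add: smooth_def)
qed

lemma continuous_has_antiderivative:
  fixes h :: "real \<Rightarrow> real"
  assumes "continuous_on UNIV h"
  obtains H where "\<And>x. (H has_real_derivative h x) (at x)" "H 0 = 0"
proof -
  have "\<exists>F. \<forall>x. - \<infinity> < ereal x \<longrightarrow> ereal x < \<infinity> \<longrightarrow> (F has_vector_derivative h x) (at x)"
    by (rule einterval_antiderivative)
      (use assms in \<open>auto simp: continuous_on_eq_continuous_at\<close>)
  then obtain F where F: "\<And>x. (F has_real_derivative h x) (at x)"
    by (auto simp: has_real_derivative_iff_has_vector_derivative)
  show thesis
    by (rule that[of "\<lambda>x. F x - F 0"]) (auto intro!: derivative_eq_intros F)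
qed

text \<open>
  The step is a normalised antiderivative of the bump \<open>exp (- 1 / x) exp (- 1 / (1 - x))\<close>. Working
  with an antiderivative instead of a quotient leaves only products and compositions to differentiate.
\<close>

lemma smooth_step_exists:
  obtains S :: "real \<Rightarrow> real"
  where "smooth S" "\<And>x. 0 \<le> S x" "\<And>x. S x \<le> 1" "\<And>x. x \<le> 0 \<Longrightarrow> S x = 0" "\<And>x. x \<ge> 1 \<Longrightarrow> S x = 1"
proof -
  define B where "B = (\<lambda>x. flat 1 x * flat 1 (1 - x))"
  have sB: "smooth B"
    unfolding B_def
    by (rule smooth_mult[OF smooth_flat smooth_compose[OF smooth_flat smooth_diff[OF smooth_const smooth_ident]]])
  have B0: "B x \<ge> 0" for x by (simp add: B_def flat_def)
  have Bpos: "B x > 0" if "0 < x" "x < 1" for x using that by (simp add: B_def flat_def)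
  obtain H where H: "\<And>x. (H has_real_derivative B x) (at x)" "H 0 = 0"
    by (rule continuous_has_antiderivative[OF smooth_continuous[OF sB]]) blast
  have mono: "H x \<le> H y" if "x \<le> y" for x y
    by (rule DERIV_nonneg_imp_nondecreasing[OF that]) (use H(1) B0 in blast)
  have cont: "continuous_on A H" for A
    by (intro continuous_at_imp_continuous_on ballI DERIV_isCont[OF H(1)])
  have flat0: "(H has_real_derivative 0) (at x)" if "x \<le> 0 \<or> x \<ge> 1" for x
  proof -
    have "B x = 0" using that by (auto simp: B_def flat_def)
    then show ?thesis using H(1)[of x] by simp
  qed
  have left: "H x = 0" if "x \<le> 0" for x
  proof (cases "x = 0")
    case False
    have "H 0 = H x"
      by (rule DERIV_isconst2[of x 0 H]) (use that False in \<open>auto intro!: flat0 cont\<close>)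
    then show ?thesis using H(2) by simp
  qed (use H(2) in auto)
  have right: "H x = H 1" if "x \<ge> 1" for x
  proof (cases "x = 1")
    case False
    show ?thesis
      by (rule DERIV_isconst2[of 1 x H]) (use that False in \<open>auto intro!: flat0 cont\<close>)
  qed auto
  have "H 0 < H 1"
  proof (rule DERIV_pos_imp_increasing_open[where f = H])
    show "\<exists>y. (H has_real_derivative y) (at x) \<and> y > 0" if "0 < x" "x < 1" for x
      using H(1)[of x] Bpos[OF that] by blast
  qed (use cont in simp_all)
  then have H1: "H 1 > 0" using H by simp
  have sH: "smooth H" by (rule smooth_antideriv[OF H(1) sB])
  define S where "S = (\<lambda>x. H x / H 1)"
  have "smooth (\<lambda>x. H x * inverse (H 1))"
    by (rule smooth_mult[OF sH smooth_const])
  then have 1: "smooth S" by (simp only: S_def divide_inverse)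
  have 2: "0 \<le> S x" for x
  proof -
    have "0 \<le> H x"
      using mono[of 0 x] left[of x] H(2) by linarith
    then show ?thesis using H1 by (simp add: S_def)
  qed
  have 3: "S x \<le> 1" for x
  proof -
    have "H x \<le> H 1"
      using mono[of x 1] right[of x] by linarith
    then show ?thesis using H1 by (simp add: S_def)
  qed
  have 4: "S x = 0" if "x \<le> 0" for x
    using left[OF that] by (simp add: S_def)
  have 5: "S x = 1" if "x \<ge> 1" for x
    unfolding S_def right[OF that] using H1 by simp
  show thesis by (rule that[of S]) (fact 1 2 3 4 5)+
qed

text \<open>
  A smooth substitute for the truncation to \<open>[0, z]\<close>. Composing with it maps test functions to test
  functions, and since its derivative lies in \<open>[0, 1]\<close> it shortens gradients. It is the
  antiderivative of a function \<open>\<theta>\<close> that equals one on \<open>[\<eta>, z - \<eta>]\<close> and vanishes outside \<open>[0, z]\<close>; at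
  each end at most \<open>\<eta>\<close> is lost against the true truncation.
\<close>

lemma smooth_clamp_exists:
  fixes z \<delta> :: real
  assumes "z > 0" "\<delta> > 0"
  obtains \<psi> :: "real \<Rightarrow> real"
  where "smooth \<psi>" "\<psi> 0 = 0" "\<And>s. 0 \<le> \<psi> s" "\<And>s. \<psi> s \<le> z"
    "\<And>s. \<bar>\<psi> s - max 0 (min z s)\<bar> \<le> \<delta>" "\<And>s. 0 \<le> grad \<psi> s" "\<And>s. grad \<psi> s \<le> 1"
proof -
  obtain S :: "real \<Rightarrow> real" where S: "smooth S" "\<And>x. 0 \<le> S x" "\<And>x. S x \<le> 1"
      "\<And>x. x \<le> 0 \<Longrightarrow> S x = 0" "\<And>x. x \<ge> 1 \<Longrightarrow> S x = 1"
    using smooth_step_exists by blast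
  define \<eta> where "\<eta> = min (\<delta> / 2) (z / 2)"
  have \<eta>: "\<eta> > 0" "2 * \<eta> \<le> \<delta>" "2 * \<eta> \<le> z"
    using assms by (auto simp: \<eta>_def min_def field_simps)
  define \<theta> where "\<theta> = (\<lambda>s. S (s * (1 / \<eta>)) * S ((z - s) * (1 / \<eta>)))"
  have s\<theta>: "smooth \<theta>"
    unfolding \<theta>_def
    by (intro smooth_mult smooth_compose[OF S(1)] smooth_diff smooth_const smooth_ident)
  have \<theta>0: "0 \<le> \<theta> s" and \<theta>1: "\<theta> s \<le> 1" for s
    using S(2,3) by (auto simp: \<theta>_def intro: mult_le_one)
  have \<theta>out: "\<theta> s = 0" if "s \<le> 0 \<or> s \<ge> z" for s
    using that S(4) \<eta> by (auto simp: \<theta>_def divide_nonpos_pos)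
  have \<theta>in: "\<theta> s = 1" if "\<eta> \<le> s" "s \<le> z - \<eta>" for s
    using that \<eta> S(5) by (auto simp: \<theta>_def field_simps)
  obtain \<psi> where \<psi>: "\<And>x. (\<psi> has_real_derivative \<theta> x) (at x)" "\<psi> 0 = 0"
    by (rule continuous_has_antiderivative[OF smooth_continuous[OF s\<theta>]]) blast
  have mono: "\<psi> x \<le> \<psi> y" if "x \<le> y" for x y
    by (rule DERIV_nonneg_imp_nondecreasing[OF that]) (use \<psi>(1) \<theta>0 in blast)
  have dmono: "x - \<psi> x \<le> y - \<psi> y" if "x \<le> y" for x y
  proof -
    have "((\<lambda>x. x - \<psi> x) has_real_derivative (1 - \<theta> x)) (at x)" for x
      by (intro DERIV_diff DERIV_ident \<psi>(1))
    then show ?thesis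
      using that \<theta>1 by (intro DERIV_nonneg_imp_nondecreasing[OF that]) (metis diff_ge_0_iff_ge)
  qed
  have left: "\<psi> s = 0" if "s \<le> 0" for s
  proof (cases "s = 0")
    case False
    have "\<psi> 0 = \<psi> s"
    proof (rule DERIV_isconst2[of s 0 \<psi>])
      show "continuous_on {s..0} \<psi>"
        by (intro continuous_at_imp_continuous_on ballI DERIV_isCont[OF \<psi>(1)])
      show "(\<psi> has_real_derivative 0) (at x)" if "s < x" "x < 0" for x
        using \<psi>(1)[of x] \<theta>out[of x] that by simp
    qed (use that False in auto)
    then show ?thesis using \<psi>(2) by simp
  qed (use \<psi>(2) in auto)
  have right: "\<psi> s = \<psi> z" if "s \<ge> z" for s
  proof (cases "s = z")
    case False
    show ?thesis
    proof (rule DERIV_isconst2[of z s \<psi>])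
      show "continuous_on {z..s} \<psi>"
        by (intro continuous_at_imp_continuous_on ballI DERIV_isCont[OF \<psi>(1)])
      show "(\<psi> has_real_derivative 0) (at x)" if "z < x" "x < s" for x
        using \<psi>(1)[of x] \<theta>out[of x] that by simp
    qed (use that False in auto)
  qed auto
  have mid: "z - \<eta> - \<psi> (z - \<eta>) \<le> \<eta> - \<psi> \<eta>"
  proof (rule DERIV_nonpos_imp_nonincreasing[where f = "\<lambda>s. s - \<psi> s"])
    fix x assume x: "\<eta> \<le> x" "x \<le> z - \<eta>"
    have "((\<lambda>x. x - \<psi> x) has_real_derivative (1 - \<theta> x)) (at x)"
      by (intro DERIV_diff DERIV_ident \<psi>(1))
    then show "\<exists>y. ((\<lambda>s. s - \<psi> s) has_real_derivative y) (at x) \<and> y \<le> 0"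
      using \<theta>in[OF x] by auto
  qed (use \<eta> in auto)
  have dz: "z - \<psi> z \<le> 2 * \<eta>"
    using mid mono[of "z - \<eta>" z] mono[of 0 \<eta>] \<psi>(2) \<eta> by simp
  show thesis
  proof
    show "smooth \<psi>" by (rule smooth_antideriv[OF \<psi>(1) s\<theta>])
    show "\<psi> 0 = 0" by (rule \<psi>(2))
    show p0: "0 \<le> \<psi> s" for s
      using mono[of 0 s] left[of s] \<psi>(2) by linarith
    show pz: "\<psi> s \<le> z" for s
      using mono[of s z] right[of s] dmono[of 0 z] \<psi>(2) assms(1) by linarith
    show "\<bar>\<psi> s - max 0 (min z s)\<bar> \<le> \<delta>" for s
    proof -
      consider "s \<le> 0" | "0 \<le> s" "s \<le> z" | "z \<le> s" by linarith
      then show ?thesis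
      proof cases
        case 1
        then show ?thesis using left[OF 1] assms by (simp add: min_def max_def)
      next
        case 2
        then show ?thesis
          using dmono[of 0 s] dmono[of s z] \<psi>(2) dz \<eta> by (simp add: min_def max_def)
      next
        case 3
        have "\<psi> s = \<psi> z" by (rule right[OF 3])
        then show ?thesis
          using 3 assms pz[of z] dz \<eta> by (simp add: min_def max_def)
      qed
    qed
    have g: "grad \<psi> s = \<theta> s" for s
      by (rule grad_eqI) (use \<psi>(1) in simp)
    show "0 \<le> grad \<psi> s" "grad \<psi> s \<le> 1" for s
      unfolding g by (rule \<theta>0 \<theta>1)+
  qed
qed

section \<open>Test functions\<close>

lemma GDERIV_eq_0_outside:
  assumes "closed K" "\<And>x. x \<notin> K \<Longrightarrow> w x = 0" "x \<notin> K"
  shows "GDERIV w x :> 0"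
proof -
  have "((\<lambda>_. 0::real) has_derivative (\<lambda>h. h \<bullet> 0)) (at x)" by simp
  then show ?thesis
    unfolding gderiv_def
    by (rule has_derivative_transform_within_open[where s = "- K"]) (use assms in auto)
qed

lemma test_functionsI:
  assumes "smooth \<phi>" "compact K" "K \<subseteq> \<Omega>" "\<And>x. x \<notin> K \<Longrightarrow> \<phi> x = 0"
  shows "\<phi> \<in> test_functions \<Omega>"
proof -
  have "closure {x. \<phi> x \<noteq> 0} \<subseteq> K"
    by (rule closure_minimal) (use assms compact_imp_closed in auto)
  moreover from this have "compact (closure {x. \<phi> x \<noteq> 0})"
    using assms(2) by (metis closed_closure compact_Int_closed inf.absorb_iff2)
  ultimately show ?thesis
    using assms by (auto simp: test_functions_def smooth_def)
qed

lemma test_functions_smooth: "\<phi> \<in> test_functions \<Omega> \<Longrightarrow> smooth \<phi>"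
  by (auto simp: test_functions_def smooth_def)

lemma test_functions_support:
  assumes "\<phi> \<in> test_functions \<Omega>"
  obtains K where "compact K" "K \<subseteq> \<Omega>" "\<And>x. x \<notin> K \<Longrightarrow> \<phi> x = 0" "\<And>x. x \<notin> K \<Longrightarrow> grad \<phi> x = 0"
proof -
  define K where "K = closure {x. \<phi> x \<noteq> 0}"
  have K: "compact K" "K \<subseteq> \<Omega>" using assms by (auto simp: test_functions_def K_def)
  have 0: "\<phi> x = 0" if "x \<notin> K" for x
    using that closure_subset[of "{x. \<phi> x \<noteq> 0}"] by (auto simp: K_def)
  have "grad \<phi> x = 0" if "x \<notin> K" for x
    by (rule grad_eqI, rule GDERIV_eq_0_outside[OF compact_imp_closed[OF K(1)] 0 that])
  with K 0 show thesis by (rule that)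
qed

lemma test_functions_zero_outside:
  assumes "\<phi> \<in> test_functions \<Omega>" "x \<notin> \<Omega>"
  shows "\<phi> x = 0" "grad \<phi> x = 0"
  using assms by (metis test_functions_support subsetD)+

lemma test_functions_GDERIV: "\<phi> \<in> test_functions \<Omega> \<Longrightarrow> GDERIV \<phi> x :> grad \<phi> x"
  by (rule smooth_GDERIV[OF test_functions_smooth])

lemma compact_support_bounded:
  fixes w :: "'a::euclidean_space \<Rightarrow> 'b::real_normed_vector"
  assumes "continuous_on UNIV w" "compact K" "\<And>x. x \<notin> K \<Longrightarrow> w x = 0"
  obtains B where "B \<ge> 0" "\<And>x. norm (w x) \<le> B"
proof -
  have "compact (w ` K)"
    by (rule compact_continuous_image[OF continuous_on_subset[OF assms(1)] assms(2)]) simp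
  then have "bounded (w ` K)" by (rule compact_imp_bounded)
  then obtain B where B: "\<And>x. x \<in> K \<Longrightarrow> norm (w x) \<le> B"
    by (auto simp: bounded_iff)
  have "norm (w x) \<le> max B 0" for x
    using B[of x] assms(3)[of x] by (cases "x \<in> K") auto
  then show thesis by (intro that[of "max B 0"]) auto
qed

lemma test_functions_bounded:
  assumes "\<phi> \<in> test_functions \<Omega>"
  obtains B where "B \<ge> 0" "\<And>x. \<bar>\<phi> x\<bar> \<le> B" "\<And>x. norm (grad \<phi> x) \<le> B"
proof -
  obtain K where K: "compact K" "K \<subseteq> \<Omega>" "\<And>x. x \<notin> K \<Longrightarrow> \<phi> x = 0" "\<And>x. x \<notin> K \<Longrightarrow> grad \<phi> x = 0"
    using test_functions_support[OF assms] by blast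
  have s: "smooth \<phi>" by (rule test_functions_smooth[OF assms])
  obtain B1 where B1: "B1 \<ge> 0" "\<And>x. norm (\<phi> x) \<le> B1"
    using compact_support_bounded[OF smooth_continuous[OF s] K(1,3)] by blast
  obtain B2 where B2: "B2 \<ge> 0" "\<And>x. norm (grad \<phi> x) \<le> B2"
    using compact_support_bounded[OF smooth_grad_continuous[OF s] K(1,4)] by blast
  show thesis
  proof (rule that[of "max B1 B2"])
    show "0 \<le> max B1 B2" using B1(1) by simp
    show "\<bar>\<phi> x\<bar> \<le> max B1 B2" for x using B1(2)[of x] by simp
    show "norm (grad \<phi> x) \<le> max B1 B2" for x using B2(2)[of x] by simp
  qed
qed

lemma test_functions_add:
  assumes "\<phi> \<in> test_functions \<Omega>" "\<psi> \<in> test_functions \<Omega>"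
  shows "(\<lambda>x. c * \<phi> x + d * \<psi> x) \<in> test_functions \<Omega>"
    and "grad (\<lambda>x. c * \<phi> x + d * \<psi> x) x = c *\<^sub>R grad \<phi> x + d *\<^sub>R grad \<psi> x"
proof -
  obtain K where K: "compact K" "K \<subseteq> \<Omega>" "\<And>x. x \<notin> K \<Longrightarrow> \<phi> x = 0"
      "\<And>x. x \<notin> K \<Longrightarrow> grad \<phi> x = 0"
    using test_functions_support[OF assms(1)] by blast
  obtain L where L: "compact L" "L \<subseteq> \<Omega>" "\<And>x. x \<notin> L \<Longrightarrow> \<psi> x = 0"
      "\<And>x. x \<notin> L \<Longrightarrow> grad \<psi> x = 0"
    using test_functions_support[OF assms(2)] by blast
  show "(\<lambda>x. c * \<phi> x + d * \<psi> x) \<in> test_functions \<Omega>"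
  proof (rule test_functionsI[where K = "K \<union> L"])
    show "smooth (\<lambda>x. c * \<phi> x + d * \<psi> x)"
      by (intro smooth_add smooth_mult smooth_const assms[THEN test_functions_smooth])
    show "compact (K \<union> L)" using K(1) L(1) by (rule compact_Un)
    show "K \<union> L \<subseteq> \<Omega>" using K(2) L(2) by simp
    show "c * \<phi> x + d * \<psi> x = 0" if "x \<notin> K \<union> L" for x
      using that K(3)[of x] L(3)[of x] by simp
  qed
  show "grad (\<lambda>x. c * \<phi> x + d * \<psi> x) x = c *\<^sub>R grad \<phi> x + d *\<^sub>R grad \<psi> x"
  proof (rule grad_eqI)
    have "GDERIV (\<lambda>x. c * \<phi> x + d * \<psi> x) x
        :> (c *\<^sub>R grad \<phi> x + \<phi> x *\<^sub>R 0) + (d *\<^sub>R grad \<psi> x + \<psi> x *\<^sub>R 0)"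
      by (rule GDERIV_add[OF GDERIV_mult[OF GDERIV_const test_functions_GDERIV[OF assms(1)]]
            GDERIV_mult[OF GDERIV_const test_functions_GDERIV[OF assms(2)]]])
    then show "GDERIV (\<lambda>x. c * \<phi> x + d * \<psi> x) x :> c *\<^sub>R grad \<phi> x + d *\<^sub>R grad \<psi> x"
      unfolding scaleR_zero_right add_0_right .
  qed
qed

lemma test_functions_scale:
  assumes "\<phi> \<in> test_functions \<Omega>"
  shows "(\<lambda>x. c * \<phi> x) \<in> test_functions \<Omega>" "grad (\<lambda>x. c * \<phi> x) x = c *\<^sub>R grad \<phi> x"
  using test_functions_add[OF assms assms, of c 0] by simp_all

lemma test_functions_compose:
  assumes "\<phi> \<in> test_functions \<Omega>" "smooth \<psi>" "\<psi> 0 = (0::real)"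
  shows "(\<lambda>x. \<psi> (\<phi> x)) \<in> test_functions \<Omega>"
    and "grad (\<lambda>x. \<psi> (\<phi> x)) x = grad \<psi> (\<phi> x) *\<^sub>R grad \<phi> x"
proof -
  obtain K where K: "compact K" "K \<subseteq> \<Omega>" "\<And>x. x \<notin> K \<Longrightarrow> \<phi> x = 0"
      "\<And>x. x \<notin> K \<Longrightarrow> grad \<phi> x = 0"
    using test_functions_support[OF assms(1)] by blast
  show "(\<lambda>x. \<psi> (\<phi> x)) \<in> test_functions \<Omega>"
  proof (rule test_functionsI[OF smooth_compose[OF assms(2) test_functions_smooth[OF assms(1)]] K(1,2)])
    show "\<psi> (\<phi> x) = 0" if "x \<notin> K" for x using K(3)[OF that] assms(3) by simp
  qed
  show "grad (\<lambda>x. \<psi> (\<phi> x)) x = grad \<psi> (\<phi> x) *\<^sub>R grad \<phi> x"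
    by (rule grad_eqI[OF GDERIV_DERIV_compose[OF test_functions_GDERIV[OF assms(1)]
            smooth_GDERIV[OF assms(2), unfolded gderiv_deriv]]])
qed

text \<open>
  Finitely many bumps, each positive on a ball around a point of \<open>K\<close>, add up to a function that is
  bounded below on \<open>K\<close> by some \<open>c > 0\<close>. The smooth step turns the values above \<open>c\<close> into one.
\<close>

lemma smooth_cutoff_exists:
  fixes K U :: "'a::euclidean_space set"
  assumes "compact K" "open U" "K \<subseteq> U"
  obtains \<kappa> :: "'a \<Rightarrow> real"
  where "\<kappa> \<in> test_functions U" "\<And>x. 0 \<le> \<kappa> x" "\<And>x. \<kappa> x \<le> 1" "\<And>x. x \<in> K \<Longrightarrow> \<kappa> x = 1"
proof -
  obtain S :: "real \<Rightarrow> real" where S: "smooth S" "\<And>x. 0 \<le> S x" "\<And>x. S x \<le> 1"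
      "\<And>x. x \<le> 0 \<Longrightarrow> S x = 0" "\<And>x. x \<ge> 1 \<Longrightarrow> S x = 1"
    using smooth_step_exists by blast
  have "\<forall>x\<in>K. \<exists>r>0. cball x r \<subseteq> U"
  proof
    fix x assume "x \<in> K"
    then have "x \<in> U" using assms(3) by (rule subsetD[rotated])
    with assms(2) show "\<exists>r>0. cball x r \<subseteq> U" unfolding open_contains_cball by (rule bspec)
  qed
  then obtain r where r: "\<forall>x\<in>K. r x > 0 \<and> cball x (r x) \<subseteq> U"
    by (rule bchoice[THEN exE])
  obtain D where D: "D \<subseteq> K" "finite D" "K \<subseteq> (\<Union>x\<in>D. ball x (r x))"
    by (rule compactE_image[OF assms(1), of K "\<lambda>x. ball x (r x)"]) (use r in auto)
  define q where "q = (\<lambda>x y::'a. \<Sum>b\<in>Basis. (y \<bullet> b - x \<bullet> b) * (y \<bullet> b - x \<bullet> b))"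
  have q: "q x y = (dist x y)\<^sup>2" for x y
  proof -
    have "q x y = (y - x) \<bullet> (y - x)"
      by (subst euclidean_inner) (simp add: q_def inner_diff_left)
    then show ?thesis by (simp add: dot_square_norm dist_norm norm_minus_commute[of x y])
  qed
  have sq: "smooth (q x)" for x
    unfolding q_def by (intro smooth_sum smooth_mult smooth_diff smooth_inner smooth_const) simp
  define b where "b = (\<lambda>y. \<Sum>x\<in>D. flat 1 ((r x)\<^sup>2 - q x y))"
  have sb: "smooth b"
    unfolding b_def
    by (intro smooth_sum D(2) smooth_compose[OF smooth_flat] smooth_diff smooth_const sq)
  have flat_nn: "0 \<le> flat 1 t" for t by (simp add: flat_def)
  have bpos: "b y > 0" if y: "y \<in> K" for y
  proof -
    obtain x where x: "x \<in> D" "dist x y < r x" using D(3) y by auto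
    then have "(dist x y)\<^sup>2 < (r x)\<^sup>2" by (simp add: power_strict_mono)
    then have "0 < flat 1 ((r x)\<^sup>2 - q x y)" by (simp add: flat_def q)
    also have "\<dots> \<le> b y"
      unfolding b_def by (rule member_le_sum[OF x(1) flat_nn D(2)])
    finally show ?thesis .
  qed
  have bout: "b y = 0" if "y \<notin> (\<Union>x\<in>D. cball x (r x))" for y
    unfolding b_def
  proof (rule sum.neutral, rule ballI)
    fix x assume x: "x \<in> D"
    then have "r x < dist x y" "0 < r x" using that r D(1) by auto
    then have "(r x)\<^sup>2 \<le> q x y" by (simp add: q power_mono)
    then show "flat 1 ((r x)\<^sup>2 - q x y) = 0" by (simp add: flat_def)
  qed
  obtain c where c: "c > 0" "\<And>y. y \<in> K \<Longrightarrow> c \<le> b y"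
  proof (cases "K = {}")
    case False
    obtain y where "y \<in> K" "\<forall>x\<in>K. b y \<le> b x"
      using continuous_attains_inf[OF assms(1) False smooth_continuous[OF sb]] by blast
    with bpos show thesis by (intro that[of "b y"]) auto
  qed (use that[of 1] in auto)
  have C: "compact (\<Union>x\<in>D. cball x (r x))" using D(2) by (intro compact_UN) auto
  have CU: "(\<Union>x\<in>D. cball x (r x)) \<subseteq> U" using r D(1) by blast
  show thesis
  proof
    show "(\<lambda>y. S (b y * (1 / c))) \<in> test_functions U"
    proof (rule test_functionsI[OF smooth_compose[OF S(1) smooth_mult[OF sb smooth_const]] C CU])
      show "S (b y * (1 / c)) = 0" if "y \<notin> (\<Union>x\<in>D. cball x (r x))" for y
        using bout[OF that] S(4)[of 0] by simp
    qed
    show "0 \<le> S (b x * (1 / c))" "S (b x * (1 / c)) \<le> 1" for x using S by auto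
    show "S (b x * (1 / c)) = 1" if "x \<in> K" for x
      using c(2)[OF that] c(1) by (intro S(5)) (simp add: field_simps)
  qed
qed

lemma integrable_indicator_bounded:
  fixes A :: "'a::euclidean_space set"
  assumes "bounded A" "A \<in> sets borel"
  shows "integrable lborel (indicator A :: 'a \<Rightarrow> real)"
  using emeasure_bounded_finite[OF assms(1)] assms(2)
  by (intro integrable_real_indicator) simp_all

section \<open>Translations and averages of compactly supported functions\<close>

text \<open>
  Instances are the test functions and the products of two test functions; the latter give the
  integration by parts formula.
\<close>

locale compactly_supported_C1 =
  fixes w :: "'a::euclidean_space \<Rightarrow> real" and g :: "'a \<Rightarrow> 'a" and K :: "'a set"
  assumes deriv: "GDERIV w x :> g x"
    and cont_grad: "continuous_on UNIV g"
    and compact_supp: "compact K"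
    and zero_outside: "x \<notin> K \<Longrightarrow> w x = 0"
begin

lemma cont: "continuous_on UNIV w"
proof (intro continuous_at_imp_continuous_on ballI)
  show "isCont w x" for x
    using deriv[of x] unfolding gderiv_def by (rule has_derivative_continuous)
qed

lemma grad_zero_outside: "x \<notin> K \<Longrightarrow> g x = 0"
  using GDERIV_unique[OF deriv GDERIV_eq_0_outside[OF compact_imp_closed[OF compact_supp] zero_outside]]
  by blast

lemma borel [measurable]: "w \<in> borel_measurable borel" "g \<in> borel_measurable borel"
  by (intro borel_measurable_continuous_onI cont cont_grad)+

lemma integrable_compact_supp:
  fixes v :: "'a \<Rightarrow> 'b::euclidean_space"
  assumes "continuous_on UNIV v" "compact L" "\<And>x. x \<notin> L \<Longrightarrow> v x = 0"
  shows "integrable lborel v"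
proof -
  have "integrable lborel (\<lambda>x. indicator L x *\<^sub>R v x)"
    by (rule borel_integrable_compact[OF assms(2) continuous_on_subset[OF assms(1)]]) simp
  moreover have "(\<lambda>x. indicator L x *\<^sub>R v x) = v"
    using assms(3) by (auto simp: fun_eq_iff indicator_def)
  ultimately show ?thesis by simp
qed

lemma integrable_w: "integrable lborel w" and integrable_g: "integrable lborel g"
  by (rule integrable_compact_supp[OF cont compact_supp zero_outside], assumption,
      rule integrable_compact_supp[OF cont_grad compact_supp grad_zero_outside])

lemma grad_bounded:
  obtains B where "B \<ge> 0" "\<And>x. norm (g x) \<le> B"
  by (rule compact_support_bounded[OF cont_grad compact_supp grad_zero_outside]) blast+

lemma lipschitz:
  assumes "\<And>x. norm (g x) \<le> B"
  shows "\<bar>w y - w x\<bar> \<le> B * norm (y - x)"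
proof -
  have "norm (w y - w x) \<le> B * norm (y - x)"
  proof (rule differentiable_bound[where S = UNIV and f' = "\<lambda>x h. h \<bullet> g x"])
    show "(w has_derivative (\<lambda>h. h \<bullet> g x)) (at x within UNIV)" for x
      using deriv[of x] unfolding gderiv_def .
    show "onorm (\<lambda>h. h \<bullet> g x) \<le> B" for x
    proof (rule onorm_le)
      fix h
      have "norm (h \<bullet> g x) \<le> norm h * norm (g x)" by (simp add: Cauchy_Schwarz_ineq2)
      also have "\<dots> \<le> norm h * B" by (intro mult_left_mono assms norm_ge_zero)
      finally show "norm (h \<bullet> g x) \<le> B * norm h" by (simp add: mult.commute)
    qed
  qed auto
  then show ?thesis by simp
qed

lemma lborel_integral_shift:
  fixes v :: "'a \<Rightarrow> 'b::euclidean_space"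
  assumes [measurable]: "v \<in> borel_measurable borel"
  shows "(LINT x|lborel. v (x + z)) = (LINT x|lborel. v x)"
    and "integrable lborel v \<Longrightarrow> integrable lborel (\<lambda>x. v (x + z))"
proof -
  have d: "distr lborel borel (\<lambda>x. x + z) = (lborel :: 'a measure)"
  proof -
    have "(\<lambda>x. x + z) = (+) z" by (simp add: fun_eq_iff add.commute)
    then show ?thesis using lborel_distr_plus[of z] by simp
  qed
  show "(LINT x|lborel. v (x + z)) = (LINT x|lborel. v x)"
    by (subst (2) d[symmetric], subst integral_distr) auto
  show "integrable lborel (\<lambda>x. v (x + z))" if "integrable lborel v"
    using that by (subst (asm) d[symmetric], subst (asm) integrable_distr_eq) auto
qed

definition quot :: "'a \<Rightarrow> nat \<Rightarrow> 'a \<Rightarrow> real" where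
  "quot z n x = real (Suc n) * (w (x + z /\<^sub>R real (Suc n)) - w x)"

lemma quot_tendsto: "(\<lambda>n. quot z n x) \<longlonglongrightarrow> z \<bullet> g x"
proof -
  have "((\<lambda>t. w (x + t *\<^sub>R z)) has_derivative (\<lambda>t. (t *\<^sub>R z) \<bullet> g x)) (at 0)"
  proof (rule has_derivative_compose[where g = w and f = "\<lambda>t. x + t *\<^sub>R z" and f' = "\<lambda>t. t *\<^sub>R z"
        and g' = "\<lambda>h. h \<bullet> g x"])
    show "((\<lambda>t. x + t *\<^sub>R z) has_derivative (\<lambda>t. t *\<^sub>R z)) (at 0)"
      by (auto intro!: derivative_eq_intros)
    show "(w has_derivative (\<lambda>h. h \<bullet> g x)) (at (x + 0 *\<^sub>R z))"
      using deriv[of x] by (simp add: gderiv_def)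
  qed
  then have "DERIV (\<lambda>t. w (x + t *\<^sub>R z)) 0 :> z \<bullet> g x"
    by (simp add: has_field_derivative_def mult_commute_abs)
  then have lim: "((\<lambda>h. (w (x + h *\<^sub>R z) - w x) / h) \<longlongrightarrow> z \<bullet> g x) (at 0)"
    by (simp add: DERIV_def)
  have "filterlim (\<lambda>n. inverse (real (Suc n))) (at 0) sequentially"
    unfolding filterlim_at using LIMSEQ_inverse_real_of_nat by simp
  from filterlim_compose[OF lim this] show ?thesis
    by (simp add: quot_def field_simps)
qed

text \<open>
  The quotients are dominated by the Lipschitz constant on a ball that contains the support of every
  translate involved.
\<close>

lemma quot_integrals:
  shows "(\<lambda>n. LINT x|lborel. quot z n x) \<longlonglongrightarrow> (LINT x|lborel. z \<bullet> g x)"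
    and "(\<lambda>n. LINT x|lborel. \<bar>quot z n x\<bar>) \<longlonglongrightarrow> (LINT x|lborel. \<bar>z \<bullet> g x\<bar>)"
proof -
  obtain B where B: "B \<ge> 0" "\<And>x. norm (g x) \<le> B" using grad_bounded by blast
  obtain R where R: "\<And>x. x \<in> K \<Longrightarrow> norm x \<le> R"
    using compact_imp_bounded[OF compact_supp] by (auto simp: bounded_iff)
  define L where "L = cball (0::'a) (R + norm z)"
  have bound: "norm (quot z n x) \<le> B * norm z * indicator L x" for n x
  proof (cases "x \<in> L")
    case True
    have "\<bar>quot z n x\<bar> = real (Suc n) * \<bar>w (x + z /\<^sub>R real (Suc n)) - w x\<bar>"
      by (simp add: quot_def abs_mult)
    also have "\<dots> \<le> real (Suc n) * (B * norm (x + z /\<^sub>R real (Suc n) - x))"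
      by (intro mult_left_mono lipschitz B(2)) simp
    also have "\<dots> = B * norm z" by simp
    finally show ?thesis using True by simp
  next
    case False
    then have xL: "R + norm z < norm x" by (simp add: L_def)
    then have "x \<notin> K" using R[of x] norm_ge_zero[of z] by linarith
    moreover have "x + z /\<^sub>R real (Suc n) \<notin> K"
    proof
      assume "x + z /\<^sub>R real (Suc n) \<in> K"
      then have "norm (x + z /\<^sub>R real (Suc n)) \<le> R" by (rule R)
      moreover have "norm (z /\<^sub>R real (Suc n)) \<le> norm z"
        by (simp add: divide_le_eq field_simps mult_left_le)
      moreover have "norm x \<le> norm (x + z /\<^sub>R real (Suc n)) + norm (z /\<^sub>R real (Suc n))"
        using norm_triangle_ineq4[of "x + z /\<^sub>R real (Suc n)" "z /\<^sub>R real (Suc n)"] by simp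
      ultimately show False using xL by linarith
    qed
    ultimately show ?thesis using False by (simp add: quot_def zero_outside)
  qed
  have dom: "integrable lborel (\<lambda>x. B * norm z * indicator L x)"
    by (intro integrable_mult_right integrable_indicator_bounded) (simp_all add: L_def)
  have m: "quot z n \<in> borel_measurable lborel" for n
    unfolding quot_def by measurable
  have mg: "(\<lambda>x. z \<bullet> g x) \<in> borel_measurable lborel" by measurable
  show "(\<lambda>n. LINT x|lborel. quot z n x) \<longlonglongrightarrow> (LINT x|lborel. z \<bullet> g x)"
    by (rule integral_dominated_convergence[OF mg m dom]) (use quot_tendsto bound in auto)
  have ma: "(\<lambda>x. \<bar>quot z n x\<bar>) \<in> borel_measurable lborel" for n
    using m[of n] by measurable
  show "(\<lambda>n. LINT x|lborel. \<bar>quot z n x\<bar>) \<longlonglongrightarrow> (LINT x|lborel. \<bar>z \<bullet> g x\<bar>)"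
    by (rule integral_dominated_convergence[OF _ ma dom])
      (use quot_tendsto bound mg in \<open>auto intro!: tendsto_rabs\<close>)
qed

lemma integrable_shift_diff: "integrable lborel (\<lambda>x. w (x + z) - w x)"
  by (intro Bochner_Integration.integrable_diff lborel_integral_shift(2) integrable_w borel)

text \<open>
  The difference quotients have integral zero because Lebesgue measure is translation invariant.
\<close>

lemma integral_grad_eq_0: "(LINT x|lborel. g x) = 0"
proof (rule euclidean_eqI)
  fix b :: 'a assume "b \<in> Basis"
  have "(LINT x|lborel. quot b n x) = 0" for n
    unfolding quot_def
    by (simp add: lborel_integral_shift integrable_w)
  then have "(LINT x|lborel. b \<bullet> g x) = 0"
    using quot_integrals(1)[of b] by (simp add: LIMSEQ_const_iff)
  then show "(LINT x|lborel. g x) \<bullet> b = 0 \<bullet> b"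
    by (simp add: integrable_g inner_commute)
qed

text \<open>
  Going from \<open>x\<close> to \<open>x + z\<close> in \<open>n + 1\<close> equal steps and using translation invariance for each step bounds
  the left-hand side by the integral of \<open>\<bar>quot z n\<bar>\<close>, which tends to \<open>\<integral> \<bar>z \<bullet> g\<bar>\<close>.
\<close>

lemma translation_le:
  "(LINT x|lborel. \<bar>w (x + z) - w x\<bar>) \<le> norm z * (LINT x|lborel. norm (g x))"
proof -
  have sub: "(LINT x|lborel. \<bar>w (x + z) - w x\<bar>) \<le> (LINT x|lborel. \<bar>quot z n x\<bar>)" for n
  proof -
    define y where "y = z /\<^sub>R real (Suc n)"
    have z: "z = real (Suc n) *\<^sub>R y" by (simp add: y_def)
    have step: "(LINT x|lborel. \<bar>w (x + real (Suc i) *\<^sub>R y) - w (x + real i *\<^sub>R y)\<bar>)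
        = (LINT x|lborel. \<bar>w (x + y) - w x\<bar>)" for i
      using lborel_integral_shift(1)[of "\<lambda>x. \<bar>w (x + y) - w x\<bar>" "real i *\<^sub>R y"]
      by (simp add: algebra_simps)
    have int: "integrable lborel (\<lambda>x. \<bar>w (x + real (Suc i) *\<^sub>R y) - w (x + real i *\<^sub>R y)\<bar>)" for i
      by (intro Bochner_Integration.integrable_diff lborel_integral_shift(2) integrable_w borel integrable_abs)
    have "(LINT x|lborel. \<bar>w (x + z) - w x\<bar>)
        \<le> (LINT x|lborel. (\<Sum>i<Suc n. \<bar>w (x + real (Suc i) *\<^sub>R y) - w (x + real i *\<^sub>R y)\<bar>))"
    proof (rule integral_mono)
      show "integrable lborel (\<lambda>x. \<bar>w (x + z) - w x\<bar>)"
        by (intro integrable_abs integrable_shift_diff)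
      show "integrable lborel (\<lambda>x. \<Sum>i<Suc n. \<bar>w (x + real (Suc i) *\<^sub>R y) - w (x + real i *\<^sub>R y)\<bar>)"
        by (intro Bochner_Integration.integrable_sum int)
      fix x
      have "w (x + z) - w x = (\<Sum>i<Suc n. w (x + real (Suc i) *\<^sub>R y) - w (x + real i *\<^sub>R y))"
        by (subst sum_lessThan_telescope) (simp add: z)
      then show "\<bar>w (x + z) - w x\<bar> \<le> (\<Sum>i<Suc n. \<bar>w (x + real (Suc i) *\<^sub>R y) - w (x + real i *\<^sub>R y)\<bar>)"
        by (simp only: sum_abs)
    qed
    also have "\<dots> = real (Suc n) * (LINT x|lborel. \<bar>w (x + y) - w x\<bar>)"
      by (subst Bochner_Integration.integral_sum[OF int]) (simp only: step, simp)
    also have "\<dots> = (LINT x|lborel. \<bar>quot z n x\<bar>)"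
      by (simp add: quot_def abs_mult y_def)
    finally show ?thesis .
  qed
  have "(LINT x|lborel. \<bar>w (x + z) - w x\<bar>) \<le> (LINT x|lborel. \<bar>z \<bullet> g x\<bar>)"
    by (rule LIMSEQ_le_const[OF quot_integrals(2)]) (use sub in blast)
  also have "\<dots> \<le> (LINT x|lborel. norm z * norm (g x))"
    by (rule integral_mono) (auto intro!: integrable_abs integrable_norm integrable_g Cauchy_Schwarz_ineq2)
  finally show ?thesis by simp
qed

definition box_average :: "real \<Rightarrow> 'a \<Rightarrow> real" where
  "box_average h x = (LINT y|lborel. indicator (cbox 0 (h *\<^sub>R One)) y * w (x + y)) / measure lborel (cbox 0 (h *\<^sub>R One :: 'a))"

lemma content_box_pos: "h > 0 \<Longrightarrow> measure lborel (cbox 0 (h *\<^sub>R One :: 'a)) > 0"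
  by (rule content_pos_lt) simp

lemma integrable_shift_box:
  "integrable lborel (\<lambda>y. indicator (cbox 0 (h *\<^sub>R One)) y * w (x + y))"
proof -
  have "integrable lborel (\<lambda>y. indicator (cbox 0 (h *\<^sub>R One)) y *\<^sub>R w (y + x))"
    by (intro integrable_mult_indicator lborel_integral_shift(2) integrable_w borel) simp
  then show ?thesis by (simp add: add.commute)
qed

lemma box_average_bound:
  assumes "h > 0" "\<And>x. \<bar>w x\<bar> \<le> z"
  shows "\<bar>box_average h x\<bar> \<le> z"
proof -
  let ?Q = "cbox 0 (h *\<^sub>R One :: 'a)"
  have "\<bar>LINT y|lborel. indicator ?Q y * w (x + y)\<bar> \<le> (LINT y|lborel. z * indicator ?Q y)"
    by (rule integral_abs_bound_integral[OF integrable_shift_box])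
      (use assms(2) in \<open>auto split: split_indicator intro!: integrable_mult_right integrable_indicator_bounded\<close>)
  also have "\<dots> = z * measure lborel ?Q" by simp
  finally show ?thesis
    using content_box_pos[OF assms(1)] by (simp add: box_average_def abs_divide divide_le_eq)
qed

text \<open>
  The Lipschitz constant depends on \<open>w\<close> only through the integral of the gradient. This is the
  equicontinuity from which compactness is derived.
\<close>

lemma box_average_lipschitz:
  assumes "h > 0"
  shows "\<bar>box_average h x - box_average h x'\<bar> \<le> norm (x - x') * ((LINT x|lborel. norm (g x)) / measure lborel (cbox 0 (h *\<^sub>R One :: 'a)))"
proof -
  let ?Q = "cbox 0 (h *\<^sub>R One :: 'a)"
  have i1: "integrable lborel (\<lambda>y. indicator ?Q y * w (x + y) - indicator ?Q y * w (x' + y))"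
    by (intro Bochner_Integration.integrable_diff integrable_shift_box)
  have m: "(\<lambda>y. \<bar>w (y + (x - x')) - w y\<bar>) \<in> borel_measurable borel" by measurable
  have "integrable lborel (\<lambda>y. \<bar>w (y + x' + (x - x')) - w (y + x')\<bar>)"
    by (rule lborel_integral_shift(2)[OF m, of x']) (intro integrable_abs integrable_shift_diff)
  then have i2: "integrable lborel (\<lambda>y. \<bar>w (x + y) - w (x' + y)\<bar>)" by (simp add: add.commute)
  have "\<bar>(LINT y|lborel. indicator ?Q y * w (x + y)) - (LINT y|lborel. indicator ?Q y * w (x' + y))\<bar>
      = \<bar>LINT y|lborel. (indicator ?Q y * w (x + y) - indicator ?Q y * w (x' + y))\<bar>"
    by (simp add: integrable_shift_box)
  also have "\<dots> \<le> (LINT y|lborel. \<bar>w (x + y) - w (x' + y)\<bar>)"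
    by (rule integral_abs_bound_integral[OF i1 i2]) (auto simp: indicator_def)
  also have "\<dots> = (LINT y|lborel. \<bar>w (y + (x - x')) - w y\<bar>)"
    using lborel_integral_shift(1)[OF m, of x'] by (simp add: add.commute)
  also have "\<dots> \<le> norm (x - x') * (LINT x|lborel. norm (g x))" by (rule translation_le)
  finally show ?thesis
    using content_box_pos[OF assms]
    by (simp add: box_average_def flip: diff_divide_distrib) (simp add: divide_right_mono)
qed

lemma box_average_continuous:
  assumes "h > 0" shows "continuous_on UNIV (box_average h)"
proof -
  let ?C = "(LINT x|lborel. norm (g x)) / measure lborel (cbox 0 (h *\<^sub>R One :: 'a))"
  have C: "?C \<ge> 0" by simp
  have "lipschitz_on ?C UNIV (box_average h)"
    by (rule lipschitz_onI[OF _ C])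
      (use box_average_lipschitz[OF assms] in \<open>simp add: dist_norm mult.commute\<close>)
  then show ?thesis by (rule lipschitz_on_continuous_on)
qed

text \<open>
  By Tonelli the left-hand side is at most an average over the box of the integrals bounded in
  \<open>translation_le\<close>.
\<close>

lemma box_average_L1_close:
  assumes h: "h > 0"
  shows "(\<integral>\<^sup>+x. \<bar>box_average h x - w x\<bar> \<partial>lborel) \<le> ennreal (h * norm (One::'a) * (LINT x|lborel. norm (g x)))"
proof -
  let ?Q = "cbox 0 (h *\<^sub>R One :: 'a)" and ?G = "LINT x|lborel. norm (g x)"
  define \<mu> where "\<mu> = measure lborel ?Q"
  have \<mu>: "\<mu> > 0" unfolding \<mu>_def by (rule content_box_pos[OF h])
  have m0 [measurable]: "?Q \<in> sets borel" by simp
  have pt: "ennreal \<bar>box_average h x - w x\<bar> \<le> (\<integral>\<^sup>+y. ennreal (indicator ?Q y / \<mu> * \<bar>w (x + y) - w x\<bar>) \<partial>lborel)" for x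
  proof -
    have i: "integrable lborel (\<lambda>y. indicator ?Q y * w x)"
      by (intro integrable_mult_left integrable_indicator_bounded) simp_all
    have i3: "integrable lborel (\<lambda>y. (indicator ?Q y * w (x + y) - indicator ?Q y * w x) / \<mu>)"
      by (intro integrable_divide Bochner_Integration.integrable_diff integrable_shift_box i)
    have eq: "box_average h x - w x = (LINT y|lborel. (indicator ?Q y * w (x + y) - indicator ?Q y * w x) / \<mu>)"
    proof -
      have "(LINT y|lborel. indicator ?Q y * w x) = \<mu> * w x" by (simp add: \<mu>_def)
      then have "(LINT y|lborel. (indicator ?Q y * w (x + y) - indicator ?Q y * w x) / \<mu>)
          = ((LINT y|lborel. indicator ?Q y * w (x + y)) - \<mu> * w x) / \<mu>"
        by (simp only: integral_divide_zero Bochner_Integration.integral_diff[OF integrable_shift_box i])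
      then show ?thesis using \<mu> by (simp add: box_average_def \<mu>_def diff_divide_distrib)
    qed
    have "\<bar>box_average h x - w x\<bar> \<le> (LINT y|lborel. \<bar>(indicator ?Q y * w (x + y) - indicator ?Q y * w x) / \<mu>\<bar>)"
      unfolding eq by (rule integral_abs_bound)
    also have "\<dots> = (LINT y|lborel. indicator ?Q y / \<mu> * \<bar>w (x + y) - w x\<bar>)"
      using \<mu> by (intro Bochner_Integration.integral_cong) (auto simp: indicator_def)
    finally have "\<bar>box_average h x - w x\<bar> \<le> (LINT y|lborel. indicator ?Q y / \<mu> * \<bar>w (x + y) - w x\<bar>)" .
    moreover have "(\<integral>\<^sup>+y. ennreal (indicator ?Q y / \<mu> * \<bar>w (x + y) - w x\<bar>) \<partial>lborel)
        = ennreal (LINT y|lborel. indicator ?Q y / \<mu> * \<bar>w (x + y) - w x\<bar>)"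
    proof (rule nn_integral_eq_integral)
      have "integrable lborel (\<lambda>y. \<bar>(indicator ?Q y * w (x + y) - indicator ?Q y * w x) / \<mu>\<bar>)"
        by (rule integrable_abs[OF i3])
      moreover have "\<bar>(indicator ?Q y * w (x + y) - indicator ?Q y * w x) / \<mu>\<bar>
          = indicator ?Q y / \<mu> * \<bar>w (x + y) - w x\<bar>" for y
        using \<mu> by (auto simp: indicator_def)
      ultimately show "integrable lborel (\<lambda>y. indicator ?Q y / \<mu> * \<bar>w (x + y) - w x\<bar>)" by simp
    qed (use \<mu> in auto)
    ultimately show ?thesis by (simp add: ennreal_leI)
  qed
  have mF: "(\<lambda>(x, y). ennreal (indicator ?Q y / \<mu> * \<bar>w (x + y) - w x\<bar>)) \<in> borel_measurable (lborel \<Otimes>\<^sub>M lborel)"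
    unfolding split_beta' by measurable
  have shift_nn: "(\<integral>\<^sup>+x. ennreal \<bar>w (x + y) - w x\<bar> \<partial>lborel) \<le> ennreal (norm y * ?G)" for y
    by (subst nn_integral_eq_integral[OF integrable_abs[OF integrable_shift_diff]])
      (auto intro!: ennreal_leI translation_le)
  have norm_box: "norm y \<le> h * norm (One::'a)" if "y \<in> ?Q" for y
  proof -
    have "norm y \<le> norm (h *\<^sub>R One :: 'a)"
      by (rule norm_le_componentwise) (use that h in \<open>auto simp: mem_box\<close>)
    then show ?thesis using h by simp
  qed
  have "(\<integral>\<^sup>+x. \<bar>box_average h x - w x\<bar> \<partial>lborel)
      \<le> (\<integral>\<^sup>+x. (\<integral>\<^sup>+y. ennreal (indicator ?Q y / \<mu> * \<bar>w (x + y) - w x\<bar>) \<partial>lborel) \<partial>lborel)"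
    by (intro nn_integral_mono pt)
  also have "\<dots> = (\<integral>\<^sup>+y. (\<integral>\<^sup>+x. ennreal (indicator ?Q y / \<mu> * \<bar>w (x + y) - w x\<bar>) \<partial>lborel) \<partial>lborel)"
    by (rule lborel_pair.Fubini'[OF mF, symmetric])
  also have "\<dots> = (\<integral>\<^sup>+y. ennreal (indicator ?Q y / \<mu>) * (\<integral>\<^sup>+x. ennreal \<bar>w (x + y) - w x\<bar> \<partial>lborel) \<partial>lborel)"
  proof (rule nn_integral_cong)
    fix y :: 'a
    have "ennreal (indicator ?Q y / \<mu> * \<bar>w (x + y) - w x\<bar>)
        = ennreal (indicator ?Q y / \<mu>) * ennreal \<bar>w (x + y) - w x\<bar>" for x
      using \<mu> by (intro ennreal_mult) auto
    then show "(\<integral>\<^sup>+x. ennreal (indicator ?Q y / \<mu> * \<bar>w (x + y) - w x\<bar>) \<partial>lborel)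
        = ennreal (indicator ?Q y / \<mu>) * (\<integral>\<^sup>+x. ennreal \<bar>w (x + y) - w x\<bar> \<partial>lborel)"
      by (simp only:) (rule nn_integral_cmult, measurable)
  qed
  also have "\<dots> \<le> (\<integral>\<^sup>+y. ennreal (h * norm (One::'a) * ?G / \<mu>) * indicator ?Q y \<partial>lborel)"
  proof (rule nn_integral_mono)
    fix y :: 'a
    show "ennreal (indicator ?Q y / \<mu>) * (\<integral>\<^sup>+x. ennreal \<bar>w (x + y) - w x\<bar> \<partial>lborel)
        \<le> ennreal (h * norm (One::'a) * ?G / \<mu>) * indicator ?Q y"
    proof (cases "y \<in> ?Q")
      case True
      have "(\<integral>\<^sup>+x. ennreal \<bar>w (x + y) - w x\<bar> \<partial>lborel) \<le> ennreal (h * norm (One::'a) * ?G)"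
        by (rule order_trans[OF shift_nn ennreal_leI[OF mult_right_mono[OF norm_box[OF True]]]]) simp
      then have "ennreal (1 / \<mu>) * (\<integral>\<^sup>+x. ennreal \<bar>w (x + y) - w x\<bar> \<partial>lborel)
          \<le> ennreal (1 / \<mu>) * ennreal (h * norm (One::'a) * ?G)" by (rule mult_left_mono) simp
      also have "\<dots> = ennreal (h * norm (One::'a) * ?G / \<mu>)"
        using \<mu> h by (subst ennreal_mult[symmetric]) simp_all
      finally show ?thesis using True by simp
    qed auto
  qed
  also have "\<dots> = ennreal (h * norm (One::'a) * ?G / \<mu>) * emeasure lborel ?Q"
    by (rule nn_integral_cmult_indicator) simp
  also have "emeasure lborel ?Q = ennreal \<mu>"
    unfolding \<mu>_def
    using emeasure_bounded_finite[OF bounded_cbox, of 0 "h *\<^sub>R One :: 'a"]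
    by (intro emeasure_eq_ennreal_measure) simp
  also have "ennreal (h * norm (One::'a) * ?G / \<mu>) * ennreal \<mu> = ennreal (h * norm (One::'a) * ?G)"
    using \<mu> h by (subst ennreal_mult[symmetric]) simp_all
  finally show ?thesis .
qed

end

lemma test_function_C1:
  assumes "\<phi> \<in> test_functions \<Omega>"
  obtains K where "compactly_supported_C1 \<phi> (grad \<phi>) K" "K \<subseteq> \<Omega>"
proof -
  obtain K where K: "compact K" "K \<subseteq> \<Omega>" "\<And>x. x \<notin> K \<Longrightarrow> \<phi> x = 0" "\<And>x. x \<notin> K \<Longrightarrow> grad \<phi> x = 0"
    using test_functions_support[OF assms] by blast
  have "compactly_supported_C1 \<phi> (grad \<phi>) K"
    by unfold_locales
      (rule test_functions_GDERIV[OF assms] smooth_grad_continuous[OF test_functions_smooth[OF assms]]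
        K(1) K(3), assumption?)+
  then show thesis using K(2) by (rule that)
qed


text \<open>
  A form of Rellich's theorem. For each side length \<open>h\<close> the averages over boxes of side \<open>h\<close> are bounded
  and equi-Lipschitz, so by a diagonal argument one subsequence of them converges at every point,
  for all \<open>h = 1 / (j + 1)\<close> simultaneously. Since the averages differ from the functions by at most a multiple
  of \<open>h\<close> in \<open>L^1\<close>, uniformly in \<open>k\<close>, the functions themselves are Cauchy in \<open>L^1\<close>.
\<close>

lemma bounded_gradient_compactness:
  fixes \<phi> :: "nat \<Rightarrow> 'a::euclidean_space \<Rightarrow> real"
  assumes \<Omega>: "bounded \<Omega>" and \<phi>: "\<And>k. \<phi> k \<in> test_functions \<Omega>"
    and z: "\<And>k x. \<bar>\<phi> k x\<bar> \<le> z"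
    and B: "\<And>k. (LINT x|lborel. norm (grad (\<phi> k) x)) \<le> B"
  obtains r where "strict_mono (r :: nat \<Rightarrow> nat)" "AE x in lborel. convergent (\<lambda>k. \<phi> (r k) x)"
proof -
  have "\<forall>k. \<exists>K. compactly_supported_C1 (\<phi> k) (grad (\<phi> k)) K"
    using test_function_C1[OF \<phi>] by metis
  then obtain K where C1: "\<And>k. compactly_supported_C1 (\<phi> k) (grad (\<phi> k)) (K k)" by metis
  define h where "h = (\<lambda>j. inverse (real (Suc j)))"
  have h: "h j > 0" for j by (simp add: h_def)
  \<comment> \<open>The function \<open>A j k\<close> is the average of \<open>\<phi> k\<close> over boxes of side \<open>h j\<close>.\<close>
  define A where "A = (\<lambda>j k x. compactly_supported_C1.box_average (\<phi> k) (h j) x)"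
  define \<mu> where "\<mu> = (\<lambda>j. measure lborel (cbox 0 (h j *\<^sub>R One :: 'a)))"
  have \<mu>: "\<mu> j > 0" for j
    unfolding \<mu>_def by (rule compactly_supported_C1.content_box_pos[OF C1 h])
  have B0: "B \<ge> 0" using B[of 0] by (rule order_trans[rotated]) simp
  have z0: "z \<ge> 0" using z[of 0 0] by (rule order_trans[rotated]) simp
  have Ab: "\<bar>A j k x\<bar> \<le> z" for j k x
    unfolding A_def by (rule compactly_supported_C1.box_average_bound[OF C1 h z])
  have Al: "\<bar>A j k x - A j k y\<bar> \<le> norm (x - y) * (B / \<mu> j)" for j k x y
  proof -
    have "\<bar>A j k x - A j k y\<bar> \<le> norm (x - y) * ((LINT x|lborel. norm (grad (\<phi> k) x)) / \<mu> j)"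
      unfolding A_def \<mu>_def by (rule compactly_supported_C1.box_average_lipschitz[OF C1 h])
    also have "\<dots> \<le> norm (x - y) * (B / \<mu> j)"
      by (intro mult_left_mono divide_right_mono B norm_ge_zero less_imp_le[OF \<mu>])
    finally show ?thesis .
  qed
  obtain D :: "'a set" where D: "countable D" "\<And>X. open X \<Longrightarrow> X \<noteq> {} \<Longrightarrow> \<exists>d\<in>D. d \<in> X"
    using countable_dense_setE by blast
  obtain r :: "nat \<Rightarrow> nat" where r: "strict_mono r"
    and rD: "\<And>q. q \<in> UNIV \<times> D \<Longrightarrow> \<exists>l. (\<lambda>n. A (fst q) (r n) (snd q)) \<longlonglongrightarrow> l"
  proof (rule function_convergent_subsequence[of "UNIV \<times> D" "\<lambda>k q. A (fst q) k (snd q)" z])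
    show "countable ((UNIV :: nat set) \<times> D)" using D(1) by simp
    show "norm (A (fst q) n (snd q)) \<le> z" for n q using Ab by simp
  qed (use that in blast)
  have conv: "convergent (\<lambda>k. A j (r k) x)" for j x
  proof (rule Cauchy_convergent, rule metric_CauchyI)
    fix e :: real assume e: "e > 0"
    define q where "q = B / \<mu> j + 1"
    define \<delta> where "\<delta> = e / (3 * q)"
    have p: "B / \<mu> j \<ge> 0" using B0 \<mu>[of j] by simp
    then have q: "q > 0" by (simp add: q_def)
    have \<delta>: "\<delta> > 0" using e q by (simp add: \<delta>_def)
    obtain d where d: "d \<in> D" "d \<in> ball x \<delta>"
      using D(2)[of "ball x \<delta>"] \<delta> by auto
    have "norm (x - d) * (B / \<mu> j) \<le> \<delta> * (B / \<mu> j)"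
      using d(2) p by (intro mult_right_mono) (auto simp: dist_norm)
    also have "\<dots> < \<delta> * q" using \<delta> by (intro mult_strict_left_mono) (simp_all add: q_def)
    also have "\<dots> = e / 3" using q by (simp add: \<delta>_def)
    finally have near: "\<bar>A j k x - A j k d\<bar> < e / 3" for k using Al[of j k x d] by linarith
    have "Cauchy (\<lambda>n. A j (r n) d)"
      using rD[of "(j, d)"] d(1) by (auto intro: LIMSEQ_imp_Cauchy)
    then obtain M where M: "\<And>m n. m \<ge> M \<Longrightarrow> n \<ge> M \<Longrightarrow> \<bar>A j (r m) d - A j (r n) d\<bar> < e / 3"
      unfolding Cauchy_def dist_real_def using e by (meson divide_pos_pos zero_less_numeral)
    show "\<exists>M. \<forall>m\<ge>M. \<forall>n\<ge>M. dist (A j (r m) x) (A j (r n) x) < e"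
    proof (intro exI allI impI)
      fix m n assume "m \<ge> M" "n \<ge> M"
      then show "dist (A j (r m) x) (A j (r n) x) < e"
        using near[of "r m"] near[of "r n"] M[of m n] unfolding dist_real_def by linarith
    qed
  qed
  obtain R where R: "\<And>x. x \<in> \<Omega> \<Longrightarrow> norm x \<le> R" using \<Omega> by (auto simp: bounded_iff)
  define C where "C = cball (0::'a) R"
  have \<phi>out: "\<phi> k x = 0" if "x \<notin> C" for k x
    using that R[of x] test_functions_zero_outside(1)[OF \<phi>[of k], of x] by (auto simp: C_def)
  have mC [measurable]: "C \<in> sets borel" by (simp add: C_def)
  have iC: "integrable lborel (indicator C :: 'a \<Rightarrow> real)"
    by (rule integrable_indicator_bounded) (simp_all add: C_def)
  have mA [measurable]: "A j k \<in> borel_measurable borel" for j k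
    unfolding A_def by (intro borel_measurable_continuous_onI compactly_supported_C1.box_average_continuous[OF C1 h])
  have m\<phi> [measurable]: "\<phi> k \<in> borel_measurable borel" for k
    by (rule compactly_supported_C1.borel(1)[OF C1])
  have i\<phi>: "integrable lborel (\<phi> k)" for k by (rule compactly_supported_C1.integrable_w[OF C1])
  have close: "(LINT x|lborel. indicator C x * \<bar>A j k x - \<phi> k x\<bar>) \<le> h j * norm (One::'a) * B"
    and iclose: "integrable lborel (\<lambda>x. indicator C x * \<bar>A j k x - \<phi> k x\<bar>)" for j k
  proof -
    have nn: "(\<integral>\<^sup>+x. ennreal (indicator C x * \<bar>A j k x - \<phi> k x\<bar>) \<partial>lborel) \<le> ennreal (h j * norm (One::'a) * B)"
    proof -
      have "(\<integral>\<^sup>+x. ennreal (indicator C x * \<bar>A j k x - \<phi> k x\<bar>) \<partial>lborel)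
          \<le> (\<integral>\<^sup>+x. ennreal \<bar>A j k x - \<phi> k x\<bar> \<partial>lborel)"
        by (intro nn_integral_mono ennreal_leI) (auto split: split_indicator)
      also have "\<dots> \<le> ennreal (h j * norm (One::'a) * (LINT x|lborel. norm (grad (\<phi> k) x)))"
        unfolding A_def by (rule compactly_supported_C1.box_average_L1_close[OF C1 h])
      also have "\<dots> \<le> ennreal (h j * norm (One::'a) * B)"
        using h[of j] by (intro ennreal_leI mult_left_mono B) simp
      finally show ?thesis .
    qed
    show i: "integrable lborel (\<lambda>x. indicator C x * \<bar>A j k x - \<phi> k x\<bar>)"
      by (rule integrableI_bounded) (use nn in \<open>auto simp: abs_mult intro: le_less_trans\<close>)
    have "ennreal (LINT x|lborel. indicator C x * \<bar>A j k x - \<phi> k x\<bar>) \<le> ennreal (h j * norm (One::'a) * B)"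
      using nn by (subst nn_integral_eq_integral[symmetric, OF i]) auto
    then show "(LINT x|lborel. indicator C x * \<bar>A j k x - \<phi> k x\<bar>) \<le> h j * norm (One::'a) * B"
      using h[of j] B0 by (subst (asm) ennreal_le_iff) auto
  qed
  define a where "a = (\<lambda>j x. lim (\<lambda>k. A j (r k) x))"
  have ma [measurable]: "a j \<in> borel_measurable borel" for j unfolding a_def by measurable
  have Aa: "(\<lambda>k. A j (r k) x) \<longlonglongrightarrow> a j x" for j x
    using conv[of j x] by (simp add: a_def convergent_LIMSEQ_iff)
  have ab: "\<bar>a j x\<bar> \<le> z" for j x
    by (rule LIMSEQ_le_const2[OF tendsto_rabs[OF Aa]]) (use Ab in blast)
  have bnd: "norm (indicator C x * \<bar>A j (r k) x - a j x\<bar>) \<le> 2 * z * indicator C x" for j k x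
    using Ab[of j "r k" x] ab[of j x] by (auto split: split_indicator)
  have i2: "integrable lborel (\<lambda>x. 2 * z * indicator C x)" using iC by (rule integrable_mult_right)
  have iAa: "integrable lborel (\<lambda>x. indicator C x * \<bar>A j (r k) x - a j x\<bar>)" for j k
    by (rule Bochner_Integration.integrable_bound[OF i2])
      (measurable, use bnd z0 in \<open>auto split: split_indicator\<close>)
  have limA: "(\<lambda>k. LINT x|lborel. indicator C x * \<bar>A j (r k) x - a j x\<bar>) \<longlonglongrightarrow> 0" for j
  proof -
    have "(\<lambda>k. LINT x|lborel. indicator C x * \<bar>A j (r k) x - a j x\<bar>) \<longlonglongrightarrow> (LINT x|(lborel :: 'a measure). 0)"
    proof (rule integral_dominated_convergence[where w = "\<lambda>x. 2 * z * indicator C x"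
          and f = "\<lambda>_. 0" and s = "\<lambda>k x. indicator C x * \<bar>A j (r k) x - a j x\<bar>"])
      show "integrable lborel (\<lambda>x. 2 * z * indicator C x)" by (rule i2)
      have "(\<lambda>k. indicator C x * \<bar>A j (r k) x - a j x\<bar>) \<longlonglongrightarrow> indicator C x * \<bar>a j x - a j x\<bar>" for x
        by (intro tendsto_intros Aa)
      then show "AE x in lborel. (\<lambda>k. indicator C x * \<bar>A j (r k) x - a j x\<bar>) \<longlonglongrightarrow> 0" by simp
      show "AE x in lborel. norm (indicator C x * \<bar>A j (r k) x - a j x\<bar>) \<le> 2 * z * indicator C x" for k
        using bnd by (intro AE_I2)
    qed measurable
    then show ?thesis by simp
  qed
  have cau: "\<exists>N. \<forall>i\<ge>N. \<forall>k\<ge>N. (LINT x|lborel. norm (\<phi> (r i) x - \<phi> (r k) x)) < e" if e: "e > 0" for e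
  proof -
    define c where "c = norm (One::'a) * B"
    have c: "c \<ge> 0" using B0 by (simp add: c_def)
    have "e / (4 * (c + 1)) > 0" using e c by simp
    then obtain j where "h j < e / (4 * (c + 1))"
      unfolding h_def using reals_Archimedean by blast
    then have "h j * (4 * (c + 1)) < e" using c by (simp add: pos_less_divide_eq)
    then have hj: "h j * norm (One::'a) * B < e / 4"
      using h[of j] by (simp add: c_def algebra_simps)
    have "\<forall>\<^sub>F k in sequentially. (LINT x|lborel. indicator C x * \<bar>A j (r k) x - a j x\<bar>) < e / 4"
      using limA[of j] e by (intro order_tendstoD(2)) auto
    then obtain N where N: "\<And>k. k \<ge> N \<Longrightarrow> (LINT x|lborel. indicator C x * \<bar>A j (r k) x - a j x\<bar>) < e / 4"
      by (auto simp: eventually_sequentially)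
    show ?thesis
    proof (intro exI allI impI)
      fix i k assume ik: "i \<ge> N" "k \<ge> N"
      let ?T = "\<lambda>k x. indicator C x * \<bar>A j (r k) x - \<phi> (r k) x\<bar> + indicator C x * \<bar>A j (r k) x - a j x\<bar>"
      have iT: "integrable lborel (?T k)" for k
        by (intro Bochner_Integration.integrable_add iclose iAa)
      have "(LINT x|lborel. norm (\<phi> (r i) x - \<phi> (r k) x)) \<le> (LINT x|lborel. ?T i x + ?T k x)"
      proof (rule integral_mono)
        show "integrable lborel (\<lambda>x. norm (\<phi> (r i) x - \<phi> (r k) x))"
          by (intro integrable_norm Bochner_Integration.integrable_diff i\<phi>)
        show "integrable lborel (\<lambda>x. ?T i x + ?T k x)"
          by (intro Bochner_Integration.integrable_add[OF iT iT])
        show "norm (\<phi> (r i) x - \<phi> (r k) x) \<le> ?T i x + ?T k x" for x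
          using \<phi>out[of x] by (cases "x \<in> C") auto
      qed
      also have "\<dots> = (LINT x|lborel. ?T i x) + (LINT x|lborel. ?T k x)"
        by (rule Bochner_Integration.integral_add[OF iT iT])
      also have "(LINT x|lborel. ?T k x) = (LINT x|lborel. indicator C x * \<bar>A j (r k) x - \<phi> (r k) x\<bar>)
          + (LINT x|lborel. indicator C x * \<bar>A j (r k) x - a j x\<bar>)"
        by (rule Bochner_Integration.integral_add[OF iclose iAa])
      also have "(LINT x|lborel. ?T i x) = (LINT x|lborel. indicator C x * \<bar>A j (r i) x - \<phi> (r i) x\<bar>)
          + (LINT x|lborel. indicator C x * \<bar>A j (r i) x - a j x\<bar>)"
        by (rule Bochner_Integration.integral_add[OF iclose iAa])
      finally show "(LINT x|lborel. norm (\<phi> (r i) x - \<phi> (r k) x)) < e"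
        using close[of j "r i"] close[of j "r k"] N[OF ik(1)] N[OF ik(2)] hj by linarith
    qed
  qed
  obtain r' where r': "strict_mono r'" "AE x in lborel. Cauchy (\<lambda>i. \<phi> (r (r' i)) x)"
    by (rule cauchy_L1_AE_cauchy_subseq[OF i\<phi> cau]) blast+
  show thesis
  proof (rule that[of "r \<circ> r'"])
    show "strict_mono (r \<circ> r')" using r r'(1) by (simp add: strict_mono_o)
    show "AE x in lborel. convergent (\<lambda>k. \<phi> ((r \<circ> r') k) x)"
      using r'(2) by (rule AE_mp) (auto intro!: AE_I2 Cauchy_convergent)
  qed
qed

section \<open>Spaces of p-integrable vector fields\<close>

text \<open>
  Lebesgue measure is complete, so measurability passes to functions that agree almost everywhere.
\<close>

lemma measurable_lebesgue_on_AE: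
  fixes f g :: "'a::euclidean_space \<Rightarrow> 'b::euclidean_space"
  assumes S: "S \<in> sets lebesgue" and f: "f \<in> borel_measurable (lebesgue_on S)"
    and eq: "AE x in lebesgue_on S. f x = g x"
  shows "g \<in> borel_measurable (lebesgue_on S)"
proof -
  have "AE x in lebesgue. x \<in> S \<longrightarrow> f x = g x"
    using eq S by (simp add: AE_restrict_space_iff)
  then have "AE x in lebesgue. (if x \<in> S then f x else 0) = (if x \<in> S then g x else 0)"
    by (rule AE_mp) (auto intro!: AE_I2)
  from borel_measurable_AE[OF borel_measurable_if[OF S, THEN iffD2, OF f] this]
  show ?thesis by (rule borel_measurable_if[OF S, THEN iffD1])
qed

lemma norm_add_powr_le:
  fixes a b :: "'a::real_normed_vector"
  assumes "p \<ge> 0"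
  shows "norm (a + b) powr p \<le> 2 powr p * (norm a powr p + norm b powr p)"
proof -
  have "norm (a + b) powr p \<le> (2 * max (norm a) (norm b)) powr p"
    using assms norm_triangle_ineq[of a b] by (intro powr_mono2) auto
  also have "\<dots> = 2 powr p * max (norm a) (norm b) powr p"
    by (rule powr_mult)
  also have "max (norm a) (norm b) powr p \<le> norm a powr p + norm b powr p"
    by (simp add: max_def)
  finally show ?thesis by simp
qed

text \<open>
  On a space of finite measure this bounds the \<open>L^1\<close> norm by the \<open>p\<close>-th power integral with an
  arbitrarily small error.
\<close>

lemma le_delta_plus_powr:
  fixes t :: real
  assumes "p \<ge> 1" "\<delta> > 0" "t \<ge> 0"
  shows "t \<le> \<delta> + \<delta> powr (1 - p) * t powr p"
proof (cases "t \<le> \<delta>")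
  case True
  then show ?thesis by (simp add: add_increasing2)
next
  case False
  then have t: "t > \<delta>" "t > 0" using assms by auto
  have "t = t powr (1 - p) * t powr p" using t by (simp flip: powr_add)
  also have "\<dots> \<le> \<delta> powr (1 - p) * t powr p"
    using assms t by (intro mult_right_mono powr_mono2') auto
  finally show ?thesis using assms by linarith
qed

definition Lp_fun :: "'a measure \<Rightarrow> real \<Rightarrow> ('a \<Rightarrow> 'b::euclidean_space) \<Rightarrow> bool" where
  "Lp_fun M p u \<longleftrightarrow> u \<in> borel_measurable M \<and> integrable M (\<lambda>x. norm (u x) powr p)"

lemma Lp_funD [dest]:
  assumes "Lp_fun M p u"
  shows "u \<in> borel_measurable M" "integrable M (\<lambda>x. norm (u x) powr p)"
  using assms by (auto simp: Lp_fun_def)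

lemma Lp_fun_bound:
  fixes u :: "'a \<Rightarrow> 'b::euclidean_space"
  assumes "integrable M v" "u \<in> borel_measurable M" "AE x in M. norm (u x) powr p \<le> v x"
  shows "Lp_fun M p u"
  unfolding Lp_fun_def
  by (intro conjI assms(2) Bochner_Integration.integrable_bound[OF assms(1)])
    (use assms(2,3) in auto)

lemma Lp_fun_add:
  assumes "p \<ge> 0" "Lp_fun M p u" "Lp_fun M p v"
  shows "Lp_fun M p (\<lambda>x. u x + v x)"
proof -
  note [measurable] = Lp_funD(1)[OF assms(2)] Lp_funD(1)[OF assms(3)]
  have "integrable M (\<lambda>x. 2 powr p * (norm (u x) powr p + norm (v x) powr p))"
    using assms by auto
  then show ?thesis
    by (rule Lp_fun_bound) (auto intro!: AE_I2 norm_add_powr_le assms(1))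
qed

lemma Lp_fun_scale:
  assumes "Lp_fun M p u"
  shows "Lp_fun M p (\<lambda>x. c *\<^sub>R u x)"
proof -
  have "integrable M (\<lambda>x. \<bar>c\<bar> powr p * norm (u x) powr p)"
    using assms by auto
  then show ?thesis
    by (rule Lp_fun_bound) (use Lp_funD(1)[OF assms] in \<open>auto simp: powr_mult\<close>)
qed

lemma Lp_fun_diff:
  assumes "p \<ge> 0" "Lp_fun M p u" "Lp_fun M p v"
  shows "Lp_fun M p (\<lambda>x. u x - v x)"
  using Lp_fun_add[OF assms(1,2) Lp_fun_scale[OF assms(3), of "-1"]] by simp

lemma (in finite_measure) Lp_fun_integrable:
  assumes "p \<ge> 1" "Lp_fun M p u"
  shows "integrable M u"
proof -
  have "integrable M (\<lambda>x. 1 + 1 powr (1 - p) * norm (u x) powr p)"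
    using assms(2) by auto
  then show ?thesis
    by (rule Bochner_Integration.integrable_bound)
      (use assms le_delta_plus_powr[of p 1 "norm (u _)"] in \<open>auto intro!: AE_I2\<close>)
qed

lemma (in finite_measure) L1_le_Lp:
  fixes u :: "'a \<Rightarrow> 'b::euclidean_space"
  assumes "p \<ge> 1" "Lp_fun M p u" "\<delta> > 0"
  shows "(LINT x|M. norm (u x)) \<le> \<delta> * measure M (space M) + \<delta> powr (1 - p) * (LINT x|M. norm (u x) powr p)"
proof -
  have "(LINT x|M. norm (u x)) \<le> (LINT x|M. \<delta> + \<delta> powr (1 - p) * norm (u x) powr p)"
    by (rule integral_mono)
      (use assms Lp_fun_integrable[OF assms(1,2)] le_delta_plus_powr[OF assms(1,3)] in auto)
  also have "\<dots> = \<delta> * measure M (space M) + \<delta> powr (1 - p) * (LINT x|M. norm (u x) powr p)"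
    using assms(2) by (subst Bochner_Integration.integral_add) (auto simp: mult.commute)
  finally show ?thesis .
qed

lemma (in finite_measure) Lp_small_imp_L1_small:
  assumes "p \<ge> 1" "e > 0"
  obtains d where "d > 0"
    "\<And>u :: 'a \<Rightarrow> 'b::euclidean_space. Lp_fun M p u \<Longrightarrow> (LINT x|M. norm (u x) powr p) < d \<Longrightarrow> (LINT x|M. norm (u x)) < e"
proof -
  define m where "m = measure M (space M)"
  have m: "m \<ge> 0" by (simp add: m_def)
  define q where "q = m + 1"
  have q: "q > 0" using m by (simp add: q_def)
  define \<delta> where "\<delta> = e / (2 * q)"
  have \<delta>: "\<delta> > 0" using assms(2) q by (simp add: \<delta>_def)
  have "\<delta> * m < \<delta> * q" using \<delta> by (simp add: q_def)
  also have "\<dots> = e / 2" using q by (simp add: \<delta>_def)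
  finally have dm: "\<delta> * m < e / 2" .
  define d where "d = e / 2 / \<delta> powr (1 - p)"
  show thesis
  proof (rule that[of d])
    show "d > 0" using assms(2) \<delta> by (simp add: d_def)
    fix u :: "'a \<Rightarrow> 'b"
    assume u: "Lp_fun M p u" "(LINT x|M. norm (u x) powr p) < d"
    have "(LINT x|M. norm (u x)) \<le> \<delta> * m + \<delta> powr (1 - p) * (LINT x|M. norm (u x) powr p)"
      unfolding m_def by (rule L1_le_Lp[OF assms(1) u(1) \<delta>])
    also have "\<delta> powr (1 - p) * (LINT x|M. norm (u x) powr p) \<le> \<delta> powr (1 - p) * d"
      using u(2) by (intro mult_left_mono) auto
    also have "\<dots> = e / 2" using \<delta> by (simp add: d_def)
    finally show "(LINT x|M. norm (u x)) < e" using dm by linarith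
  qed
qed

lemma (in finite_measure) Lp_tendsto_imp_L1_tendsto:
  fixes u :: "nat \<Rightarrow> 'a \<Rightarrow> 'b::euclidean_space"
  assumes "p \<ge> 1" "\<And>k. Lp_fun M p (u k)" "(\<lambda>k. LINT x|M. norm (u k x) powr p) \<longlonglongrightarrow> 0"
  shows "(\<lambda>k. LINT x|M. norm (u k x)) \<longlonglongrightarrow> 0"
proof (rule LIMSEQ_I)
  fix e :: real assume "e > 0"
  from Lp_small_imp_L1_small[OF assms(1) this, where 'b = 'b]
  obtain d where d: "d > 0"
    "\<And>u :: 'a \<Rightarrow> 'b. Lp_fun M p u \<Longrightarrow> (LINT x|M. norm (u x) powr p) < d \<Longrightarrow> (LINT x|M. norm (u x)) < e"
    by blast
  have "\<forall>\<^sub>F k in sequentially. (LINT x|M. norm (u k x) powr p) < d"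
    by (rule order_tendstoD(2)[OF assms(3) d(1)])
  then obtain N where "\<And>k. k \<ge> N \<Longrightarrow> (LINT x|M. norm (u k x) powr p) < d"
    unfolding eventually_sequentially by blast
  then have "norm ((LINT x|M. norm (u k x)) - 0) < e" if "k \<ge> N" for k
    using d(2)[OF assms(2)] that by (simp add: abs_of_nonneg)
  then show "\<exists>N. \<forall>k\<ge>N. norm ((LINT x|M. norm (u k x)) - 0) < e" by blast
qed

text \<open>
  Completeness of \<open>L^p\<close>. A Cauchy sequence is also Cauchy in \<open>L^1\<close> and hence has an almost everywhere
  convergent subsequence; Fatou's lemma transfers the Cauchy estimates to the limit.
\<close>

lemma (in finite_measure) Lp_Cauchy_limit:
  fixes g :: "nat \<Rightarrow> 'a \<Rightarrow> 'b::euclidean_space"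
  assumes p: "p \<ge> 1" and g: "\<And>k. Lp_fun M p (g k)"
    and cau: "\<And>e. e > 0 \<Longrightarrow> \<exists>N. \<forall>i\<ge>N. \<forall>j\<ge>N. (LINT x|M. norm (g i x - g j x) powr p) < e"
  obtains r h where "strict_mono (r :: nat \<Rightarrow> nat)" "Lp_fun M p h"
    "AE x in M. (\<lambda>k. g (r k) x) \<longlonglongrightarrow> h x"
    "(\<lambda>k. LINT x|M. norm (g (r k) x - h x) powr p) \<longlonglongrightarrow> 0"
proof -
  have p0: "p \<ge> 0" using p by simp
  have L1: "\<exists>N. \<forall>i\<ge>N. \<forall>j\<ge>N. (LINT x|M. norm (g i x - g j x)) < e" if e: "e > 0" for e
  proof -
    from Lp_small_imp_L1_small[OF p e, where 'b = 'b]
    obtain d where d: "d > 0"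
      "\<And>u :: 'a \<Rightarrow> 'b. Lp_fun M p u \<Longrightarrow> (LINT x|M. norm (u x) powr p) < d \<Longrightarrow> (LINT x|M. norm (u x)) < e"
      by blast
    obtain N where N: "\<forall>i\<ge>N. \<forall>j\<ge>N. (LINT x|M. norm (g i x - g j x) powr p) < d"
      using cau[OF d(1)] by blast
    show ?thesis
      by (rule exI[of _ N]) (use N d(2)[OF Lp_fun_diff[OF p0 g g]] in blast)
  qed
  obtain r where r: "strict_mono r" "AE x in M. Cauchy (\<lambda>i. g (r i) x)"
    by (rule cauchy_L1_AE_cauchy_subseq[OF Lp_fun_integrable[OF p g] L1]) blast+
  note mg [measurable] = Lp_funD(1)[OF g]
  define h where "h = (\<lambda>x. lim (\<lambda>i. g (r i) x))"
  have mh [measurable]: "h \<in> borel_measurable M" unfolding h_def by measurable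
  have lim: "AE x in M. (\<lambda>k. g (r k) x) \<longlonglongrightarrow> h x"
    using r(2) by (rule AE_mp)
      (auto intro!: AE_I2 simp: h_def Cauchy_convergent_iff convergent_LIMSEQ_iff)
  have fatou: "(\<integral>\<^sup>+x. ennreal (norm (g i x - h x) powr p) \<partial>M) \<le> ennreal e"
    if N: "\<forall>j\<ge>N. (LINT x|M. norm (g i x - g j x) powr p) < e" for i e N
  proof -
    have "AE x in M. ennreal (norm (g i x - h x) powr p)
        = liminf (\<lambda>k. ennreal (norm (g i x - g (r k) x) powr p))"
      using lim
    proof (rule AE_mp, intro AE_I2 impI)
      fix x assume "(\<lambda>k. g (r k) x) \<longlonglongrightarrow> h x"
      then have "(\<lambda>k. norm (g i x - g (r k) x) powr p) \<longlonglongrightarrow> norm (g i x - h x) powr p"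
        using p by (intro tendsto_powr' tendsto_intros) auto
      then have "(\<lambda>k. ennreal (norm (g i x - g (r k) x) powr p)) \<longlonglongrightarrow> ennreal (norm (g i x - h x) powr p)"
        by (rule tendsto_ennrealI)
      then show "ennreal (norm (g i x - h x) powr p) = liminf (\<lambda>k. ennreal (norm (g i x - g (r k) x) powr p))"
        using lim_imp_Liminf[OF sequentially_bot] by metis
    qed
    then have "(\<integral>\<^sup>+x. ennreal (norm (g i x - h x) powr p) \<partial>M)
        = (\<integral>\<^sup>+x. liminf (\<lambda>k. ennreal (norm (g i x - g (r k) x) powr p)) \<partial>M)"
      by (rule nn_integral_cong_AE)
    also have "\<dots> \<le> liminf (\<lambda>k. \<integral>\<^sup>+x. ennreal (norm (g i x - g (r k) x) powr p) \<partial>M)"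
      by (rule nn_integral_liminf) measurable
    also have "\<dots> \<le> ennreal e"
    proof (rule Liminf_le)
      have "(\<integral>\<^sup>+x. ennreal (norm (g i x - g (r k) x) powr p) \<partial>M) \<le> ennreal e" if "k \<ge> N" for k
      proof -
        have "r k \<ge> N" using that seq_suble[OF r(1), of k] by linarith
        then have "(LINT x|M. norm (g i x - g (r k) x) powr p) \<le> e" using N by force
        moreover have "(\<integral>\<^sup>+x. ennreal (norm (g i x - g (r k) x) powr p) \<partial>M)
            = ennreal (LINT x|M. norm (g i x - g (r k) x) powr p)"
          by (rule nn_integral_eq_integral[OF Lp_funD(2)[OF Lp_fun_diff[OF p0 g g]]]) simp
        ultimately show ?thesis by (simp add: ennreal_leI)
      qed
      then show "\<forall>\<^sub>F k in sequentially. (\<integral>\<^sup>+x. ennreal (norm (g i x - g (r k) x) powr p) \<partial>M) \<le> ennreal e"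
        unfolding eventually_sequentially by blast
    qed simp
    finally show ?thesis .
  qed
  have Lgh: "Lp_fun M p (\<lambda>x. g (r k) x - h x)" if "\<exists>N. \<forall>j\<ge>N. (LINT x|M. norm (g (r k) x - g j x) powr p) < 1" for k
  proof -
    obtain N where "\<forall>j\<ge>N. (LINT x|M. norm (g (r k) x - g j x) powr p) < 1" using \<open>\<exists>N. _ N\<close> by blast
    from fatou[OF this] have *: "(\<integral>\<^sup>+x. ennreal (norm (g (r k) x - h x) powr p) \<partial>M) \<le> ennreal 1" .
    have "integrable M (\<lambda>x. norm (g (r k) x - h x) powr p)"
      by (rule integrableI_bounded) (measurable, use * in \<open>auto intro: le_less_trans\<close>)
    then show ?thesis by (auto simp: Lp_fun_def)
  qed
  obtain N1 where N1: "\<forall>i\<ge>N1. \<forall>j\<ge>N1. (LINT x|M. norm (g i x - g j x) powr p) < 1"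
    using cau[of 1] by auto
  have rN1: "r N1 \<ge> N1" by (rule seq_suble[OF r(1)])
  have "Lp_fun M p (\<lambda>x. g (r N1) x - (g (r N1) x - h x))"
    by (rule Lp_fun_diff[OF p0 g Lgh]) (use N1 rN1 in blast)
  then have hL: "Lp_fun M p h" by simp
  have "(\<lambda>k. LINT x|M. norm (g (r k) x - h x) powr p) \<longlonglongrightarrow> 0"
  proof (rule LIMSEQ_I)
    fix e :: real assume e: "e > 0"
    obtain N where N: "\<forall>i\<ge>N. \<forall>j\<ge>N. (LINT x|M. norm (g i x - g j x) powr p) < e / 2"
      using cau[of "e / 2"] e by auto
    have "norm ((LINT x|M. norm (g (r k) x - h x) powr p) - 0) < e" if "k \<ge> N" for k
    proof -
      have "r k \<ge> N" using that seq_suble[OF r(1), of k] by linarith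
      then have "(\<integral>\<^sup>+x. ennreal (norm (g (r k) x - h x) powr p) \<partial>M) \<le> ennreal (e / 2)"
        by (intro fatou[of N]) (use N in blast)
      then have "ennreal (LINT x|M. norm (g (r k) x - h x) powr p) \<le> ennreal (e / 2)"
        by (subst nn_integral_eq_integral[symmetric, OF Lp_funD(2)[OF Lp_fun_diff[OF p0 g hL]]]) auto
      then have "(LINT x|M. norm (g (r k) x - h x) powr p) \<le> e / 2"
        using e by (subst (asm) ennreal_le_iff) auto
      then show ?thesis using e by (simp add: abs_of_nonneg)
    qed
    then show "\<exists>N. \<forall>k\<ge>N. norm ((LINT x|M. norm (g (r k) x - h x) powr p) - 0) < e" by blast
  qed
  with r(1) hL lim show thesis by (rule that)
qed

subsection \<open>Uniform convexity\<close>

text \<open>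
  The mean value theorem on both halves of \<open>[s, t]\<close>, together with strict monotonicity of the derivative.
\<close>

lemma powr_midpoint_strict:
  fixes s t p :: real
  assumes "p > 1" "0 \<le> s" "s < t"
  shows "((s + t) / 2) powr p < (s powr p + t powr p) / 2"
proof -
  define m where "m = (s + t) / 2"
  have m: "s < m" "m < t" "m - s = t - m" using assms by (auto simp: m_def field_simps)
  have d: "((\<lambda>x. x powr p) has_real_derivative p * x powr (p - 1)) (at x)" if "x > 0" for x
    using that by (rule has_real_derivative_powr)
  have mvt: "\<exists>x. a < x \<and> x < b \<and> b powr p - a powr p = (b - a) * (p * x powr (p - 1))"
    if ab: "0 \<le> a" "a < b" for a b
  proof -
    have c: "continuous_on {a..b} (\<lambda>x. x powr p)"
      using assms(1) ab(1) by (intro continuous_on_powr' continuous_on_id continuous_on_const) auto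
    have df: "(\<lambda>x. x powr p) differentiable (at x)" if "a < x" for x
      unfolding real_differentiable_def by (rule exI, rule d) (use that ab(1) in linarith)
    obtain l x where x: "a < x" "x < b" "((\<lambda>x. x powr p) has_real_derivative l) (at x)"
        "b powr p - a powr p = (b - a) * l"
      using MVT[OF ab(2) c df] by blast
    have "l = p * x powr (p - 1)"
      by (rule DERIV_unique[OF x(3) d]) (use x(1) ab(1) in linarith)
    with x show ?thesis by blast
  qed
  obtain x1 where 1: "s < x1" "x1 < m" "m powr p - s powr p = (m - s) * (p * x1 powr (p - 1))"
    using mvt[OF assms(2) m(1)] by blast
  obtain x2 where 2: "m < x2" "x2 < t" "t powr p - m powr p = (t - m) * (p * x2 powr (p - 1))"
    using mvt[OF _ m(2)] assms(2) m(1) by force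
  have "x1 powr (p - 1) < x2 powr (p - 1)"
    using 1(1,2) 2(1) assms by (intro powr_less_mono2) auto
  then have "(m - s) * (p * x1 powr (p - 1)) < (m - s) * (p * x2 powr (p - 1))"
    using m(1) assms(1) by (intro mult_strict_left_mono) auto
  then have "m powr p - s powr p < t powr p - m powr p"
    using 1(3) 2(3) m(3) by simp
  then show ?thesis by (simp add: m_def)
qed

lemma norm_powr_midpoint:
  fixes a b :: "'a::euclidean_space"
  assumes p: "p > 1"
  shows "norm ((1/2) *\<^sub>R (a + b)) powr p \<le> (norm a powr p + norm b powr p) / 2"
    and "a \<noteq> b \<Longrightarrow> norm ((1/2) *\<^sub>R (a + b)) powr p < (norm a powr p + norm b powr p) / 2"
proof -
  have le: "norm ((1/2) *\<^sub>R (a + b)) \<le> (norm a + norm b) / 2"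
    using norm_triangle_ineq[of a b] by simp
  have le2: "norm ((1/2) *\<^sub>R (a + b)) powr p \<le> ((norm a + norm b) / 2) powr p"
    using le p by (intro powr_mono2) auto
  have mid: "((norm a + norm b) / 2) powr p < (norm a powr p + norm b powr p) / 2" if "norm a \<noteq> norm b"
    using powr_midpoint_strict[OF p, of "norm a" "norm b"] powr_midpoint_strict[OF p, of "norm b" "norm a"] that
    by (cases "norm a < norm b") (simp_all add: add.commute)
  show *: "norm ((1/2) *\<^sub>R (a + b)) powr p < (norm a powr p + norm b powr p) / 2" if ab: "a \<noteq> b"
  proof (cases "norm a = norm b")
    case False
    with mid le2 show ?thesis by linarith
  next
    case True
    have "norm (a + b) \<noteq> norm a + norm b"
    proof
      assume "norm (a + b) = norm a + norm b"
      then have "norm a *\<^sub>R b = norm b *\<^sub>R a" by (simp only: norm_triangle_eq)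
      with True have "norm a *\<^sub>R (b - a) = 0" by (simp add: scaleR_diff_right)
      with ab True show False by auto
    qed
    then have "norm ((1/2) *\<^sub>R (a + b)) < norm b"
      using norm_triangle_ineq[of a b] True by simp
    then have "norm ((1/2) *\<^sub>R (a + b)) powr p < norm b powr p"
      using p by (intro powr_less_mono2) auto
    then show ?thesis using True by simp
  qed
  show "norm ((1/2) *\<^sub>R (a + b)) powr p \<le> (norm a powr p + norm b powr p) / 2"
    using * by (cases "a = b") (auto simp flip: scaleR_2)
qed

text \<open>
  Both sides are homogeneous of degree \<open>p\<close>, so it suffices to treat pairs with
  \<open>norm a powr p + norm b powr p = 1\<close>. If \<open>norm (a - b) powr p < \<epsilon>\<close> the first summand is enough. The
  other pairs form a compact set on which the bracket, positive by strict convexity, is bounded away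
  from zero. Integrating the inequality turns small midpoint defects into small distances in \<open>L^p\<close>.
\<close>

lemma norm_powr_uniformly_convex:
  fixes p \<epsilon> :: real
  assumes p: "p > 1" and \<epsilon>: "\<epsilon> > 0"
  obtains C where "C \<ge> 0" "\<And>a b :: 'a::euclidean_space. norm (a - b) powr p
      \<le> \<epsilon> * (norm a powr p + norm b powr p)
        + C * ((norm a powr p + norm b powr p) / 2 - norm ((1/2) *\<^sub>R (a + b)) powr p)"
proof -
  define s where "s = (\<lambda>q::'a \<times> 'a. norm (fst q) powr p + norm (snd q) powr p)"
  \<comment> \<open>For \<open>q = (a, b)\<close>, \<open>D q\<close> is the midpoint defect and \<open>e q\<close> the distance to be bounded.\<close>
  define D where "D = (\<lambda>q::'a \<times> 'a. s q / 2 - norm ((1/2) *\<^sub>R (fst q + snd q)) powr p)"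
  define e where "e = (\<lambda>q::'a \<times> 'a. norm (fst q - snd q) powr p)"
  have cs: "continuous_on UNIV s" and cD: "continuous_on UNIV D" and ce: "continuous_on UNIV e"
    unfolding s_def D_def e_def using p by (auto intro!: continuous_intros continuous_on_powr')
  define S where "S = {q. s q = 1 \<and> \<epsilon> \<le> e q}"
  have "closed S"
    unfolding S_def Collect_conj_eq
    by (intro closed_Int closed_Collect_eq closed_Collect_le cs ce continuous_on_const)
  moreover have "bounded S"
  proof (rule boundedI)
    fix q assume "q \<in> S"
    then have q: "norm (fst q) powr p + norm (snd q) powr p = 1" by (simp add: S_def s_def)
    have nn: "norm (fst q) powr p \<ge> 0" "norm (snd q) powr p \<ge> 0" by simp_all
    have one: "x \<le> 1" if "x powr p \<le> 1" "0 \<le> x" for x :: real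
    proof (rule ccontr)
      assume "\<not> x \<le> 1"
      then have "1 powr p < x powr p" using p by (intro powr_less_mono2) auto
      with that show False by simp
    qed
    have "norm (fst q) powr p \<le> 1" "norm (snd q) powr p \<le> 1" using q nn by linarith+
    then have "norm (fst q) \<le> 1" "norm (snd q) \<le> 1" by (simp_all add: one)
    then show "norm q \<le> 2" using norm_Pair_le[of "fst q" "snd q"] by simp
  qed
  ultimately have cS: "compact S" by (simp add: compact_eq_bounded_closed)
  have Dnn: "D q \<ge> 0" for q
    using norm_powr_midpoint(1)[OF p, of "fst q" "snd q"] by (simp add: D_def s_def)
  have e2: "e q \<le> 2 powr p * s q" for q
    using norm_add_powr_le[of p "fst q" "- snd q"] p by (simp add: e_def s_def)
  obtain d where d: "d > 0" "\<And>q. q \<in> S \<Longrightarrow> d \<le> D q"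
  proof (cases "S = {}")
    case False
    obtain q where q: "q \<in> S" "\<forall>q'\<in>S. D q \<le> D q'"
      using continuous_attains_inf[OF cS False continuous_on_subset[OF cD]] by blast
    have "fst q \<noteq> snd q" using q(1) \<epsilon> by (auto simp: S_def e_def)
    then have "D q > 0"
      using norm_powr_midpoint(2)[OF p] by (simp add: D_def s_def)
    with q(2) show thesis by (intro that[of "D q"]) auto
  qed (use that[of 1] in auto)
  define C where "C = 2 powr p / d"
  have C: "C \<ge> 0" using d by (simp add: C_def)
  have unit: "e q \<le> \<epsilon> + C * D q" if "s q = 1" for q
  proof (cases "\<epsilon> \<le> e q")
    case True
    with that have "d \<le> D q" using d(2) by (simp add: S_def)
    then have "C * d \<le> C * D q" using C by (rule mult_left_mono)
    then show ?thesis using d(1) e2[of q] that \<epsilon> by (simp add: C_def)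
  next
    case False
    then show ?thesis using C Dnn[of q] by (simp add: add_increasing2)
  qed
  show thesis
  proof (rule that[OF C])
    fix a b :: 'a
    define q where "q = (a, b)"
    have "e q \<le> \<epsilon> * s q + C * D q"
    proof (cases "s q = 0")
      case True
      then have "e q \<le> 0" using e2[of q] by simp
      moreover have "0 \<le> C * D q" using C Dnn[of q] by simp
      ultimately show ?thesis using True by simp
    next
      case False
      have "s q \<ge> 0" by (simp add: s_def)
      with False have sq: "s q > 0" by simp
      define t where "t = s q powr (- 1 / p)"
      have t: "t > 0" using sq by (simp add: t_def)
      have tp: "t powr p = 1 / s q"
        unfolding t_def powr_powr using sq p by (simp add: powr_minus_divide)
      have sc: "s (t *\<^sub>R q) = t powr p * s q" "e (t *\<^sub>R q) = t powr p * e q" "D (t *\<^sub>R q) = t powr p * D q"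
      proof -
        have "norm (t *\<^sub>R a + t *\<^sub>R b) = t * norm (a + b)"  "norm (t *\<^sub>R a - t *\<^sub>R b) = t * norm (a - b)" for a b :: 'a
          using t by (simp_all flip: scaleR_add_right scaleR_diff_right)
        note n = this
        show s: "s (t *\<^sub>R q) = t powr p * s q"
          using t by (simp add: s_def powr_mult distrib_left)
        show "e (t *\<^sub>R q) = t powr p * e q"
          using t by (simp add: e_def n powr_mult)
        show "D (t *\<^sub>R q) = t powr p * D q"
          using t unfolding D_def s by (simp add: n powr_mult powr_divide right_diff_distrib)
      qed
      have "s (t *\<^sub>R q) = 1" using sq by (simp add: sc tp)
      from unit[OF this] have "e q / s q \<le> \<epsilon> + C * (D q / s q)" by (simp add: sc tp)
      then show ?thesis using sq by (simp add: field_simps)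
    qed
    then show "norm (a - b) powr p \<le> \<epsilon> * (norm a powr p + norm b powr p)
        + C * ((norm a powr p + norm b powr p) / 2 - norm ((1/2) *\<^sub>R (a + b)) powr p)"
      by (simp add: q_def e_def s_def D_def)
  qed
qed

text \<open>
  The infima of \<open>J\<close> over the sets \<open>C k\<close> increase to a finite limit, so elements of \<open>C k\<close> and \<open>C m\<close> that
  almost attain them have a midpoint at which \<open>J\<close> is not much smaller. Combined with uniform
  convexity this takes the place of weak compactness.
\<close>

lemma nested_midpoint_minimizers:
  fixes C :: "nat \<Rightarrow> 'b set" and J :: "'b \<Rightarrow> real"
  assumes dec: "\<And>k m. k \<le> m \<Longrightarrow> C m \<subseteq> C k" and ne: "\<And>k. C k \<noteq> {}"
    and J0: "\<And>v. J v \<ge> 0" and JB: "\<And>v. v \<in> C 0 \<Longrightarrow> J v \<le> B"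
    and mid: "\<And>k v w. v \<in> C k \<Longrightarrow> w \<in> C k \<Longrightarrow> mid v w \<in> C k"
  obtains v where "\<And>k. v k \<in> C k"
    "\<And>e. e > 0 \<Longrightarrow> \<exists>N. \<forall>k\<ge>N. \<forall>m\<ge>N. (J (v k) + J (v m)) / 2 - J (mid (v k) (v m)) < e"
proof -
  define i where "i = (\<lambda>k. Inf (J ` C k))"
  have bb: "bdd_below (J ` C k)" for k by (rule bdd_belowI2[of _ 0]) (rule J0)
  have low: "i k \<le> J v" if "v \<in> C k" for k v
    unfolding i_def using that by (intro cInf_lower bb) auto
  have imono: "incseq i"
  proof (rule incseq_SucI)
    show "i k \<le> i (Suc k)" for k
      unfolding i_def using ne dec[of k "Suc k"] by (intro cInf_superset_mono bb image_mono) auto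
  qed
  have iB: "i k \<le> B" for k
  proof -
    obtain v where v: "v \<in> C k" using ne by blast
    then have "v \<in> C 0" using dec[of 0 k] by auto
    then show ?thesis using low[OF v] JB[of v] by linarith
  qed
  obtain L where L: "i \<longlonglongrightarrow> L"
    using incseq_convergent[OF imono] iB by blast
  have "\<forall>k. \<exists>v\<in>C k. J v < i k + inverse (real (Suc k))"
  proof
    fix k
    have "i k < i k + inverse (real (Suc k))" by simp
    then show "\<exists>v\<in>C k. J v < i k + inverse (real (Suc k))"
      unfolding i_def using ne cInf_less_iff[OF _ bb, of k] by (subst (asm) cInf_less_iff[OF _ bb]) auto
  qed
  then obtain v where v: "\<And>k. v k \<in> C k" "\<And>k. J (v k) < i k + inverse (real (Suc k))" by metis
  show thesis
  proof (rule that[of v])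
    show "v k \<in> C k" for k by (rule v(1))
    fix e :: real assume e: "e > 0"
    have "(\<lambda>k. i k + inverse (real (Suc k))) \<longlonglongrightarrow> L + 0"
      by (intro tendsto_add L LIMSEQ_inverse_real_of_nat)
    then have "\<forall>\<^sub>F k in sequentially. i k + inverse (real (Suc k)) < L + e / 2"
      using e by (intro order_tendstoD(2)) auto
    moreover have "\<forall>\<^sub>F k in sequentially. L - e / 2 < i k"
      using L e by (intro order_tendstoD(1)) auto
    ultimately have "\<forall>\<^sub>F k in sequentially. i k + inverse (real (Suc k)) < L + e / 2 \<and> L - e / 2 < i k"
      by eventually_elim simp
    then obtain N where N: "\<And>k. k \<ge> N \<Longrightarrow> i k + inverse (real (Suc k)) < L + e / 2 \<and> L - e / 2 < i k"
      unfolding eventually_sequentially by blast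
    have "(J (v k) + J (v m)) / 2 - J (mid (v k) (v m)) < e" if km: "k \<ge> N" "m \<ge> N" for k m
    proof -
      have "v k \<in> C (min k m)" "v m \<in> C (min k m)"
        using v(1)[of k] v(1)[of m] dec[of "min k m" k] dec[of "min k m" m] by auto
      then have "i (min k m) \<le> J (mid (v k) (v m))" by (intro low mid)
      moreover have "L - e / 2 < i (min k m)" using N[of "min k m"] km by simp
      moreover have "J (v k) < L + e / 2" "J (v m) < L + e / 2"
        using N[OF km(1)] N[OF km(2)] v(2)[of k] v(2)[of m] by linarith+
      ultimately show ?thesis by (simp add: field_simps)
    qed
    then show "\<exists>N. \<forall>k\<ge>N. \<forall>m\<ge>N. (J (v k) + J (v m)) / 2 - J (mid (v k) (v m)) < e" by blast
  qed
qed

section \<open>Weak gradients on bounded open sets\<close>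

locale bounded_open_set =
  fixes \<Omega> :: "'a::euclidean_space set"
  assumes open_\<Omega>: "open \<Omega>" and bounded_\<Omega>: "bounded \<Omega>"
begin

abbreviation M :: "'a measure" where "M \<equiv> lebesgue_on \<Omega>"

lemma sets_\<Omega> [simp]: "\<Omega> \<in> sets lebesgue" "\<Omega> \<in> sets borel" "\<Omega> \<in> lmeasurable"
  using open_\<Omega> bounded_\<Omega> by (auto intro: lmeasurable_open)

sublocale finite_measure M
  by (rule finite_measure_lebesgue_on) simp

lemma integral_lebesgue_on_zero_outside:
  fixes h :: "'a \<Rightarrow> 'b::euclidean_space"
  assumes "\<And>x. x \<notin> \<Omega> \<Longrightarrow> h x = 0"
  shows "(LINT x|M. h x) = (LINT x|lebesgue. h x)" "integrable M h \<longleftrightarrow> integrable lebesgue h"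
proof -
  have "(\<lambda>x. indicator \<Omega> x *\<^sub>R h x) = h"
    using assms by (auto simp: fun_eq_iff indicator_def)
  then show "(LINT x|M. h x) = (LINT x|lebesgue. h x)" "integrable M h \<longleftrightarrow> integrable lebesgue h"
    by (simp_all add: integral_restrict_space integrable_restrict_space)
qed

lemma integral_M_lborel:
  fixes h :: "'a \<Rightarrow> 'b::euclidean_space"
  assumes "h \<in> borel_measurable borel" "\<And>x. x \<notin> \<Omega> \<Longrightarrow> h x = 0"
  shows "(LINT x|M. h x) = (LINT x|lborel. h x)" "integrable M h \<longleftrightarrow> integrable lborel h"
proof -
  have m: "h \<in> borel_measurable lborel" using assms(1) by simp
  show "(LINT x|M. h x) = (LINT x|lborel. h x)"
    by (rule trans[OF integral_lebesgue_on_zero_outside(1)[OF assms(2)] integral_completion[OF m]])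
  show "integrable M h \<longleftrightarrow> integrable lborel h"
    by (rule trans[OF integral_lebesgue_on_zero_outside(2)[OF assms(2)] integrable_completion[OF m]])
qed

lemma AE_M_I: "AE x in lborel. P x \<Longrightarrow> AE x in M. P x"
  unfolding AE_restrict_space_iff[of \<Omega> lebesgue, simplified]
  by (rule AE_mp[OF AE_completion]) auto

lemma continuous_measurable_M:
  fixes h :: "'a \<Rightarrow> 'b::euclidean_space"
  assumes "continuous_on UNIV h"
  shows "h \<in> borel_measurable M"
  by (intro measurable_restrict_space1 measurable_completion)
    (simp add: borel_measurable_continuous_onI[OF assms])

lemma bounded_Lp_fun:
  fixes h :: "'a \<Rightarrow> 'b::euclidean_space"
  assumes "h \<in> borel_measurable M" "AE x in M. norm (h x) \<le> B" "p \<ge> 0"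
  shows "Lp_fun M p h"
proof (rule Lp_fun_bound[OF _ assms(1)])
  show "integrable M (\<lambda>_. B powr p)" by simp
  show "AE x in M. norm (h x) powr p \<le> B powr p"
    using assms(2) by (rule AE_mp) (auto intro!: AE_I2 powr_mono2 assms(3))
qed

lemma test_function_measurable:
  assumes "\<phi> \<in> test_functions \<Omega>"
  shows "\<phi> \<in> borel_measurable M" "grad \<phi> \<in> borel_measurable M"
  using test_functions_smooth[OF assms]
  by (auto intro!: continuous_measurable_M smooth_continuous smooth_grad_continuous)

lemma test_function_Lp:
  assumes "\<phi> \<in> test_functions \<Omega>" "p \<ge> 0"
  shows "Lp_fun M p \<phi>" "Lp_fun M p (grad \<phi>)"
proof -
  obtain B where B: "B \<ge> 0" "\<And>x. \<bar>\<phi> x\<bar> \<le> B" "\<And>x. norm (grad \<phi> x) \<le> B"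
    using test_functions_bounded[OF assms(1)] by blast
  show "Lp_fun M p \<phi>"
    by (rule bounded_Lp_fun[OF test_function_measurable(1)[OF assms(1)] _ assms(2), of B])
      (use B(2) in simp)
  show "Lp_fun M p (grad \<phi>)"
    by (rule bounded_Lp_fun[OF test_function_measurable(2)[OF assms(1)] _ assms(2), of B])
      (use B(3) in simp)
qed

lemma test_function_integrable:
  assumes "\<phi> \<in> test_functions \<Omega>"
  shows "integrable M \<phi>" "integrable M (grad \<phi>)"
  using test_function_Lp[OF assms, of 1] by (auto intro: Lp_fun_integrable[of 1])

lemma integrable_imp_locally_integrable:
  fixes u :: "'a \<Rightarrow> 'b::euclidean_space"
  assumes "integrable M u"
  shows "locally_integrable \<Omega> u"
  unfolding locally_integrable_def
proof (intro allI impI)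
  fix K assume K: "compact K" "K \<subseteq> \<Omega>"
  have "set_integrable lebesgue \<Omega> u"
    using assms by (simp add: set_integrable_def integrable_restrict_space)
  then show "u absolutely_integrable_on K"
    by (rule set_integrable_subset) (use K in \<open>auto intro: lmeasurable_compact fmeasurableD\<close>)
qed

text \<open>
  Integration by parts: the product of two test functions has a gradient with integral zero.
\<close>

lemma test_function_has_weak_grad:
  assumes "\<phi> \<in> test_functions \<Omega>"
  shows "has_weak_grad \<Omega> \<phi> (grad \<phi>)"
  unfolding has_weak_grad_def
proof (intro conjI ballI integrable_imp_locally_integrable test_function_integrable[OF assms])
  fix \<psi> assume \<psi>: "\<psi> \<in> test_functions \<Omega>"
  obtain K where K: "compactly_supported_C1 \<phi> (grad \<phi>) K" "K \<subseteq> \<Omega>"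
    using test_function_C1[OF assms] by blast
  obtain L where L: "compactly_supported_C1 \<psi> (grad \<psi>) L" "L \<subseteq> \<Omega>"
    using test_function_C1[OF \<psi>] by blast
  interpret \<phi>: compactly_supported_C1 \<phi> "grad \<phi>" K by (rule K(1))
  interpret \<psi>: compactly_supported_C1 \<psi> "grad \<psi>" L by (rule L(1))
  interpret P: compactly_supported_C1 "\<lambda>x. \<phi> x * \<psi> x" "\<lambda>x. \<phi> x *\<^sub>R grad \<psi> x + \<psi> x *\<^sub>R grad \<phi> x" K
  proof
    show "GDERIV (\<lambda>x. \<phi> x * \<psi> x) x :> \<phi> x *\<^sub>R grad \<psi> x + \<psi> x *\<^sub>R grad \<phi> x" for x
      by (rule GDERIV_mult[OF \<phi>.deriv \<psi>.deriv])
    show "continuous_on UNIV (\<lambda>x. \<phi> x *\<^sub>R grad \<psi> x + \<psi> x *\<^sub>R grad \<phi> x)"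
      by (intro continuous_on_add continuous_on_scaleR \<phi>.cont \<psi>.cont \<phi>.cont_grad \<psi>.cont_grad)
    show "\<phi> x * \<psi> x = 0" if "x \<notin> K" for x using \<phi>.zero_outside[OF that] by simp
  qed (rule \<phi>.compact_supp)
  have c1: "continuous_on UNIV (\<lambda>x. \<phi> x *\<^sub>R grad \<psi> x)" and c2: "continuous_on UNIV (\<lambda>x. \<psi> x *\<^sub>R grad \<phi> x)"
    by (intro continuous_on_scaleR \<phi>.cont \<psi>.cont \<phi>.cont_grad \<psi>.cont_grad)+
  have i1: "integrable lborel (\<lambda>x. \<phi> x *\<^sub>R grad \<psi> x)"
    by (rule \<phi>.integrable_compact_supp[OF c1 \<phi>.compact_supp]) (simp add: \<phi>.zero_outside)
  have i2: "integrable lborel (\<lambda>x. \<psi> x *\<^sub>R grad \<phi> x)"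
    by (rule \<psi>.integrable_compact_supp[OF c2 \<psi>.compact_supp]) (simp add: \<psi>.zero_outside)
  have "(LINT x|lborel. \<phi> x *\<^sub>R grad \<psi> x) + (LINT x|lborel. \<psi> x *\<^sub>R grad \<phi> x) = 0"
    using P.integral_grad_eq_0 by (simp add: i1 i2)
  moreover have "(LINT x|M. \<phi> x *\<^sub>R grad \<psi> x) = (LINT x|lborel. \<phi> x *\<^sub>R grad \<psi> x)"
    by (rule integral_M_lborel(1)) (simp_all add: borel_measurable_continuous_onI[OF c1] test_functions_zero_outside[OF assms])
  moreover have "(LINT x|M. \<psi> x *\<^sub>R grad \<phi> x) = (LINT x|lborel. \<psi> x *\<^sub>R grad \<phi> x)"
    by (rule integral_M_lborel(1)) (simp_all add: borel_measurable_continuous_onI[OF c2] test_functions_zero_outside[OF assms])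
  ultimately show "(LINT x|M. \<phi> x *\<^sub>R grad \<psi> x) = - (LINT x|M. \<psi> x *\<^sub>R grad \<phi> x)"
    by (simp add: add_eq_0_iff2)
qed

lemma locally_integrable_measurable:
  fixes u :: "'a \<Rightarrow> 'b::euclidean_space"
  assumes "locally_integrable \<Omega> u"
  shows "u \<in> borel_measurable M"
proof -
  obtain C where C: "\<And>n::nat. compact (C n)" "\<And>n. C n \<subseteq> \<Omega>" "\<And>n. C n \<subseteq> interior (C (Suc n))" "\<Union>(range C) = \<Omega>"
    by (rule open_Union_compact_subsets[OF open_\<Omega>]) blast
  have mono: "C m \<subseteq> C n" if "m \<le> n" for m n
    using that by (rule lift_Suc_mono_le[rotated]) (use C(3) interior_subset in blast)
  have m: "(\<lambda>x. indicator (C n) x *\<^sub>R u x) \<in> borel_measurable M" for n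
  proof (intro measurable_restrict_space1)
    have "u absolutely_integrable_on C n"
      using assms C(1,2)[of n] by (simp add: locally_integrable_def)
    then show "(\<lambda>x. indicator (C n) x *\<^sub>R u x) \<in> borel_measurable lebesgue"
      unfolding set_integrable_def by (rule borel_measurable_integrable)
  qed
  have lim: "(\<lambda>n. indicator (C n) x *\<^sub>R u x) \<longlonglongrightarrow> u x" if x: "x \<in> space M" for x
  proof -
    obtain N where "x \<in> C N" using x C(4) by auto
    then have "indicator (C n) x *\<^sub>R u x = u x" if "n \<ge> N" for n using mono[OF that] by auto
    then have "\<forall>\<^sub>F n in sequentially. indicator (C n) x *\<^sub>R u x = u x"
      unfolding eventually_sequentially by blast
    then show ?thesis by (rule tendsto_eventually)
  qed
  show ?thesis by (rule borel_measurable_LIMSEQ_metric[OF m lim])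
qed

lemma test_functions_mono: "U \<subseteq> \<Omega> \<Longrightarrow> \<phi> \<in> test_functions U \<Longrightarrow> \<phi> \<in> test_functions \<Omega>"
  by (auto simp: test_functions_def)

text \<open>
  The indicator of \<open>K\<close> is the pointwise limit of cutoffs that live in shrinking neighbourhoods of \<open>K\<close>, all
  contained in one compact subset \<open>K1\<close> of \<open>\<Omega>\<close> on which \<open>h\<close> is integrable.
\<close>

lemma integral_compact_eq_0:
  fixes h :: "'a \<Rightarrow> 'b::euclidean_space"
  assumes h: "locally_integrable \<Omega> h"
    and ortho: "\<And>\<phi>. \<phi> \<in> test_functions \<Omega> \<Longrightarrow> (LINT x|M. \<phi> x *\<^sub>R h x) = 0"
    and K: "compact K" "K \<subseteq> \<Omega>"
  shows "(LINT x|lebesgue. indicator K x *\<^sub>R h x) = 0"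
proof -
  obtain C where C: "\<And>n::nat. compact (C n)" "\<And>n. C n \<subseteq> \<Omega>" "\<And>n. C n \<subseteq> interior (C (Suc n))"
      "\<And>K. compact K \<Longrightarrow> K \<subseteq> \<Omega> \<Longrightarrow> \<exists>N. \<forall>n\<ge>N. K \<subseteq> C n"
    by (rule open_Union_compact_subsets[OF open_\<Omega>]) blast
  obtain N where "K \<subseteq> C N" using C(4)[OF K] by blast
  define K1 where "K1 = C (Suc N)"
  have K1: "compact K1" "K1 \<subseteq> \<Omega>" "K \<subseteq> interior K1"
    unfolding K1_def using C(1,2) subset_trans[OF \<open>K \<subseteq> C N\<close> C(3)] by blast+
  obtain d where d: "d > 0" "(\<Union>x\<in>K. cball x d) \<subseteq> interior K1"
    using compact_subset_open_imp_cball_epsilon_subset[OF K(1) open_interior K1(3)] by blast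
  define U where "U = (\<lambda>n. \<Union>x\<in>K. ball x (d / real (Suc n)))"
  have U: "open (U n)" "K \<subseteq> U n" "U n \<subseteq> K1" for n
  proof -
    show "open (U n)" "K \<subseteq> U n" unfolding U_def using d(1) by (auto intro!: open_UN)
    have "d / real (Suc n) \<le> d" using d(1) by (simp add: divide_le_eq)
    then have "ball x (d / real (Suc n)) \<subseteq> cball x d" for x :: 'a
      by (meson ball_subset_cball order_trans subset_ball)
    then show "U n \<subseteq> K1" unfolding U_def using d(2) interior_subset by fast
  qed
  have "\<forall>n. \<exists>\<kappa>. \<kappa> \<in> test_functions (U n) \<and> (\<forall>x. 0 \<le> \<kappa> x \<and> \<kappa> x \<le> 1) \<and> (\<forall>x\<in>K. \<kappa> x = 1)"
  proof
    fix n
    obtain \<kappa> where "\<kappa> \<in> test_functions (U n)" "\<And>x. 0 \<le> \<kappa> x" "\<And>x. \<kappa> x \<le> 1" "\<And>x. x \<in> K \<Longrightarrow> \<kappa> x = 1"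
      using smooth_cutoff_exists[OF K(1) U(1,2)] by blast
    then show "\<exists>\<kappa>. \<kappa> \<in> test_functions (U n) \<and> (\<forall>x. 0 \<le> \<kappa> x \<and> \<kappa> x \<le> 1) \<and> (\<forall>x\<in>K. \<kappa> x = 1)"
      by blast
  qed
  from choice[OF this] obtain \<kappa> where \<kappa>: "\<And>n. \<kappa> n \<in> test_functions (U n)"
      "\<And>n x. 0 \<le> \<kappa> n x \<and> \<kappa> n x \<le> 1" "\<And>n x. x \<in> K \<Longrightarrow> \<kappa> n x = 1"
    by blast
  have \<kappa>T: "\<kappa> n \<in> test_functions \<Omega>" for n
    by (rule test_functions_mono[OF _ \<kappa>(1)]) (use U(3) K1(2) in blast)
  have \<kappa>0: "\<kappa> n x = 0" if "x \<notin> U n" for n x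
    by (rule test_functions_zero_outside(1)[OF \<kappa>(1) that])
  have hK1: "integrable lebesgue (\<lambda>x. indicator K1 x *\<^sub>R h x)"
    using h K1(1,2) by (simp add: locally_integrable_def set_integrable_def)
  note m1 [measurable] = borel_measurable_integrable[OF hK1]
  have m2 [measurable]: "\<kappa> n \<in> borel_measurable lebesgue" for n
    by (intro measurable_completion)
      (simp add: borel_measurable_continuous_onI smooth_continuous test_functions_smooth[OF \<kappa>(1)])
  have eq: "\<kappa> n x *\<^sub>R h x = \<kappa> n x *\<^sub>R (indicator K1 x *\<^sub>R h x)" for n x
    using \<kappa>0[of x n] U(3)[of n] by (auto simp: indicator_def)
  have Keq: "indicator K x *\<^sub>R h x = indicator K x *\<^sub>R (indicator K1 x *\<^sub>R h x)" for x
    using K1(3) interior_subset by (auto simp: indicator_def)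
  have mK: "indicator K \<in> borel_measurable lebesgue"
    using K(1) by (intro borel_measurable_indicator) (auto intro: lmeasurable_compact fmeasurableD)
  have lim: "(\<lambda>n. \<kappa> n x *\<^sub>R h x) \<longlonglongrightarrow> indicator K x *\<^sub>R h x" for x
  proof (cases "x \<in> K")
    case True
    then show ?thesis using \<kappa>(3) by simp
  next
    case False
    have "open (- K)" using compact_imp_closed[OF K(1)] by (simp add: open_Compl)
    then obtain e where e: "e > 0" "ball x e \<subseteq> - K" using False open_contains_ball by blast
    obtain m where m: "inverse (real (Suc m)) < e / d" using reals_Archimedean[of "e / d"] e d(1) by auto
    have "\<kappa> n x *\<^sub>R h x = 0" if n: "n \<ge> m" for n
    proof -
      have "x \<notin> U n"
      proof
        assume "x \<in> U n"
        then obtain y where y: "y \<in> K" "dist y x < d / real (Suc n)" by (auto simp: U_def)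
        have "d / real (Suc n) \<le> d * inverse (real (Suc m))"
          using d(1) n by (simp add: divide_inverse le_imp_inverse_le)
        also have "\<dots> < d * (e / d)" using m d(1) by (intro mult_strict_left_mono)
        also have "\<dots> = e" using d(1) by simp
        finally have "y \<in> ball x e" using y(2) by (simp add: dist_commute)
        with e(2) y(1) show False by blast
      qed
      then show ?thesis using \<kappa>0 by simp
    qed
    then have "\<forall>\<^sub>F n in sequentially. \<kappa> n x *\<^sub>R h x = 0" unfolding eventually_sequentially by blast
    then show ?thesis using False by (simp add: tendsto_eventually)
  qed
  have "(\<lambda>n. LINT x|lebesgue. \<kappa> n x *\<^sub>R h x) \<longlonglongrightarrow> (LINT x|lebesgue. indicator K x *\<^sub>R h x)"
  proof (rule integral_dominated_convergence[where w = "\<lambda>x. norm (indicator K1 x *\<^sub>R h x)"])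
    show "(\<lambda>x. indicator K x *\<^sub>R h x) \<in> borel_measurable lebesgue"
      unfolding Keq by (rule borel_measurable_scaleR[OF mK m1])
    show "(\<lambda>x. \<kappa> n x *\<^sub>R h x) \<in> borel_measurable lebesgue" for n
      unfolding eq[of n] by (rule borel_measurable_scaleR[OF m2 m1])
    show "integrable lebesgue (\<lambda>x. norm (indicator K1 x *\<^sub>R h x))" by (rule integrable_norm[OF hK1])
    show "AE x in lebesgue. (\<lambda>n. \<kappa> n x *\<^sub>R h x) \<longlonglongrightarrow> indicator K x *\<^sub>R h x"
      by (intro AE_I2 lim)
    show "AE x in lebesgue. norm (\<kappa> n x *\<^sub>R h x) \<le> norm (indicator K1 x *\<^sub>R h x)" for n
    proof (rule AE_I2)
      fix x
      have "norm (\<kappa> n x *\<^sub>R h x) = \<bar>\<kappa> n x\<bar> * norm (indicator K1 x *\<^sub>R h x)"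
        unfolding eq[of n] by (rule norm_scaleR)
      also have "\<dots> \<le> 1 * norm (indicator K1 x *\<^sub>R h x)"
        using \<kappa>(2)[of n x] by (intro mult_right_mono) auto
      finally show "norm (\<kappa> n x *\<^sub>R h x) \<le> norm (indicator K1 x *\<^sub>R h x)" by simp
    qed
  qed
  moreover have "(LINT x|lebesgue. \<kappa> n x *\<^sub>R h x) = 0" for n
    using ortho[OF \<kappa>T[of n]]
    by (subst integral_lebesgue_on_zero_outside(1)[symmetric]) (simp_all add: test_functions_zero_outside(1)[OF \<kappa>T])
  ultimately show ?thesis by (simp add: LIMSEQ_const_iff)
qed

text \<open>
  Otherwise the set where \<open>h\<close> is positive would, by inner regularity, contain a compact set of positive
  measure, and the integral of \<open>h\<close> over that set would be positive.
\<close>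

lemma AE_le_0_of_integral_compact:
  fixes h :: "'a \<Rightarrow> real"
  assumes h: "locally_integrable \<Omega> h"
    and zero: "\<And>K. compact K \<Longrightarrow> K \<subseteq> \<Omega> \<Longrightarrow> (LINT x|lebesgue. indicator K x * h x) = 0"
  shows "AE x in M. h x \<le> 0"
proof -
  define S where "S = {x \<in> \<Omega>. 0 < h x}"
  have "{x \<in> space M. 0 < h x} \<in> sets M"
    using locally_integrable_measurable[OF h] by measurable
  then have S: "S \<in> sets lebesgue" by (simp add: S_def sets_restrict_space_iff)
  have bS: "bounded S" using bounded_\<Omega> by (rule bounded_subset) (auto simp: S_def)
  have "S \<in> null_sets lebesgue"
  proof (rule ccontr)
    assume nn: "S \<notin> null_sets lebesgue"
    have lS: "S \<in> lmeasurable" by (rule bounded_set_imp_lmeasurable[OF bS S])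
    then have e: "measure lebesgue S > 0"
      using nn S by (simp add: null_sets_def emeasure_eq_measure2 zero_less_measure_iff)
    obtain T where T: "closed T" "T \<subseteq> S" "S - T \<in> lmeasurable" "emeasure lebesgue (S - T) < ennreal (measure lebesgue S)"
      using sets_lebesgue_inner_closed[OF S e] by blast
    have cT: "compact T"
      using T(1,2) bS bounded_subset compact_eq_bounded_closed by blast
    have T\<Omega>: "T \<subseteq> \<Omega>" using T(2) by (auto simp: S_def)
    have i: "integrable lebesgue (\<lambda>x. indicator T x * h x)"
      using h cT T\<Omega> by (simp add: locally_integrable_def set_integrable_def)
    have "AE x in lebesgue. indicator T x * h x = 0"
      using zero[OF cT T\<Omega>] T(2)
      by (subst integral_nonneg_eq_0_iff_AE[OF i, symmetric]) (auto intro!: AE_I2 simp: S_def indicator_def)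
    then have "AE x in lebesgue. x \<notin> T"
      by (rule AE_mp) (use T(2) in \<open>auto intro!: AE_I2 simp: S_def indicator_def\<close>)
    then have T0: "emeasure lebesgue T = 0"
      using cT by (subst AE_iff_measurable[symmetric, where P = "\<lambda>x. x \<notin> T"])
        (auto intro: fmeasurableD lmeasurable_compact)
    have "emeasure lebesgue S \<le> emeasure lebesgue (S - T) + emeasure lebesgue T"
      using emeasure_subadditive[of "S - T" lebesgue T] T(2,3) cT
      by (simp add: Un_absorb2 fmeasurableD lmeasurable_compact)
    also have "\<dots> < ennreal (measure lebesgue S)" using T(4) T0 by simp
    also have "\<dots> = emeasure lebesgue S" using lS by (simp add: emeasure_eq_measure2)
    finally show False by simp
  qed
  then have "AE x in lebesgue. x \<notin> S" by (rule AE_not_in)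
  then show ?thesis
    unfolding AE_restrict_space_iff[of \<Omega> lebesgue, simplified]
    by (rule AE_mp) (auto intro!: AE_I2 simp: S_def)
qed

lemma locally_integrable_diff:
  "locally_integrable \<Omega> u \<Longrightarrow> locally_integrable \<Omega> v \<Longrightarrow> locally_integrable \<Omega> (\<lambda>x. u x - v x)"
  unfolding locally_integrable_def by (auto intro: set_integral_diff)

lemma locally_integrable_test_function:
  assumes h: "locally_integrable \<Omega> h" and \<phi>: "\<phi> \<in> test_functions \<Omega>"
  shows "integrable M (\<lambda>x. \<phi> x *\<^sub>R h x)"
proof -
  obtain K where K: "compact K" "K \<subseteq> \<Omega>" "\<And>x. x \<notin> K \<Longrightarrow> \<phi> x = 0" "\<And>x. x \<notin> K \<Longrightarrow> grad \<phi> x = 0"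
    using test_functions_support[OF \<phi>] by blast
  obtain B where B: "B \<ge> 0" "\<And>x. \<bar>\<phi> x\<bar> \<le> B" "\<And>x. norm (grad \<phi> x) \<le> B"
    using test_functions_bounded[OF \<phi>] by blast
  have i: "integrable lebesgue (\<lambda>x. indicator K x *\<^sub>R h x)"
    using h K(1,2) by (simp add: locally_integrable_def set_integrable_def)
  have m: "\<phi> \<in> borel_measurable lebesgue"
    by (intro measurable_completion)
      (simp add: borel_measurable_continuous_onI smooth_continuous test_functions_smooth[OF \<phi>])
  have eq: "\<phi> x *\<^sub>R h x = \<phi> x *\<^sub>R (indicator K x *\<^sub>R h x)" for x
    using K(3)[of x] by (auto simp: indicator_def)
  have "integrable lebesgue (\<lambda>x. \<phi> x *\<^sub>R (indicator K x *\<^sub>R h x))"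
  proof (rule Bochner_Integration.integrable_bound)
    show "integrable lebesgue (\<lambda>x. B * norm (indicator K x *\<^sub>R h x))"
      by (intro integrable_mult_right integrable_norm i)
    show "(\<lambda>x. \<phi> x *\<^sub>R (indicator K x *\<^sub>R h x)) \<in> borel_measurable lebesgue"
      by (rule borel_measurable_scaleR[OF m borel_measurable_integrable[OF i]])
    show "AE x in lebesgue. norm (\<phi> x *\<^sub>R (indicator K x *\<^sub>R h x)) \<le> norm (B * norm (indicator K x *\<^sub>R h x))"
    proof (rule AE_I2)
      fix x
      have "\<bar>\<phi> x\<bar> * norm (indicator K x *\<^sub>R h x) \<le> B * norm (indicator K x *\<^sub>R h x)"
        by (rule mult_right_mono[OF B(2)]) simp
      then show "norm (\<phi> x *\<^sub>R (indicator K x *\<^sub>R h x)) \<le> norm (B * norm (indicator K x *\<^sub>R h x))"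
        using B(1) by (simp add: abs_mult mult.assoc)
    qed
  qed
  then have "integrable lebesgue (\<lambda>x. \<phi> x *\<^sub>R h x)" unfolding eq[symmetric] .
  then show ?thesis
    by (subst integral_lebesgue_on_zero_outside(2)) (simp_all add: test_functions_zero_outside(1)[OF \<phi>])
qed

text \<open>
  This makes \<open>weak_grad\<close>, which is chosen among all weak gradients, well defined up to null sets.
\<close>

lemma has_weak_grad_unique:
  assumes g: "has_weak_grad \<Omega> u g1" "has_weak_grad \<Omega> u g2"
  shows "AE x in M. g1 x = g2 x"
proof -
  define h where "h = (\<lambda>x. g1 x - g2 x)"
  have l: "locally_integrable \<Omega> g1" "locally_integrable \<Omega> g2"
    using g by (auto simp: has_weak_grad_def)
  then have lh: "locally_integrable \<Omega> h" unfolding h_def by (rule locally_integrable_diff)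
  have ortho: "(LINT x|M. \<phi> x *\<^sub>R h x) = 0" if \<phi>: "\<phi> \<in> test_functions \<Omega>" for \<phi>
  proof -
    have "(LINT x|M. \<phi> x *\<^sub>R g1 x) = (LINT x|M. \<phi> x *\<^sub>R g2 x)"
      using g \<phi> by (simp add: has_weak_grad_def)
    then show ?thesis
      unfolding h_def scaleR_diff_right
      by (subst Bochner_Integration.integral_diff)
        (simp_all add: locally_integrable_test_function[OF l(1) \<phi>] locally_integrable_test_function[OF l(2) \<phi>])
  qed
  have comp: "AE x in M. h x \<bullet> b = 0" for b
  proof -
    have lc: "locally_integrable \<Omega> (\<lambda>x. h x \<bullet> c)" for c
      unfolding locally_integrable_def
    proof (intro allI impI)
      fix K assume K: "compact K" "K \<subseteq> \<Omega>"
      have "integrable lebesgue (\<lambda>x. (indicator K x *\<^sub>R h x) \<bullet> c)"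
        using lh K by (intro integrable_inner_left) (auto simp: locally_integrable_def set_integrable_def)
      then show "(\<lambda>x. h x \<bullet> c) absolutely_integrable_on K" by (simp add: set_integrable_def)
    qed
    have z: "(LINT x|lebesgue. indicator K x * (h x \<bullet> c)) = 0" if K: "compact K" "K \<subseteq> \<Omega>" for K c
    proof -
      have "integrable lebesgue (\<lambda>x. indicator K x *\<^sub>R h x)"
        using lh K by (simp add: locally_integrable_def set_integrable_def)
      then have "(LINT x|lebesgue. (indicator K x *\<^sub>R h x) \<bullet> c) = (LINT x|lebesgue. indicator K x *\<^sub>R h x) \<bullet> c"
        by (simp only: integral_inner_left)
      also have "\<dots> = 0" using integral_compact_eq_0[OF lh ortho K] by simp
      finally show ?thesis by simp
    qed
    have "AE x in M. h x \<bullet> b \<le> 0" by (rule AE_le_0_of_integral_compact[OF lc z])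
    moreover have "AE x in M. h x \<bullet> (- b) \<le> 0" by (rule AE_le_0_of_integral_compact[OF lc z])
    ultimately show ?thesis by eventually_elim simp
  qed
  have "AE x in M. \<forall>b\<in>Basis. h x \<bullet> b = 0"
    by (intro AE_finite_allI finite_Basis comp)
  then show ?thesis
    by (rule AE_mp) (auto intro!: AE_I2 simp: h_def euclidean_eq_iff[of "g1 _"] inner_diff_left)
qed

lemma weak_grad_props:
  assumes "has_weak_grad \<Omega> u g"
  shows "has_weak_grad \<Omega> u (weak_grad \<Omega> u)" "AE x in M. weak_grad \<Omega> u x = g x"
    "weak_grad \<Omega> u \<in> borel_measurable M"
proof -
  show *: "has_weak_grad \<Omega> u (weak_grad \<Omega> u)"
    unfolding weak_grad_def by (rule someI[of "has_weak_grad \<Omega> u", OF assms])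
  then show "AE x in M. weak_grad \<Omega> u x = g x" by (rule has_weak_grad_unique[OF _ assms])
  show "weak_grad \<Omega> u \<in> borel_measurable M"
    using * by (intro locally_integrable_measurable) (simp add: has_weak_grad_def)
qed

lemma integrable_mult_test:
  fixes u :: "'a \<Rightarrow> 'b::euclidean_space"
  assumes "integrable M u" "\<phi> \<in> test_functions \<Omega>"
  shows "integrable M (\<lambda>x. \<phi> x *\<^sub>R u x)"
  by (rule locally_integrable_test_function[OF integrable_imp_locally_integrable[OF assms(1)] assms(2)])

lemma integrable_scale_grad:
  fixes u :: "'a \<Rightarrow> real"
  assumes "integrable M u" "\<phi> \<in> test_functions \<Omega>"
  shows "integrable M (\<lambda>x. u x *\<^sub>R grad \<phi> x)"
proof -
  obtain B where B: "B \<ge> 0" "\<And>x. \<bar>\<phi> x\<bar> \<le> B" "\<And>x. norm (grad \<phi> x) \<le> B"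
    using test_functions_bounded[OF assms(2)] by blast
  show ?thesis
  proof (rule Bochner_Integration.integrable_bound)
    show "integrable M (\<lambda>x. B * \<bar>u x\<bar>)" using assms(1) by (intro integrable_mult_right integrable_abs)
    show "(\<lambda>x. u x *\<^sub>R grad \<phi> x) \<in> borel_measurable M"
      by (intro borel_measurable_scaleR borel_measurable_integrable[OF assms(1)] test_function_measurable assms(2))
    show "AE x in M. norm (u x *\<^sub>R grad \<phi> x) \<le> norm (B * \<bar>u x\<bar>)"
    proof (rule AE_I2)
      fix x
      have "norm (grad \<phi> x) * \<bar>u x\<bar> \<le> B * \<bar>u x\<bar>"
        by (rule mult_right_mono[OF B(3)]) simp
      then show "norm (u x *\<^sub>R grad \<phi> x) \<le> norm (B * \<bar>u x\<bar>)"
        using B(1) by (simp add: abs_mult mult.commute)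
    qed
  qed
qed

lemma has_weak_grad_lincomb:
  assumes "has_weak_grad \<Omega> u g" "has_weak_grad \<Omega> v h"
    and i: "integrable M u" "integrable M g" "integrable M v" "integrable M h"
  shows "has_weak_grad \<Omega> (\<lambda>x. c * u x + d * v x) (\<lambda>x. c *\<^sub>R g x + d *\<^sub>R h x)"
  unfolding has_weak_grad_def
proof (intro conjI ballI)
  show "locally_integrable \<Omega> (\<lambda>x. c * u x + d * v x)" "locally_integrable \<Omega> (\<lambda>x. c *\<^sub>R g x + d *\<^sub>R h x)"
    using i by (auto intro!: integrable_imp_locally_integrable)
  fix \<phi> assume \<phi>: "\<phi> \<in> test_functions \<Omega>"
  have 1: "(LINT x|M. (c * u x + d * v x) *\<^sub>R grad \<phi> x)
      = c *\<^sub>R (LINT x|M. u x *\<^sub>R grad \<phi> x) + d *\<^sub>R (LINT x|M. v x *\<^sub>R grad \<phi> x)"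
    using integrable_scale_grad[OF i(1) \<phi>] integrable_scale_grad[OF i(3) \<phi>]
    by (simp add: scaleR_add_left flip: scaleR_scaleR)
  have 2: "(LINT x|M. \<phi> x *\<^sub>R (c *\<^sub>R g x + d *\<^sub>R h x))
      = c *\<^sub>R (LINT x|M. \<phi> x *\<^sub>R g x) + d *\<^sub>R (LINT x|M. \<phi> x *\<^sub>R h x)"
  proof -
    have "\<phi> x *\<^sub>R (c *\<^sub>R g x + d *\<^sub>R h x) = c *\<^sub>R (\<phi> x *\<^sub>R g x) + d *\<^sub>R (\<phi> x *\<^sub>R h x)" for x
      by (simp add: scaleR_add_right mult.commute)
    then show ?thesis
      using integrable_mult_test[OF i(2) \<phi>] integrable_mult_test[OF i(4) \<phi>]
      by (simp del: scaleR_scaleR)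
  qed
  show "(LINT x|M. (c * u x + d * v x) *\<^sub>R grad \<phi> x) = - (LINT x|M. \<phi> x *\<^sub>R (c *\<^sub>R g x + d *\<^sub>R h x))"
    using assms(1,2) \<phi> unfolding 1 2 by (simp add: has_weak_grad_def)
qed

lemma has_weak_grad_limit:
  assumes wg: "\<And>k. has_weak_grad \<Omega> (v k) (G k)"
    and i: "\<And>k. integrable M (v k)" "\<And>k. integrable M (G k)" "integrable M u" "integrable M g"
    and lim: "(\<lambda>k. LINT x|M. \<bar>v k x - u x\<bar>) \<longlonglongrightarrow> 0" "(\<lambda>k. LINT x|M. norm (G k x - g x)) \<longlonglongrightarrow> 0"
  shows "has_weak_grad \<Omega> u g"
  unfolding has_weak_grad_def
proof (intro conjI ballI integrable_imp_locally_integrable i(3,4))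
  fix \<phi> assume \<phi>: "\<phi> \<in> test_functions \<Omega>"
  obtain B where B: "B \<ge> 0" "\<And>x. \<bar>\<phi> x\<bar> \<le> B" "\<And>x. norm (grad \<phi> x) \<le> B"
    using test_functions_bounded[OF \<phi>] by blast
  have "(\<lambda>k. (LINT x|M. v k x *\<^sub>R grad \<phi> x) - (LINT x|M. u x *\<^sub>R grad \<phi> x)) \<longlonglongrightarrow> 0"
  proof (rule Lim_null_comparison)
    show "(\<lambda>k. B * (LINT x|M. \<bar>v k x - u x\<bar>)) \<longlonglongrightarrow> 0"
      using tendsto_mult_right_zero[OF lim(1)] by simp
    have "norm ((LINT x|M. v k x *\<^sub>R grad \<phi> x) - (LINT x|M. u x *\<^sub>R grad \<phi> x)) \<le> B * (LINT x|M. \<bar>v k x - u x\<bar>)" for k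
    proof -
      have d: "integrable M (\<lambda>x. v k x - u x)" using i by auto
      have "norm ((LINT x|M. v k x *\<^sub>R grad \<phi> x) - (LINT x|M. u x *\<^sub>R grad \<phi> x))
          = norm (LINT x|M. (v k x - u x) *\<^sub>R grad \<phi> x)"
        by (simp add: scaleR_diff_left integrable_scale_grad[OF i(1) \<phi>] integrable_scale_grad[OF i(3) \<phi>])
      also have "\<dots> \<le> (LINT x|M. norm ((v k x - u x) *\<^sub>R grad \<phi> x))" by (rule integral_norm_bound)
      also have "\<dots> \<le> (LINT x|M. B * \<bar>v k x - u x\<bar>)"
        by (rule integral_mono[OF integrable_norm[OF integrable_scale_grad[OF d \<phi>]]])
          (use d B in \<open>auto simp: mult.commute[of "\<bar>_\<bar>"] intro!: mult_right_mono\<close>)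
      finally show ?thesis by simp
    qed
    then show "\<forall>\<^sub>F k in sequentially. norm ((LINT x|M. v k x *\<^sub>R grad \<phi> x) - (LINT x|M. u x *\<^sub>R grad \<phi> x)) \<le> B * (LINT x|M. \<bar>v k x - u x\<bar>)"
      by (intro always_eventually allI)
  qed
  then have 1: "(\<lambda>k. LINT x|M. v k x *\<^sub>R grad \<phi> x) \<longlonglongrightarrow> (LINT x|M. u x *\<^sub>R grad \<phi> x)"
    by (rule LIM_zero_cancel)
  have "(\<lambda>k. (LINT x|M. \<phi> x *\<^sub>R G k x) - (LINT x|M. \<phi> x *\<^sub>R g x)) \<longlonglongrightarrow> 0"
  proof (rule Lim_null_comparison)
    show "(\<lambda>k. B * (LINT x|M. norm (G k x - g x))) \<longlonglongrightarrow> 0"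
      using tendsto_mult_right_zero[OF lim(2)] by simp
    have "norm ((LINT x|M. \<phi> x *\<^sub>R G k x) - (LINT x|M. \<phi> x *\<^sub>R g x)) \<le> B * (LINT x|M. norm (G k x - g x))" for k
    proof -
      have d: "integrable M (\<lambda>x. G k x - g x)" using i by auto
      have "norm ((LINT x|M. \<phi> x *\<^sub>R G k x) - (LINT x|M. \<phi> x *\<^sub>R g x))
          = norm (LINT x|M. \<phi> x *\<^sub>R (G k x - g x))"
        by (simp add: scaleR_diff_right integrable_mult_test[OF i(2) \<phi>] integrable_mult_test[OF i(4) \<phi>])
      also have "\<dots> \<le> (LINT x|M. norm (\<phi> x *\<^sub>R (G k x - g x)))" by (rule integral_norm_bound)
      also have "\<dots> \<le> (LINT x|M. B * norm (G k x - g x))"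
        by (rule integral_mono[OF integrable_norm[OF integrable_mult_test[OF d \<phi>]]])
          (use d B in \<open>auto intro!: mult_right_mono\<close>)
      finally show ?thesis by simp
    qed
    then show "\<forall>\<^sub>F k in sequentially. norm ((LINT x|M. \<phi> x *\<^sub>R G k x) - (LINT x|M. \<phi> x *\<^sub>R g x)) \<le> B * (LINT x|M. norm (G k x - g x))"
      by (intro always_eventually allI)
  qed
  then have "(\<lambda>k. LINT x|M. \<phi> x *\<^sub>R G k x) \<longlonglongrightarrow> (LINT x|M. \<phi> x *\<^sub>R g x)"
    by (rule LIM_zero_cancel)
  from tendsto_minus[OF this]
  have 2: "(\<lambda>k. LINT x|M. v k x *\<^sub>R grad \<phi> x) \<longlonglongrightarrow> - (LINT x|M. \<phi> x *\<^sub>R g x)"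
    using wg \<phi> by (simp add: has_weak_grad_def)
  show "(LINT x|M. u x *\<^sub>R grad \<phi> x) = - (LINT x|M. \<phi> x *\<^sub>R g x)"
    by (rule LIMSEQ_unique[OF 1 2])
qed

end

section \<open>Limits of test functions\<close>

context bounded_open_set
begin

text \<open>
  Membership in \<open>W1p_0\<close> together with an explicit gradient: \<open>u\<close> and \<open>g\<close> are limits in \<open>L^p\<close> of test functions
  and of their gradients. Sums and limits can be formed without going through the choice made in
  \<open>weak_grad\<close>; the lemmas \<open>W0_imp_W1p_0\<close> and \<open>W1p_0_imp_W0\<close> translate.
\<close>

definition W0 :: "real \<Rightarrow> ('a \<Rightarrow> real) \<Rightarrow> ('a \<Rightarrow> 'a) \<Rightarrow> bool" where
  "W0 p u g \<longleftrightarrow> Lp_fun M p u \<and> Lp_fun M p g \<and>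
     (\<exists>\<phi>. (\<forall>k::nat. \<phi> k \<in> test_functions \<Omega>) \<and>
        (\<lambda>k. LINT x|M. norm (u x - \<phi> k x) powr p) \<longlonglongrightarrow> 0 \<and>
        (\<lambda>k. LINT x|M. norm (g x - grad (\<phi> k) x) powr p) \<longlonglongrightarrow> 0)"

lemma W0_Lp: "W0 p u g \<Longrightarrow> Lp_fun M p u" "W0 p u g \<Longrightarrow> Lp_fun M p g"
  by (simp_all add: W0_def)

lemma W0_approx:
  assumes "W0 p u g"
  obtains \<phi> where "\<And>k::nat. \<phi> k \<in> test_functions \<Omega>"
    "(\<lambda>k. LINT x|M. norm (u x - \<phi> k x) powr p) \<longlonglongrightarrow> 0"
    "(\<lambda>k. LINT x|M. norm (g x - grad (\<phi> k) x) powr p) \<longlonglongrightarrow> 0"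
  using assms unfolding W0_def by blast

lemma Lp_tendsto_add_scale:
  fixes u v :: "nat \<Rightarrow> 'a \<Rightarrow> 'b::euclidean_space"
  assumes p: "p \<ge> 0" and L: "\<And>k. Lp_fun M p (u k)" "\<And>k. Lp_fun M p (v k)"
    and lim: "(\<lambda>k. LINT x|M. norm (u k x) powr p) \<longlonglongrightarrow> 0" "(\<lambda>k. LINT x|M. norm (v k x) powr p) \<longlonglongrightarrow> 0"
  shows "(\<lambda>k. LINT x|M. norm (u k x + t *\<^sub>R v k x) powr p) \<longlonglongrightarrow> 0"
proof (rule Lim_null_comparison)
  have "(\<lambda>k. 2 powr p * ((LINT x|M. norm (u k x) powr p) + \<bar>t\<bar> powr p * (LINT x|M. norm (v k x) powr p)))
      \<longlonglongrightarrow> 2 powr p * (0 + \<bar>t\<bar> powr p * 0)"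
    by (intro tendsto_mult tendsto_add tendsto_const lim)
  then show "(\<lambda>k. 2 powr p * ((LINT x|M. norm (u k x) powr p) + \<bar>t\<bar> powr p * (LINT x|M. norm (v k x) powr p)))
      \<longlonglongrightarrow> 0" by simp
  have "norm (LINT x|M. norm (u k x + t *\<^sub>R v k x) powr p)
      \<le> 2 powr p * ((LINT x|M. norm (u k x) powr p) + \<bar>t\<bar> powr p * (LINT x|M. norm (v k x) powr p))" for k
  proof -
    have i: "integrable M (\<lambda>x. norm (u k x) powr p)" "integrable M (\<lambda>x. \<bar>t\<bar> powr p * norm (v k x) powr p)"
      using Lp_funD(2)[OF L(1)[of k]] Lp_funD(2)[OF L(2)[of k]] by auto
    have "(LINT x|M. norm (u k x + t *\<^sub>R v k x) powr p)
        \<le> (LINT x|M. 2 powr p * (norm (u k x) powr p + \<bar>t\<bar> powr p * norm (v k x) powr p))"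
    proof (rule integral_mono)
      show "integrable M (\<lambda>x. norm (u k x + t *\<^sub>R v k x) powr p)"
        by (rule Lp_funD(2)[OF Lp_fun_add[OF p L(1) Lp_fun_scale[OF L(2)]]])
      show "integrable M (\<lambda>x. 2 powr p * (norm (u k x) powr p + \<bar>t\<bar> powr p * norm (v k x) powr p))"
        by (intro integrable_mult_right Bochner_Integration.integrable_add i)
      show "norm (u k x + t *\<^sub>R v k x) powr p
          \<le> 2 powr p * (norm (u k x) powr p + \<bar>t\<bar> powr p * norm (v k x) powr p)" for x
        using norm_add_powr_le[OF p, of "u k x" "t *\<^sub>R v k x"] by (simp add: powr_mult)
    qed
    also have "\<dots> = 2 powr p * ((LINT x|M. norm (u k x) powr p) + \<bar>t\<bar> powr p * (LINT x|M. norm (v k x) powr p))"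
      using i by (simp add: Lp_funD(2)[OF L(2)[of k]])
    finally show ?thesis by (simp add: abs_of_nonneg)
  qed
  then show "\<forall>\<^sub>F k in sequentially. norm (LINT x|M. norm (u k x + t *\<^sub>R v k x) powr p)
      \<le> 2 powr p * ((LINT x|M. norm (u k x) powr p) + \<bar>t\<bar> powr p * (LINT x|M. norm (v k x) powr p))"
    by (intro always_eventually allI)
qed

lemma W0_add_scale:
  assumes p: "p \<ge> 0" and "W0 p u g" "W0 p v h"
  shows "W0 p (\<lambda>x. u x + t *\<^sub>R v x) (\<lambda>x. g x + t *\<^sub>R h x)"
proof -
  obtain \<phi> where \<phi>: "\<And>k::nat. \<phi> k \<in> test_functions \<Omega>"
    "(\<lambda>k. LINT x|M. norm (u x - \<phi> k x) powr p) \<longlonglongrightarrow> 0"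
    "(\<lambda>k. LINT x|M. norm (g x - grad (\<phi> k) x) powr p) \<longlonglongrightarrow> 0"
    using W0_approx[OF assms(2)] by blast
  obtain \<psi> where \<psi>: "\<And>k::nat. \<psi> k \<in> test_functions \<Omega>"
    "(\<lambda>k. LINT x|M. norm (v x - \<psi> k x) powr p) \<longlonglongrightarrow> 0"
    "(\<lambda>k. LINT x|M. norm (h x - grad (\<psi> k) x) powr p) \<longlonglongrightarrow> 0"
    using W0_approx[OF assms(3)] by blast
  note Lu = W0_Lp[OF assms(2)] and Lv = W0_Lp[OF assms(3)]
  have 1: "(\<lambda>k. LINT x|M. norm ((u x - \<phi> k x) + t *\<^sub>R (v x - \<psi> k x)) powr p) \<longlonglongrightarrow> 0"
    by (rule Lp_tendsto_add_scale[OF p Lp_fun_diff[OF p Lu(1) test_function_Lp(1)[OF \<phi>(1) p]]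
          Lp_fun_diff[OF p Lv(1) test_function_Lp(1)[OF \<psi>(1) p]] \<phi>(2) \<psi>(2)])
  have 2: "(\<lambda>k. LINT x|M. norm ((g x - grad (\<phi> k) x) + t *\<^sub>R (h x - grad (\<psi> k) x)) powr p) \<longlonglongrightarrow> 0"
    by (rule Lp_tendsto_add_scale[OF p Lp_fun_diff[OF p Lu(2) test_function_Lp(2)[OF \<phi>(1) p]]
          Lp_fun_diff[OF p Lv(2) test_function_Lp(2)[OF \<psi>(1) p]] \<phi>(3) \<psi>(3)])
  define \<theta> where "\<theta> = (\<lambda>k x. 1 * \<phi> k x + t * \<psi> k x)"
  have \<theta>: "\<theta> k \<in> test_functions \<Omega>" "grad (\<theta> k) x = 1 *\<^sub>R grad (\<phi> k) x + t *\<^sub>R grad (\<psi> k) x" for k x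
    unfolding \<theta>_def by (rule test_functions_add[OF \<phi>(1) \<psi>(1)])+
  have e1: "(u x + t *\<^sub>R v x) - \<theta> k x = (u x - \<phi> k x) + t *\<^sub>R (v x - \<psi> k x)" for k x
    by (simp add: \<theta>_def algebra_simps)
  have e2: "(g x + t *\<^sub>R h x) - grad (\<theta> k) x = (g x - grad (\<phi> k) x) + t *\<^sub>R (h x - grad (\<psi> k) x)" for k x
    by (simp add: \<theta>(2) algebra_simps)
  show ?thesis
    unfolding W0_def
  proof (intro conjI exI allI)
    show "Lp_fun M p (\<lambda>x. u x + t *\<^sub>R v x)" "Lp_fun M p (\<lambda>x. g x + t *\<^sub>R h x)"
      by (intro Lp_fun_add[OF p] Lp_fun_scale Lu Lv)+
    show "\<theta> k \<in> test_functions \<Omega>" for k by (rule \<theta>(1))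
    show "(\<lambda>k. LINT x|M. norm (u x + t *\<^sub>R v x - \<theta> k x) powr p) \<longlonglongrightarrow> 0" unfolding e1 by (rule 1)
    show "(\<lambda>k. LINT x|M. norm (g x + t *\<^sub>R h x - grad (\<theta> k) x) powr p) \<longlonglongrightarrow> 0" unfolding e2 by (rule 2)
  qed
qed

lemma W0_has_weak_grad:
  assumes p: "p \<ge> 1" and W: "W0 p u g"
  shows "has_weak_grad \<Omega> u g"
proof -
  have p0: "p \<ge> 0" using p by simp
  obtain \<phi> where \<phi>: "\<And>k::nat. \<phi> k \<in> test_functions \<Omega>"
    "(\<lambda>k. LINT x|M. norm (u x - \<phi> k x) powr p) \<longlonglongrightarrow> 0"
    "(\<lambda>k. LINT x|M. norm (g x - grad (\<phi> k) x) powr p) \<longlonglongrightarrow> 0"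
    using W0_approx[OF W] by blast
  note L = W0_Lp[OF W]
  show ?thesis
  proof (rule has_weak_grad_limit[OF test_function_has_weak_grad[OF \<phi>(1)] test_function_integrable[OF \<phi>(1)]])
    show "integrable M u" "integrable M g" using L by (auto intro: Lp_fun_integrable[OF p])
    have "(\<lambda>k. LINT x|M. norm (u x - \<phi> k x)) \<longlonglongrightarrow> 0"
      by (rule Lp_tendsto_imp_L1_tendsto[OF p Lp_fun_diff[OF p0 L(1) test_function_Lp(1)[OF \<phi>(1) p0]] \<phi>(2)])
    then show "(\<lambda>k. LINT x|M. \<bar>\<phi> k x - u x\<bar>) \<longlonglongrightarrow> 0" by (simp add: abs_minus_commute)
    have "(\<lambda>k. LINT x|M. norm (g x - grad (\<phi> k) x)) \<longlonglongrightarrow> 0"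
      by (rule Lp_tendsto_imp_L1_tendsto[OF p Lp_fun_diff[OF p0 L(2) test_function_Lp(2)[OF \<phi>(1) p0]] \<phi>(3)])
    then show "(\<lambda>k. LINT x|M. norm (grad (\<phi> k) x - g x)) \<longlonglongrightarrow> 0" by (simp add: norm_minus_commute)
  qed
qed

lemma Lp_space_iff: "u \<in> Lp_space \<Omega> p \<longleftrightarrow> Lp_fun M p u"
  by (simp add: Lp_space_def Lp_fun_def)

lemma W1p_norm_eq:
  assumes "has_weak_grad \<Omega> u g" "g \<in> borel_measurable M"
  shows "W1p_norm \<Omega> p u = ((LINT x|M. \<bar>u x\<bar> powr p) + (LINT x|M. norm (g x) powr p)) powr (1 / p)"
proof -
  note w = weak_grad_props[OF assms(1)]
  note [measurable] = w(3) assms(2)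
  have "(LINT x|M. norm (weak_grad \<Omega> u x) powr p) = (LINT x|M. norm (g x) powr p)"
  proof (rule integral_cong_AE)
    show "AE x in M. norm (weak_grad \<Omega> u x) powr p = norm (g x) powr p"
      using w(2) by (rule AE_mp) (auto intro!: AE_I2)
  qed measurable
  then show ?thesis by (simp add: W1p_norm_def)
qed

lemma has_weak_grad_diff_test:
  assumes "has_weak_grad \<Omega> u g" "integrable M u" "integrable M g" "\<phi> \<in> test_functions \<Omega>"
  shows "has_weak_grad \<Omega> (\<lambda>x. u x - \<phi> x) (\<lambda>x. g x - grad \<phi> x)"
  using has_weak_grad_lincomb[OF assms(1) test_function_has_weak_grad[OF assms(4)] assms(2,3)
      test_function_integrable[OF assms(4)], of 1 "-1"] by simp

lemma W0_imp_W1p_0: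
  assumes p: "p \<ge> 1" and W: "W0 p u g"
  shows "u \<in> W1p_0 \<Omega> p" "AE x in M. weak_grad \<Omega> u x = g x"
proof -
  have p0: "p \<ge> 0" using p by simp
  obtain \<phi> where \<phi>: "\<And>k::nat. \<phi> k \<in> test_functions \<Omega>"
    "(\<lambda>k. LINT x|M. norm (u x - \<phi> k x) powr p) \<longlonglongrightarrow> 0"
    "(\<lambda>k. LINT x|M. norm (g x - grad (\<phi> k) x) powr p) \<longlonglongrightarrow> 0"
    using W0_approx[OF W] by blast
  note L = W0_Lp[OF W]
  have i: "integrable M u" "integrable M g" using L by (auto intro: Lp_fun_integrable[OF p])
  have wg: "has_weak_grad \<Omega> u g" by (rule W0_has_weak_grad[OF p W])
  show "AE x in M. weak_grad \<Omega> u x = g x" by (rule weak_grad_props(2)[OF wg])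
  have W1: "u \<in> W1p \<Omega> p" using L wg by (auto simp: W1p_def Lp_space_iff)
  have nrm: "W1p_norm \<Omega> p (\<lambda>x. u x - \<phi> k x)
      = ((LINT x|M. norm (u x - \<phi> k x) powr p) + (LINT x|M. norm (g x - grad (\<phi> k) x) powr p)) powr (1 / p)" for k
    using W1p_norm_eq[OF has_weak_grad_diff_test[OF wg i \<phi>(1)]
        Lp_funD(1)[OF Lp_fun_diff[OF p0 L(2) test_function_Lp(2)[OF \<phi>(1) p0]]]] by simp
  have "(\<lambda>k. (LINT x|M. norm (u x - \<phi> k x) powr p) + (LINT x|M. norm (g x - grad (\<phi> k) x) powr p)) \<longlonglongrightarrow> 0 + 0"
    by (rule tendsto_add[OF \<phi>(2,3)])
  then have "(\<lambda>k. W1p_norm \<Omega> p (\<lambda>x. u x - \<phi> k x)) \<longlonglongrightarrow> (0 + 0) powr (1 / p)"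
    unfolding nrm using p by (intro tendsto_powr' tendsto_const) (auto intro!: always_eventually add_nonneg_nonneg)
  then have lim: "(\<lambda>k. W1p_norm \<Omega> p (\<lambda>x. u x - \<phi> k x)) \<longlonglongrightarrow> 0" by simp
  have "\<exists>\<phi>\<in>test_functions \<Omega>. W1p_norm \<Omega> p (\<lambda>x. u x - \<phi> x) < e" if "e > 0" for e
  proof -
    from order_tendstoD(2)[OF lim that] obtain N where "\<And>k. k \<ge> N \<Longrightarrow> W1p_norm \<Omega> p (\<lambda>x. u x - \<phi> k x) < e"
      unfolding eventually_sequentially by blast
    then show ?thesis using \<phi>(1)[of N] by blast
  qed
  with W1 show "u \<in> W1p_0 \<Omega> p" by (simp add: W1p_0_def)
qed

lemma W1p_0_imp_W0:
  assumes p: "p \<ge> 1" and u: "u \<in> W1p_0 \<Omega> p"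
  shows "W0 p u (weak_grad \<Omega> u)"
proof -
  have p0: "p \<ge> 0" using p by simp
  define g where "g = weak_grad \<Omega> u"
  obtain g0 where g0: "has_weak_grad \<Omega> u g0" "Lp_fun M p g0" and Lu: "Lp_fun M p u"
    using u by (auto simp: W1p_0_def W1p_def Lp_space_iff)
  note w = weak_grad_props[OF g0(1), folded g_def]
  have Lg: "Lp_fun M p g"
  proof (rule Lp_fun_bound[OF Lp_funD(2)[OF g0(2)] w(3)])
    show "AE x in M. norm (g x) powr p \<le> norm (g0 x) powr p"
      using w(2) by (rule AE_mp) (auto intro!: AE_I2)
  qed
  have i: "integrable M u" "integrable M g" using Lu Lg by (auto intro: Lp_fun_integrable[OF p])
  have "\<forall>k. \<exists>\<phi>. \<phi> \<in> test_functions \<Omega> \<and> W1p_norm \<Omega> p (\<lambda>x. u x - \<phi> x) < inverse (real (Suc k))"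
  proof
    fix k
    have "0 < inverse (real (Suc k))" by simp
    then show "\<exists>\<phi>. \<phi> \<in> test_functions \<Omega> \<and> W1p_norm \<Omega> p (\<lambda>x. u x - \<phi> x) < inverse (real (Suc k))"
      using u unfolding W1p_0_def by blast
  qed
  from choice[OF this] obtain \<phi> where \<phi>: "\<And>k. \<phi> k \<in> test_functions \<Omega>"
      "\<And>k. W1p_norm \<Omega> p (\<lambda>x. u x - \<phi> k x) < inverse (real (Suc k))" by blast
  define A where "A = (\<lambda>k. LINT x|M. norm (u x - \<phi> k x) powr p)"
  define B where "B = (\<lambda>k. LINT x|M. norm (g x - grad (\<phi> k) x) powr p)"
  have AB: "A k \<ge> 0" "B k \<ge> 0" for k by (simp_all add: A_def B_def)
  have small: "A k + B k \<le> inverse (real (Suc k))" for k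
  proof (rule ccontr)
    define e where "e = inverse (real (Suc k))"
    have e: "0 < e" "e \<le> 1" by (simp_all add: e_def inverse_le_1_iff)
    assume "\<not> A k + B k \<le> inverse (real (Suc k))"
    then have big: "e < A k + B k" by (simp add: e_def)
    have "W1p_norm \<Omega> p (\<lambda>x. u x - \<phi> k x) = (A k + B k) powr (1 / p)"
      using W1p_norm_eq[OF has_weak_grad_diff_test[OF w(1) i \<phi>(1)]
        Lp_funD(1)[OF Lp_fun_diff[OF p0 Lg test_function_Lp(2)[OF \<phi>(1) p0]]]] by (simp add: A_def B_def)
    then have "(A k + B k) powr (1 / p) < e" using \<phi>(2)[of k] by (simp add: e_def)
    \<comment> \<open>As \<open>e \<le> 1 \<le> p\<close>, a norm below \<open>e\<close> forces the sum of the two integrals below \<open>e\<close>.\<close>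
    moreover have "e powr 1 \<le> e powr (1 / p)"
      using e p by (intro powr_mono') auto
    moreover have "e powr (1 / p) \<le> (A k + B k) powr (1 / p)"
      using big e p by (intro powr_mono2) auto
    ultimately show False using e by simp
  qed
  have "A \<longlonglongrightarrow> 0" "B \<longlonglongrightarrow> 0"
  proof -
    have "norm (A k) \<le> inverse (real (Suc k))" "norm (B k) \<le> inverse (real (Suc k))" for k
      using small[of k] AB[of k] by auto
    then show "A \<longlonglongrightarrow> 0" "B \<longlonglongrightarrow> 0"
      by (auto intro!: Lim_null_comparison[OF _ LIMSEQ_inverse_real_of_nat] always_eventually)
  qed
  then show ?thesis
    unfolding W0_def g_def[symmetric] using Lu Lg \<phi>(1) unfolding A_def B_def by blast
qed

end

section \<open>Measurability of superpositions\<close>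

text \<open>
  For simple \<open>h\<close> only finitely many \<open>\<xi>\<close> occur; the general case follows by continuity in \<open>\<xi>\<close>.
\<close>

lemma caratheodory_superposition_measurable:
  fixes b :: "'s \<Rightarrow> 'b::{second_countable_topology, metric_space} \<Rightarrow> 'c::metric_space"
  assumes meas: "\<And>\<xi>. (\<lambda>x. b x \<xi>) \<in> borel_measurable N"
    and cont: "\<And>x. x \<in> space N \<Longrightarrow> continuous_on UNIV (b x)"
    and h: "h \<in> borel_measurable N"
  shows "(\<lambda>x. b x (h x)) \<in> borel_measurable N"
proof -
  obtain s where s: "\<And>i. simple_function N (s i)" "\<And>x. x \<in> space N \<Longrightarrow> (\<lambda>i. s i x) \<longlonglongrightarrow> h x"
    using borel_measurable_implies_sequence_metric[OF h] by blast
  have m: "(\<lambda>x. b x (s i x)) \<in> borel_measurable N" for i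
  proof (rule measurable_compose_countable'[where f = "\<lambda>\<xi> x. b x \<xi>" and g = "s i" and I = "s i ` space N"])
    show "s i \<in> measurable N (count_space (s i ` space N))"
      using s(1)[of i] by (auto simp: simple_function_def measurable_count_space_eq2)
    show "countable (s i ` space N)" using simple_functionD(1)[OF s(1)] by (rule countable_finite)
  qed (rule meas)
  show ?thesis
  proof (rule borel_measurable_LIMSEQ_metric[OF m])
    fix x assume x: "x \<in> space N"
    show "(\<lambda>i. b x (s i x)) \<longlonglongrightarrow> b x (h x)"
      by (rule continuous_on_tendsto_compose[OF cont[OF x] s(2)[OF x]]) auto
  qed
qed

section \<open>The energy functional\<close>

locale p_growth_energy = bounded_open_set +
  fixes p \<alpha> \<beta> :: real and a :: "'a \<Rightarrow> 'a \<Rightarrow> 'a" and \<Phi> :: "'a \<Rightarrow> 'a \<Rightarrow> real"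
  assumes p1: "1 < p"
    and car: "caratheodory_function \<Omega> a"
    and \<alpha>0: "0 < \<alpha>" and \<alpha>\<beta>: "\<alpha> \<le> \<beta>"
    and pot: "AE x in lebesgue_on \<Omega>. (\<forall>\<xi>. GDERIV (\<Phi> x) \<xi> :> a x \<xi>) \<and> \<Phi> x 0 = 0"
    and growth: "AE x in lebesgue_on \<Omega>. \<forall>\<xi>.
           \<alpha> / p * norm \<xi> powr p \<le> \<Phi> x \<xi> \<and> \<Phi> x \<xi> \<le> \<beta> / p * norm \<xi> powr p"
    and sconv: "AE x in lebesgue_on \<Omega>. strictly_convex_on UNIV (\<Phi> x)"
begin

lemma p_pos: "p \<ge> 1" "p \<ge> 0" "p > 0" using p1 by auto

lemma \<beta>_pos: "\<beta> > 0" using \<alpha>0 \<alpha>\<beta> by simp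

definition regular_at :: "'a \<Rightarrow> bool" where
  "regular_at x \<longleftrightarrow> (\<forall>\<xi>. GDERIV (\<Phi> x) \<xi> :> a x \<xi>) \<and> \<Phi> x 0 = 0 \<and>
     (\<forall>\<xi>. \<alpha> / p * norm \<xi> powr p \<le> \<Phi> x \<xi>) \<and> (\<forall>\<xi>. \<Phi> x \<xi> \<le> \<beta> / p * norm \<xi> powr p) \<and>
     strictly_convex_on UNIV (\<Phi> x) \<and> continuous_on UNIV (a x)"

lemma AE_regular: "AE x in M. regular_at x"
proof -
  have "AE x in M. continuous_on UNIV (a x)" using car by (simp add: caratheodory_function_def)
  with pot growth sconv show ?thesis unfolding regular_at_def by eventually_elim blast
qed

context
  fixes x assumes reg: "regular_at x"
begin

lemma \<Phi>_deriv: "GDERIV (\<Phi> x) \<xi> :> a x \<xi>" using reg by (simp add: regular_at_def)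
lemma \<Phi>_0: "\<Phi> x 0 = 0" using reg by (simp add: regular_at_def)
lemma \<Phi>_lower: "\<alpha> / p * norm \<xi> powr p \<le> \<Phi> x \<xi>" using reg by (simp add: regular_at_def)
lemma \<Phi>_upper: "\<Phi> x \<xi> \<le> \<beta> / p * norm \<xi> powr p" using reg by (simp add: regular_at_def)

lemma \<Phi>_nonneg: "0 \<le> \<Phi> x \<xi>"
  using \<Phi>_lower[of \<xi>] \<alpha>0 p_pos by (rule_tac order_trans) auto

lemma \<Phi>_convex:
  assumes "0 \<le> t" "t \<le> 1"
  shows "\<Phi> x ((1 - t) *\<^sub>R \<xi> + t *\<^sub>R \<eta>) \<le> (1 - t) * \<Phi> x \<xi> + t * \<Phi> x \<eta>"
proof (cases "t = 0 \<or> t = 1 \<or> \<xi> = \<eta>")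
  case True
  moreover have "(1 - t) *\<^sub>R \<xi> + t *\<^sub>R \<xi> = \<xi>" by (simp flip: scaleR_add_left)
  moreover have "(1 - t) * \<Phi> x \<xi> + t * \<Phi> x \<xi> = \<Phi> x \<xi>" by (simp add: algebra_simps)
  ultimately show ?thesis by auto
next
  case False
  then have "0 < t" "t < 1" "\<xi> \<noteq> \<eta>" using assms by auto
  then have "\<Phi> x ((1 - t) *\<^sub>R \<xi> + t *\<^sub>R \<eta>) < (1 - t) * \<Phi> x \<xi> + t * \<Phi> x \<eta>"
    using reg unfolding regular_at_def strictly_convex_on_def by blast
  then show ?thesis by simp
qed

lemma \<Phi>_shrink:
  assumes "0 \<le> t" "t \<le> 1"
  shows "\<Phi> x (t *\<^sub>R \<xi>) \<le> \<Phi> x \<xi>"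
proof -
  have "\<Phi> x (t *\<^sub>R \<xi>) \<le> t * \<Phi> x \<xi>"
    using \<Phi>_convex[OF assms, of 0 \<xi>] \<Phi>_0 by simp
  also have "\<dots> \<le> 1 * \<Phi> x \<xi>" by (rule mult_right_mono[OF assms(2) \<Phi>_nonneg])
  finally show ?thesis by simp
qed

lemma \<Phi>_ray_deriv: "((\<lambda>s. \<Phi> x (\<xi> + s *\<^sub>R \<eta>)) has_real_derivative (\<eta> \<bullet> a x (\<xi> + s *\<^sub>R \<eta>))) (at s)"
proof -
  have "((\<lambda>s. \<Phi> x (\<xi> + s *\<^sub>R \<eta>)) has_derivative (\<lambda>t. (t *\<^sub>R \<eta>) \<bullet> a x (\<xi> + s *\<^sub>R \<eta>))) (at s)"
  proof (rule has_derivative_compose[where g = "\<Phi> x" and f = "\<lambda>s. \<xi> + s *\<^sub>R \<eta>" and f' = "\<lambda>t. t *\<^sub>R \<eta>"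
        and g' = "\<lambda>h. h \<bullet> a x (\<xi> + s *\<^sub>R \<eta>)"])
    show "((\<lambda>s. \<xi> + s *\<^sub>R \<eta>) has_derivative (\<lambda>t. t *\<^sub>R \<eta>)) (at s)"
      by (auto intro!: derivative_eq_intros)
    show "(\<Phi> x has_derivative (\<lambda>h. h \<bullet> a x (\<xi> + s *\<^sub>R \<eta>))) (at (\<xi> + s *\<^sub>R \<eta>))"
      using \<Phi>_deriv by (simp only: gderiv_def)
  qed
  then show ?thesis by (simp add: has_field_derivative_def mult_commute_abs)
qed

lemma a_continuous: "continuous_on UNIV (a x)" using reg by (simp add: regular_at_def)

text \<open>
  Measurability is assumed for \<open>a\<close> only; this formula carries it over to \<open>\<Phi>\<close>.
\<close>

lemma \<Phi>_as_integral: "(LINT s|lborel. indicator {0..1} s * (\<xi> \<bullet> a x (s *\<^sub>R \<xi>))) = \<Phi> x \<xi>"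
proof -
  have d: "((\<lambda>s. \<Phi> x (s *\<^sub>R \<xi>)) has_real_derivative \<xi> \<bullet> a x (s *\<^sub>R \<xi>)) (at s)" for s
    using \<Phi>_ray_deriv[of 0 \<xi> s] by simp
  have "(LINT s|lborel. indicator {0..1} s *\<^sub>R (\<xi> \<bullet> a x (s *\<^sub>R \<xi>))) = \<Phi> x (1 *\<^sub>R \<xi>) - \<Phi> x (0 *\<^sub>R \<xi>)"
  proof (rule integral_FTC_Icc)
    show "((\<lambda>s. \<Phi> x (s *\<^sub>R \<xi>)) has_vector_derivative \<xi> \<bullet> a x (s *\<^sub>R \<xi>)) (at s within {0..1})" for s
      using d[of s] has_vector_derivative_at_within
      unfolding has_real_derivative_iff_has_vector_derivative by blast
    show "continuous_on {0..1} (\<lambda>s. \<xi> \<bullet> a x (s *\<^sub>R \<xi>))"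
      by (intro continuous_on_inner continuous_on_const continuous_on_compose2[OF a_continuous]
          continuous_on_scaleR continuous_on_id) simp
  qed simp
  then show ?thesis using \<Phi>_0 by simp
qed

end

text \<open>
  Setting \<open>a\<close> to zero on a null set makes the Caratheodory conditions hold everywhere, so that the
  superposition is also jointly measurable in \<open>x\<close> and the integration variable of \<open>\<Phi>_as_integral\<close>.
\<close>

lemma superposition_measurable:
  assumes h: "h \<in> borel_measurable M"
  shows "(\<lambda>x. a x (h x)) \<in> borel_measurable M" "(\<lambda>x. \<Phi> x (h x)) \<in> borel_measurable M"
proof -
  obtain N where N: "{x \<in> space M. \<not> regular_at x} \<subseteq> N" "N \<in> null_sets M"
    using AE_regular unfolding eventually_ae_filter by blast
  have sN: "N \<in> sets M" using N(2) by (rule null_setsD2)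
  define b where "b = (\<lambda>x \<xi>. if x \<in> N then 0 else a x \<xi>)"
  have bm: "(\<lambda>x. b x \<xi>) \<in> borel_measurable M" for \<xi>
    unfolding b_def
    by (rule measurable_If_set) (use sN car in \<open>auto simp: caratheodory_function_def\<close>)
  have bc: "continuous_on UNIV (b x)" if "x \<in> space M" for x
    using N(1) that a_continuous[of x] by (cases "x \<in> N") (auto simp: b_def continuous_on_const)
  have AEN: "AE x in M. x \<notin> N" by (rule AE_not_in[OF N(2)])
  have "(\<lambda>x. b x (h x)) \<in> borel_measurable M"
    by (rule caratheodory_superposition_measurable[OF bm bc h])
  moreover have "AE x in M. b x (h x) = a x (h x)"
    using AEN by (rule AE_mp) (simp add: b_def)
  ultimately show "(\<lambda>x. a x (h x)) \<in> borel_measurable M"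
    by (rule measurable_lebesgue_on_AE[OF sets_\<Omega>(1)])
  have "(\<lambda>q. b (fst q) (snd q *\<^sub>R h (fst q))) \<in> borel_measurable (M \<Otimes>\<^sub>M lborel)"
  proof (rule caratheodory_superposition_measurable[where b = "\<lambda>q. b (fst q)" and h = "\<lambda>q. snd q *\<^sub>R h (fst q)"])
    show "(\<lambda>q. b (fst q) \<xi>) \<in> borel_measurable (M \<Otimes>\<^sub>M lborel)" for \<xi>
      by (rule measurable_compose[OF measurable_fst bm])
    show "continuous_on UNIV (b (fst q))" if "q \<in> space (M \<Otimes>\<^sub>M lborel)" for q
      using that by (intro bc) (auto simp: space_pair_measure)
    show "(\<lambda>q. snd q *\<^sub>R h (fst q)) \<in> borel_measurable (M \<Otimes>\<^sub>M lborel)"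
      using h by measurable
  qed
  then have "(\<lambda>q. indicator {0..1} (snd q) * (h (fst q) \<bullet> b (fst q) (snd q *\<^sub>R h (fst q)))) \<in> borel_measurable (M \<Otimes>\<^sub>M lborel)"
    using h by measurable
  then have "(\<lambda>x. LINT s|lborel. indicator {0..1::real} s * (h x \<bullet> b x (s *\<^sub>R h x))) \<in> borel_measurable M"
    by (intro lborel.borel_measurable_lebesgue_integral) (simp add: split_beta')
  moreover have "AE x in M. (LINT s|lborel. indicator {0..1::real} s * (h x \<bullet> b x (s *\<^sub>R h x))) = \<Phi> x (h x)"
    using AEN AE_regular
  proof eventually_elim
    case (elim x)
    then show ?case using \<Phi>_as_integral[of x "h x"] by (simp add: b_def)
  qed
  ultimately show "(\<lambda>x. \<Phi> x (h x)) \<in> borel_measurable M"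
    by (rule measurable_lebesgue_on_AE[OF sets_\<Omega>(1)])
qed

definition energy :: "('a \<Rightarrow> 'a) \<Rightarrow> real" where
  "energy g = (LINT x|M. \<Phi> x (g x))"

lemma energy_integrable:
  assumes "Lp_fun M p g"
  shows "integrable M (\<lambda>x. \<Phi> x (g x))"
proof (rule Bochner_Integration.integrable_bound)
  show "integrable M (\<lambda>x. \<beta> / p * norm (g x) powr p)"
    using Lp_funD(2)[OF assms] by (rule integrable_mult_right)
  show "(\<lambda>x. \<Phi> x (g x)) \<in> borel_measurable M"
    by (rule superposition_measurable(2)[OF Lp_funD(1)[OF assms]])
  show "AE x in M. norm (\<Phi> x (g x)) \<le> norm (\<beta> / p * norm (g x) powr p)"
    using AE_regular
  proof eventually_elim
    case (elim x)
    have "norm (\<Phi> x (g x)) = \<Phi> x (g x)" using \<Phi>_nonneg[OF elim] by simp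
    also have "\<dots> \<le> \<beta> / p * norm (g x) powr p" by (rule \<Phi>_upper[OF elim])
    also have "\<dots> \<le> norm (\<beta> / p * norm (g x) powr p)"
      unfolding real_norm_def by (rule abs_ge_self)
    finally show ?case .
  qed
qed

lemma energy_mono:
  assumes "Lp_fun M p g" "Lp_fun M p h" "\<And>x. regular_at x \<Longrightarrow> \<Phi> x (g x) \<le> \<Phi> x (h x)"
  shows "energy g \<le> energy h"
  unfolding energy_def
  by (rule integral_mono_AE[OF energy_integrable[OF assms(1)] energy_integrable[OF assms(2)]])
    (rule AE_mp[OF AE_regular], use assms(3) in \<open>auto intro!: AE_I2\<close>)

lemma energy_bounds:
  assumes g: "Lp_fun M p g"
  shows "0 \<le> energy g" "\<alpha> / p * (LINT x|M. norm (g x) powr p) \<le> energy g"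
    "energy g \<le> \<beta> / p * (LINT x|M. norm (g x) powr p)"
proof -
  note i = Lp_funD(2)[OF g]
  show "0 \<le> energy g" unfolding energy_def
    by (rule integral_nonneg_AE, rule AE_mp[OF AE_regular]) (auto intro!: AE_I2 \<Phi>_nonneg)
  have "(LINT x|M. \<alpha> / p * norm (g x) powr p) \<le> energy g" unfolding energy_def
    by (rule integral_mono_AE[OF integrable_mult_right[OF i] energy_integrable[OF g]], rule AE_mp[OF AE_regular])
      (auto intro!: AE_I2 \<Phi>_lower simp del: times_divide_eq_left)
  then show "\<alpha> / p * (LINT x|M. norm (g x) powr p) \<le> energy g" by simp
  have "energy g \<le> (LINT x|M. \<beta> / p * norm (g x) powr p)" unfolding energy_def
    by (rule integral_mono_AE[OF energy_integrable[OF g] integrable_mult_right[OF i]], rule AE_mp[OF AE_regular])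
      (auto intro!: AE_I2 \<Phi>_upper simp del: times_divide_eq_left)
  then show "energy g \<le> \<beta> / p * (LINT x|M. norm (g x) powr p)" by simp
qed

lemma energy_convex:
  assumes g: "Lp_fun M p g" and h: "Lp_fun M p h" and t: "0 \<le> t" "t \<le> 1"
  shows "energy (\<lambda>x. (1 - t) *\<^sub>R g x + t *\<^sub>R h x) \<le> (1 - t) * energy g + t * energy h"
proof -
  have L: "Lp_fun M p (\<lambda>x. (1 - t) *\<^sub>R g x + t *\<^sub>R h x)"
    by (intro Lp_fun_add[OF p_pos(2)] Lp_fun_scale g h)
  have "energy (\<lambda>x. (1 - t) *\<^sub>R g x + t *\<^sub>R h x) \<le> (LINT x|M. (1 - t) * \<Phi> x (g x) + t * \<Phi> x (h x))"
    unfolding energy_def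
    by (rule integral_mono_AE[OF energy_integrable[OF L]], intro Bochner_Integration.integrable_add
        integrable_mult_right energy_integrable g h, rule AE_mp[OF AE_regular])
      (auto intro!: AE_I2 \<Phi>_convex t)
  also have "\<dots> = (1 - t) * energy g + t * energy h"
    using energy_integrable[OF g] energy_integrable[OF h] by (simp add: energy_def)
  finally show ?thesis .
qed

text \<open>
  The field \<open>(1 - t) f\<close> is a convex combination of \<open>h\<close>, with weight \<open>1 - t\<close>, and a multiple of \<open>f - h\<close>, with
  weight \<open>t\<close>. For \<open>f\<close> fixed and \<open>h \<rightarrow> f\<close> this gives lower semicontinuity of the energy, and for \<open>h\<close> fixed
  and \<open>f \<rightarrow> h\<close> upper semicontinuity, in both cases after letting \<open>t\<close> tend to zero.
\<close>

lemma energy_perturb: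
  assumes f: "Lp_fun M p f" and h: "Lp_fun M p h" and t: "0 < t" "t < 1"
  shows "energy (\<lambda>x. (1 - t) *\<^sub>R f x) \<le> energy h + t * (\<beta> / p * ((1 - t) / t) powr p) * (LINT x|M. norm (f x - h x) powr p)"
proof -
  define c where "c = (1 - t) / t"
  have c: "c \<ge> 0" "t * c = 1 - t" using t by (simp_all add: c_def)
  have Ld: "Lp_fun M p (\<lambda>x. f x - h x)" by (rule Lp_fun_diff[OF p_pos(2) f h])
  have eq: "(1 - t) *\<^sub>R f x = (1 - t) *\<^sub>R h x + t *\<^sub>R (c *\<^sub>R (f x - h x))" for x
    by (simp add: c(2) scaleR_diff_right)
  have "energy (\<lambda>x. (1 - t) *\<^sub>R f x) \<le> (1 - t) * energy h + t * energy (\<lambda>x. c *\<^sub>R (f x - h x))"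
    unfolding eq by (rule energy_convex[OF h Lp_fun_scale[OF Ld]]) (use t in auto)
  also have "(1 - t) * energy h \<le> 1 * energy h"
    using energy_bounds(1)[OF h] t by (intro mult_right_mono) auto
  also have "energy (\<lambda>x. c *\<^sub>R (f x - h x)) \<le> \<beta> / p * (LINT x|M. norm (c *\<^sub>R (f x - h x)) powr p)"
    by (rule energy_bounds(3)[OF Lp_fun_scale[OF Ld]])
  also have "(LINT x|M. norm (c *\<^sub>R (f x - h x)) powr p) = c powr p * (LINT x|M. norm (f x - h x) powr p)"
    using c(1) by (simp add: powr_mult)
  finally show ?thesis using t by (simp add: c_def mult.assoc mult_left_mono)
qed

lemma energy_shrink_tendsto:
  assumes g: "Lp_fun M p g"
  shows "(\<lambda>n. energy (\<lambda>x. (1 - inverse (real (Suc (Suc n)))) *\<^sub>R g x)) \<longlonglongrightarrow> energy g"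
  unfolding energy_def
proof (rule integral_dominated_convergence[where w = "\<lambda>x. \<Phi> x (g x)"])
  let ?t = "\<lambda>n. 1 - inverse (real (Suc (Suc n)))"
  have t: "0 \<le> ?t n" "?t n \<le> 1" for n by (simp_all add: inverse_le_1_iff)
  have lim: "?t \<longlonglongrightarrow> 1"
    using tendsto_diff[OF tendsto_const[of 1] LIMSEQ_Suc[OF LIMSEQ_inverse_real_of_nat]] by simp
  show "(\<lambda>x. \<Phi> x (g x)) \<in> borel_measurable M" by (rule superposition_measurable(2)[OF Lp_funD(1)[OF g]])
  show "(\<lambda>x. \<Phi> x (?t n *\<^sub>R g x)) \<in> borel_measurable M" for n
    by (rule superposition_measurable(2)[OF Lp_funD(1)[OF Lp_fun_scale[OF g]]])
  show "integrable M (\<lambda>x. \<Phi> x (g x))" by (rule energy_integrable[OF g])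
  show "AE x in M. (\<lambda>n. \<Phi> x (?t n *\<^sub>R g x)) \<longlonglongrightarrow> \<Phi> x (g x)"
    using AE_regular
  proof eventually_elim
    case (elim x)
    have "isCont (\<Phi> x) (g x)"
      using \<Phi>_deriv[OF elim, of "g x"] unfolding gderiv_def by (rule has_derivative_continuous)
    moreover have "(\<lambda>n. ?t n *\<^sub>R g x) \<longlonglongrightarrow> g x"
      using tendsto_scaleR[OF lim tendsto_const[of "g x"]] by simp
    ultimately show ?case by (rule isCont_tendsto_compose)
  qed
  show "AE x in M. norm (\<Phi> x (?t n *\<^sub>R g x)) \<le> \<Phi> x (g x)" for n
    using AE_regular
  proof eventually_elim
    case (elim x)
    show ?case using \<Phi>_shrink[OF elim t] \<Phi>_nonneg[OF elim] by simp
  qed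
qed

end

section \<open>Minimisation of the truncated functional\<close>

text \<open>
  The intended \<open>G\<close> is the primitive of \<open>s \<mapsto> f (max 0 (min z s))\<close>. The last assumption says that truncation
  to \<open>[0, z]\<close> does not decrease \<open>G\<close>.
\<close>

locale truncated_problem = p_growth_energy +
  fixes G fz :: "real \<Rightarrow> real" and z lam C :: real
  assumes z_pos: "z > 0" and lam_pos: "lam > 0"
    and G_deriv: "(G has_real_derivative fz s) (at s)"
    and fz_bound: "\<bar>fz s\<bar> \<le> C"
    and fz_cont: "continuous_on UNIV fz"
    and G_clamp: "G s \<le> G (max 0 (min z s))"
begin

lemma C_nonneg: "C \<ge> 0" using fz_bound[of 0] abs_ge_zero order_trans by blast

lemma G_lipschitz: "\<bar>G s - G t\<bar> \<le> C * \<bar>s - t\<bar>"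
proof -
  have "norm (G s - G t) \<le> C * norm (s - t)"
    by (rule field_differentiable_bound[of UNIV G fz])
      (use G_deriv fz_bound in \<open>auto intro: has_field_derivative_at_within\<close>)
  then show ?thesis by simp
qed

lemma G_cont: "continuous_on UNIV G"
  by (intro continuous_at_imp_continuous_on ballI DERIV_isCont[OF G_deriv])

lemma G_measurable:
  assumes "u \<in> borel_measurable M"
  shows "(\<lambda>x. G (u x)) \<in> borel_measurable M"
  by (rule measurable_compose[OF assms borel_measurable_continuous_onI[OF G_cont]])

lemma G_integrable:
  assumes "integrable M u"
  shows "integrable M (\<lambda>x. G (u x))"
proof (rule Bochner_Integration.integrable_bound)
  show "integrable M (\<lambda>x. \<bar>G 0\<bar> + C * \<bar>u x\<bar>)"
    using assms by (intro Bochner_Integration.integrable_add integrable_mult_right integrable_abs) simp_all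
  show "(\<lambda>x. G (u x)) \<in> borel_measurable M"
    by (rule G_measurable[OF borel_measurable_integrable[OF assms]])
  show "AE x in M. norm (G (u x)) \<le> norm (\<bar>G 0\<bar> + C * \<bar>u x\<bar>)"
  proof (rule AE_I2)
    fix x
    have "\<bar>G (u x)\<bar> \<le> \<bar>G 0\<bar> + C * \<bar>u x\<bar>" using G_lipschitz[of "u x" 0] by simp
    then show "norm (G (u x)) \<le> norm (\<bar>G 0\<bar> + C * \<bar>u x\<bar>)" by simp
  qed
qed

lemma G_upper:
  obtains K where "K \<ge> 0" "\<And>s. G s \<le> K"
proof -
  have "{0..z} \<noteq> {}" using z_pos by simp
  then obtain s where s: "\<forall>t\<in>{0..z}. G t \<le> G s"
    using continuous_attains_sup[OF compact_Icc _ continuous_on_subset[OF G_cont subset_UNIV], of 0 z] by blast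
  have "G t \<le> max 0 (G s)" for t
  proof -
    have "max 0 (min z t) \<in> {0..z}" using z_pos by simp
    then have "G (max 0 (min z t)) \<le> G s" using s by blast
    then show ?thesis using G_clamp[of t] by simp
  qed
  then show thesis by (intro that[of "max 0 (G s)"]) simp_all
qed

definition reaction :: "('a \<Rightarrow> real) \<Rightarrow> real" where
  "reaction u = (LINT x|M. G (u x))"

lemma reaction_lipschitz:
  assumes "integrable M u" "integrable M v"
  shows "\<bar>reaction u - reaction v\<bar> \<le> C * (LINT x|M. \<bar>u x - v x\<bar>)"
proof -
  have i: "integrable M (\<lambda>x. C * \<bar>u x - v x\<bar>)"
    using assms by (intro integrable_mult_right integrable_abs Bochner_Integration.integrable_diff)
  have "\<bar>reaction u - reaction v\<bar> = \<bar>LINT x|M. G (u x) - G (v x)\<bar>"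
    using assms by (simp add: reaction_def G_integrable)
  also have "\<dots> \<le> (LINT x|M. C * \<bar>u x - v x\<bar>)"
    by (rule integral_abs_bound_integral[OF _ i])
      (use assms in \<open>auto intro!: Bochner_Integration.integrable_diff G_integrable G_lipschitz\<close>)
  finally show ?thesis by simp
qed

definition functional :: "('a \<Rightarrow> real) \<Rightarrow> ('a \<Rightarrow> 'a) \<Rightarrow> real" where
  "functional u g = energy g - lam * reaction u"

abbreviation "\<mu> \<equiv> measure M (space M)"

lemma reaction_le:
  assumes "integrable M u" "\<And>s. G s \<le> K"
  shows "reaction u \<le> K * \<mu>"
proof -
  have "reaction u \<le> (LINT x|M. K)"
    unfolding reaction_def by (rule integral_mono[OF G_integrable[OF assms(1)]]) (use assms(2) in auto)
  then show ?thesis by (simp add: mult.commute)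
qed

definition inf_value :: real where
  "inf_value = Inf ((\<lambda>\<phi>. functional \<phi> (grad \<phi>)) ` test_functions \<Omega>)"

lemma zero_test: "(\<lambda>_. 0) \<in> test_functions \<Omega>"
  by (rule test_functionsI[where K = "{}"]) (auto intro: smooth_const)

lemma inf_value_bdd: "bdd_below ((\<lambda>\<phi>. functional \<phi> (grad \<phi>)) ` test_functions \<Omega>)"
proof -
  obtain K where K: "K \<ge> 0" "\<And>s. G s \<le> K" using G_upper by blast
  show ?thesis
  proof (rule bdd_belowI2)
    fix \<phi> assume \<phi>: "\<phi> \<in> test_functions \<Omega>"
    have "lam * reaction \<phi> \<le> lam * (K * \<mu>)"
      using lam_pos by (intro mult_left_mono reaction_le[OF test_function_integrable(1)[OF \<phi>] K(2)]) simp
    then show "- lam * (K * \<mu>) \<le> functional \<phi> (grad \<phi>)"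
      using energy_bounds(1)[OF test_function_Lp(2)[OF \<phi> p_pos(2)]] by (simp add: functional_def)
  qed
qed

lemma inf_value_le: "\<phi> \<in> test_functions \<Omega> \<Longrightarrow> inf_value \<le> functional \<phi> (grad \<phi>)"
  unfolding inf_value_def by (rule cINF_lower[OF inf_value_bdd])

lemma inf_value_approx:
  assumes "e > 0"
  obtains \<phi> where "\<phi> \<in> test_functions \<Omega>" "functional \<phi> (grad \<phi>) < inf_value + e"
proof -
  have "inf_value < inf_value + e" using assms by simp
  then have "\<exists>y\<in>(\<lambda>\<phi>. functional \<phi> (grad \<phi>)) ` test_functions \<Omega>. y < inf_value + e"
    unfolding inf_value_def by (subst (asm) cInf_less_iff[OF _ inf_value_bdd]) (use zero_test in blast)
  then show thesis using that by blast
qed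

text \<open>
  The infimum over test functions is also a lower bound on the closure. A test function \<open>\<phi> k\<close> close to \<open>w\<close>
  is first multiplied by \<open>1 - t\<close>, so that \<open>energy_perturb\<close> compares its energy with that of \<open>g\<close>; the
  potential term changes, in the limit, by at most a multiple of \<open>t\<close>.
\<close>

lemma inf_value_le_W0:
  assumes W: "W0 p w g"
  shows "inf_value \<le> functional w g"
proof -
  obtain \<phi> where \<phi>: "\<And>k::nat. \<phi> k \<in> test_functions \<Omega>"
    "(\<lambda>k. LINT x|M. norm (w x - \<phi> k x) powr p) \<longlonglongrightarrow> 0"
    "(\<lambda>k. LINT x|M. norm (g x - grad (\<phi> k) x) powr p) \<longlonglongrightarrow> 0"
    using W0_approx[OF W] by blast
  note L = W0_Lp[OF W]
  have iw: "integrable M w" by (rule Lp_fun_integrable[OF p_pos(1) L(1)])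
  define A where "A = (\<lambda>k. LINT x|M. norm (g x - grad (\<phi> k) x) powr p)"
  define D where "D = (\<lambda>k. LINT x|M. norm (w x - \<phi> k x))"
  define N where "N = (LINT x|M. \<bar>w x\<bar>)"
  have A: "A \<longlonglongrightarrow> 0" unfolding A_def by (rule \<phi>(3))
  have D: "D \<longlonglongrightarrow> 0" unfolding D_def
    by (rule Lp_tendsto_imp_L1_tendsto[OF p_pos(1) Lp_fun_diff[OF p_pos(2) L(1) test_function_Lp(1)[OF \<phi>(1) p_pos(2)]] \<phi>(2)])
  have step: "inf_value \<le> functional w g + lam * C * t * N" if t: "0 < t" "t < 1" for t
  proof -
    define c where "c = t * (\<beta> / p * ((1 - t) / t) powr p)"
    have "inf_value \<le> functional w g + c * A k + lam * C * (D k + t * N)" for k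
    proof -
      note T = test_functions_scale[OF \<phi>(1)[of k], where c = "1 - t"]
      have i\<phi>: "integrable M (\<lambda>x. (1 - t) * \<phi> k x)" by (rule test_function_integrable(1)[OF T(1)])
      have "inf_value \<le> functional (\<lambda>x. (1 - t) * \<phi> k x) (grad (\<lambda>x. (1 - t) * \<phi> k x))" by (rule inf_value_le[OF T(1)])
      also have "\<dots> = energy (\<lambda>x. (1 - t) *\<^sub>R grad (\<phi> k) x) - lam * reaction (\<lambda>x. (1 - t) * \<phi> k x)"
        by (simp add: functional_def T(2)[abs_def])
      finally have 1: "inf_value \<le> energy (\<lambda>x. (1 - t) *\<^sub>R grad (\<phi> k) x) - lam * reaction (\<lambda>x. (1 - t) * \<phi> k x)" .
      have 2: "energy (\<lambda>x. (1 - t) *\<^sub>R grad (\<phi> k) x) \<le> energy g + c * A k"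
        using energy_perturb[OF test_function_Lp(2)[OF \<phi>(1) p_pos(2)] L(2) t, of k]
        by (simp add: c_def A_def norm_minus_commute)
      have ik: "integrable M (\<lambda>x. w x - \<phi> k x)" by (intro Bochner_Integration.integrable_diff iw test_function_integrable \<phi>)
      have "\<bar>reaction w - reaction (\<lambda>x. (1 - t) * \<phi> k x)\<bar> \<le> C * (LINT x|M. \<bar>w x - (1 - t) * \<phi> k x\<bar>)"
        by (rule reaction_lipschitz[OF iw i\<phi>])
      also have "\<dots> \<le> C * (LINT x|M. norm (w x - \<phi> k x) + t * \<bar>w x\<bar>)"
      proof (intro mult_left_mono integral_mono C_nonneg)
        show "integrable M (\<lambda>x. \<bar>w x - (1 - t) * \<phi> k x\<bar>)"
          by (intro integrable_abs Bochner_Integration.integrable_diff iw i\<phi>)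
        show "integrable M (\<lambda>x. norm (w x - \<phi> k x) + t * \<bar>w x\<bar>)"
          by (intro Bochner_Integration.integrable_add integrable_norm ik integrable_mult_right integrable_abs iw)
        show "\<bar>w x - (1 - t) * \<phi> k x\<bar> \<le> norm (w x - \<phi> k x) + t * \<bar>w x\<bar>" for x
        proof -
          have "w x - (1 - t) * \<phi> k x = (1 - t) * (w x - \<phi> k x) + t * w x" by (simp add: algebra_simps)
          then have "\<bar>w x - (1 - t) * \<phi> k x\<bar> \<le> \<bar>1 - t\<bar> * \<bar>w x - \<phi> k x\<bar> + \<bar>t\<bar> * \<bar>w x\<bar>"
            by (simp only: abs_mult[symmetric] abs_triangle_ineq)
          moreover have "\<bar>1 - t\<bar> * \<bar>w x - \<phi> k x\<bar> \<le> 1 * \<bar>w x - \<phi> k x\<bar>"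
            using t by (intro mult_right_mono) auto
          ultimately show ?thesis using t by simp
        qed
      qed
      also have "(LINT x|M. norm (w x - \<phi> k x) + t * \<bar>w x\<bar>) = D k + t * N"
        by (subst Bochner_Integration.integral_add)
          (simp_all only: D_def N_def integral_mult_right_zero integrable_norm[OF ik] integrable_mult_right[OF integrable_abs[OF iw]])
      finally have "reaction w - reaction (\<lambda>x. (1 - t) * \<phi> k x) \<le> C * (D k + t * N)" by simp
      then have "lam * (reaction w - reaction (\<lambda>x. (1 - t) * \<phi> k x)) \<le> lam * (C * (D k + t * N))"
        using lam_pos by (intro mult_left_mono) auto
      then show ?thesis using 1 2 by (simp add: functional_def algebra_simps)
    qed
    moreover have "(\<lambda>k. functional w g + c * A k + lam * C * (D k + t * N)) \<longlonglongrightarrow> functional w g + c * 0 + lam * C * (0 + t * N)"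
      by (intro tendsto_add tendsto_mult tendsto_const A D)
    ultimately have "inf_value \<le> functional w g + c * 0 + lam * C * (0 + t * N)"
      by (intro LIMSEQ_le_const) auto
    then show ?thesis by simp
  qed
  \<comment> \<open>The values \<open>t = 1 / (n + 2)\<close> lie strictly between 0 and 1.\<close>
  have "(\<lambda>n. functional w g + lam * C * inverse (real (Suc (Suc n))) * N) \<longlonglongrightarrow> functional w g + lam * C * 0 * N"
    by (intro tendsto_add tendsto_mult tendsto_const LIMSEQ_Suc[OF LIMSEQ_inverse_real_of_nat])
  moreover have "inf_value \<le> functional w g + lam * C * inverse (real (Suc (Suc n))) * N" for n
  proof (rule step)
    show "inverse (real (Suc (Suc n))) < 1" by (simp add: inverse_less_1_iff)
  qed simp
  ultimately have "inf_value \<le> functional w g + lam * C * 0 * N" by (intro LIMSEQ_le_const) auto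
  then show ?thesis by simp
qed

text \<open>
  The smooth clamp shortens gradients, which does not increase the energy, and it differs from the
  true truncation, which does not decrease \<open>G\<close>, by at most \<open>\<delta>\<close>.
\<close>

lemma clamp_test_function:
  assumes \<phi>: "\<phi> \<in> test_functions \<Omega>" and e: "e > 0"
  obtains \<psi> where "\<psi> \<in> test_functions \<Omega>" "\<And>x. 0 \<le> \<psi> x" "\<And>x. \<psi> x \<le> z"
    "functional \<psi> (grad \<psi>) \<le> functional \<phi> (grad \<phi>) + e"
proof -
  define q where "q = lam * C * \<mu> + 1"
  have q: "q > 0" using lam_pos C_nonneg by (simp add: q_def add_nonneg_pos)
  define \<delta> where "\<delta> = e / q"
  have \<delta>: "\<delta> > 0" using e q by (simp add: \<delta>_def)
  obtain s :: "real \<Rightarrow> real" where s: "smooth s" "s 0 = 0" "\<And>t. 0 \<le> s t" "\<And>t. s t \<le> z"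
    "\<And>t. \<bar>s t - max 0 (min z t)\<bar> \<le> \<delta>" "\<And>t. 0 \<le> grad s t" "\<And>t. grad s t \<le> 1"
    using smooth_clamp_exists[OF z_pos \<delta>] by blast
  define \<psi> where "\<psi> = (\<lambda>x. s (\<phi> x))"
  have \<psi>: "\<psi> \<in> test_functions \<Omega>" "grad \<psi> x = grad s (\<phi> x) *\<^sub>R grad \<phi> x" for x
    unfolding \<psi>_def by (rule test_functions_compose[OF \<phi> s(1,2)])+
  have Ele: "energy (grad \<psi>) \<le> energy (grad \<phi>)"
    by (rule energy_mono[OF test_function_Lp(2)[OF \<psi>(1) p_pos(2)] test_function_Lp(2)[OF \<phi> p_pos(2)]])
      (simp only: \<psi>(2) \<Phi>_shrink s)
  have "reaction \<phi> \<le> reaction \<psi> + C * \<delta> * \<mu>"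
  proof -
    have i: "integrable M (\<lambda>x. G (\<phi> x))" "integrable M (\<lambda>x. G (\<psi> x))"
      by (intro G_integrable test_function_integrable \<phi> \<psi>(1))+
    have "reaction \<phi> \<le> (LINT x|M. G (\<psi> x) + C * \<delta>)"
      unfolding reaction_def
    proof (rule integral_mono[OF i(1)])
      show "integrable M (\<lambda>x. G (\<psi> x) + C * \<delta>)"
        by (intro Bochner_Integration.integrable_add i(2)) simp
      show "G (\<phi> x) \<le> G (\<psi> x) + C * \<delta>" for x
      proof -
        have "G (\<phi> x) \<le> G (max 0 (min z (\<phi> x)))" by (rule G_clamp)
        also have "\<dots> \<le> G (\<psi> x) + C * \<bar>max 0 (min z (\<phi> x)) - \<psi> x\<bar>"
          using G_lipschitz[of "max 0 (min z (\<phi> x))" "\<psi> x"] by linarith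
        also have "C * \<bar>max 0 (min z (\<phi> x)) - \<psi> x\<bar> \<le> C * \<delta>"
          using s(5)[of "\<phi> x"] by (intro mult_left_mono C_nonneg) (simp add: \<psi>_def abs_minus_commute)
        finally show ?thesis by simp
      qed
    qed
    also have "\<dots> = reaction \<psi> + C * \<delta> * \<mu>"
      by (subst Bochner_Integration.integral_add[OF i(2)]) (simp_all add: reaction_def mult.commute)
    finally show ?thesis .
  qed
  then have "lam * reaction \<phi> \<le> lam * (reaction \<psi> + C * \<delta> * \<mu>)" using lam_pos by (intro mult_left_mono) auto
  also have "\<dots> = lam * reaction \<psi> + \<delta> * (lam * C * \<mu>)" by (simp add: algebra_simps)
  also have "\<delta> * (lam * C * \<mu>) \<le> \<delta> * q" using \<delta> by (intro mult_left_mono) (simp_all add: q_def)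
  also have "\<delta> * q = e" using q by (simp add: \<delta>_def)
  finally have "functional \<psi> (grad \<psi>) \<le> functional \<phi> (grad \<phi>) + e" using Ele by (simp add: functional_def)
  moreover have "0 \<le> \<psi> x" "\<psi> x \<le> z" for x using s(3,4) by (simp_all add: \<psi>_def)
  ultimately show thesis using that[OF \<psi>(1)] by blast
qed

lemma gradient_integral_le_energy:
  assumes "\<psi> \<in> test_functions \<Omega>"
  shows "(LINT x|M. norm (grad \<psi> x) powr p) \<le> p / \<alpha> * energy (grad \<psi>)"
  using energy_bounds(2)[OF test_function_Lp(2)[OF assms p_pos(2)]] \<alpha>0 p_pos(3)
  by (simp add: pos_divide_le_eq pos_le_divide_eq mult.commute)

lemma clamped_minimising_sequence:
  obtains \<phi> where "\<And>k. \<phi> k \<in> test_functions \<Omega>" "\<And>k x. 0 \<le> \<phi> k x \<and> \<phi> k x \<le> z"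
    "\<And>k. functional (\<phi> k) (grad (\<phi> k)) < inf_value + inverse (real (Suc k))"
proof -
  have "\<forall>k. \<exists>\<phi>. \<phi> \<in> test_functions \<Omega> \<and> (\<forall>x. 0 \<le> \<phi> x \<and> \<phi> x \<le> z) \<and> functional \<phi> (grad \<phi>) < inf_value + inverse (real (Suc k))"
  proof
    fix k
    have e: "inverse (real (Suc k)) / 2 > 0" by simp
    obtain \<phi> where \<phi>: "\<phi> \<in> test_functions \<Omega>" "functional \<phi> (grad \<phi>) < inf_value + inverse (real (Suc k)) / 2"
      using inf_value_approx[OF e] by blast
    obtain \<psi> where "\<psi> \<in> test_functions \<Omega>" "\<And>x. 0 \<le> \<psi> x" "\<And>x. \<psi> x \<le> z"
        "functional \<psi> (grad \<psi>) \<le> functional \<phi> (grad \<phi>) + inverse (real (Suc k)) / 2"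
      using clamp_test_function[OF \<phi>(1) e] by blast
    with \<phi>(2) show "\<exists>\<phi>. \<phi> \<in> test_functions \<Omega> \<and> (\<forall>x. 0 \<le> \<phi> x \<and> \<phi> x \<le> z) \<and> functional \<phi> (grad \<phi>) < inf_value + inverse (real (Suc k))"
      by (intro exI[of _ \<psi>]) (auto simp del: of_nat_Suc)
  qed
  from choice[OF this] show thesis using that by blast
qed

text \<open>
  The gradients of a minimising sequence may oscillate. These sets decrease with \<open>n\<close> and are closed under
  midpoints, so a second functional can be minimised over them to select a sequence with convergent
  gradients that keeps the limit \<open>u\<close> and the limit energy \<open>E0\<close>.
\<close>

definition competitors :: "('a \<Rightarrow> real) \<Rightarrow> real \<Rightarrow> nat \<Rightarrow> ('a \<Rightarrow> real) set" where
  "competitors u E0 n = {v \<in> test_functions \<Omega>. (\<forall>x. 0 \<le> v x \<and> v x \<le> z) \<and>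
     (LINT x|M. \<bar>v x - u x\<bar>) \<le> inverse (real (Suc n)) \<and> energy (grad v) \<le> E0 + inverse (real (Suc n))}"

lemma competitors_decreasing:
  assumes "k \<le> m"
  shows "competitors u E0 m \<subseteq> competitors u E0 k"
proof -
  have inv: "inverse (real (Suc m)) \<le> inverse (real (Suc k))" using assms by (intro le_imp_inverse_le) auto
  show ?thesis unfolding competitors_def
    using order_trans[OF _ inv] order_trans[OF _ add_left_mono[OF inv, of E0]] by blast
qed

text \<open>
  The pointwise limit of a clamped minimising sequence. Its potential term is the limit of those of the
  sequence, so \<open>inf_value + lam * reaction u\<close> is the limit of the energies.
\<close>

lemma limit_of_minimising_sequence:
  obtains u where "u \<in> borel_measurable M" "AE x in M. 0 \<le> u x \<and> u x \<le> z"
    "\<And>n. competitors u (inf_value + lam * reaction u) n \<noteq> {}"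
proof -
  obtain \<phi> where \<phi>: "\<And>k. \<phi> k \<in> test_functions \<Omega>" "\<And>k x. 0 \<le> \<phi> k x \<and> \<phi> k x \<le> z"
    "\<And>k. functional (\<phi> k) (grad (\<phi> k)) < inf_value + inverse (real (Suc k))"
    by (rule clamped_minimising_sequence) (rule that)
  obtain K where K: "K \<ge> 0" "\<And>s. G s \<le> K" using G_upper by blast
  define E1 where "E1 = inf_value + 1 + lam * (K * \<mu>)"
  have E1: "energy (grad (\<phi> k)) \<le> E1" for k
  proof -
    have "lam * reaction (\<phi> k) \<le> lam * (K * \<mu>)"
      using lam_pos by (intro mult_left_mono reaction_le[OF test_function_integrable(1)[OF \<phi>(1)] K(2)]) simp
    moreover have "inverse (real (Suc k)) \<le> 1" by (simp add: inverse_le_1_iff)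
    ultimately show ?thesis using \<phi>(3)[of k] by (simp add: E1_def functional_def del: of_nat_Suc)
  qed
  have g1: "(LINT x|lborel. norm (grad (\<phi> k) x)) \<le> \<mu> + p / \<alpha> * E1" for k
  proof -
    have "(LINT x|lborel. norm (grad (\<phi> k) x)) = (LINT x|M. norm (grad (\<phi> k) x))"
      by (rule integral_M_lborel(1)[symmetric])
        (simp_all add: test_functions_zero_outside[OF \<phi>(1)] borel_measurable_continuous_onI
          smooth_grad_continuous test_functions_smooth[OF \<phi>(1)] continuous_on_norm)
    also have "\<dots> \<le> 1 * \<mu> + 1 powr (1 - p) * (LINT x|M. norm (grad (\<phi> k) x) powr p)"
      by (rule L1_le_Lp[OF p_pos(1) test_function_Lp(2)[OF \<phi>(1) p_pos(2)]]) simp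
    also have "\<dots> \<le> \<mu> + p / \<alpha> * energy (grad (\<phi> k))" using gradient_integral_le_energy[OF \<phi>(1)] by simp
    also have "\<dots> \<le> \<mu> + p / \<alpha> * E1"
      using E1[of k] \<alpha>0 p_pos(3) by (intro add_left_mono mult_left_mono) auto
    finally show ?thesis .
  qed
  have ab: "\<bar>\<phi> k x\<bar> \<le> z" for k x using \<phi>(2)[of k x] by simp
  obtain r where r: "strict_mono (r :: nat \<Rightarrow> nat)" "AE x in lborel. convergent (\<lambda>k. \<phi> (r k) x)"
    by (rule bounded_gradient_compactness[OF bounded_\<Omega> \<phi>(1) ab g1]) (rule that)
  define u where "u = (\<lambda>x. lim (\<lambda>k. \<phi> (r k) x))"
  have mu: "u \<in> borel_measurable M"
    unfolding u_def by (rule borel_measurable_lim_metric[OF test_function_measurable(1)[OF \<phi>(1)]])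
  have lim: "AE x in M. (\<lambda>k. \<phi> (r k) x) \<longlonglongrightarrow> u x"
    using AE_M_I[OF r(2)] by eventually_elim (simp add: u_def convergent_LIMSEQ_iff)
  have ur: "AE x in M. 0 \<le> u x \<and> u x \<le> z"
    using lim
  proof eventually_elim
    case (elim x)
    show ?case
      using LIMSEQ_le_const[OF elim, of 0] LIMSEQ_le_const2[OF elim, of z] \<phi>(2) by blast
  qed
  have Lu: "Lp_fun M p u"
    by (rule bounded_Lp_fun[OF mu _ p_pos(2), of z], rule AE_mp[OF ur]) (auto intro!: AE_I2)
  have iu: "integrable M u" by (rule Lp_fun_integrable[OF p_pos(1) Lu])
  have D0: "(\<lambda>k. LINT x|M. \<bar>\<phi> (r k) x - u x\<bar>) \<longlonglongrightarrow> 0"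
  proof -
    have "(\<lambda>k. LINT x|M. \<bar>\<phi> (r k) x - u x\<bar>) \<longlonglongrightarrow> (LINT x|M. 0)"
    proof (rule integral_dominated_convergence[where w = "\<lambda>_. z" and f = "\<lambda>_. 0" and s = "\<lambda>k x. \<bar>\<phi> (r k) x - u x\<bar>"])
      show "(\<lambda>x. \<bar>\<phi> (r k) x - u x\<bar>) \<in> borel_measurable M" for k
        by (intro borel_measurable_abs borel_measurable_diff mu test_function_measurable \<phi>(1))
      show "AE x in M. (\<lambda>k. \<bar>\<phi> (r k) x - u x\<bar>) \<longlonglongrightarrow> 0"
        using lim
      proof eventually_elim
        case (elim x)
        show ?case using tendsto_rabs[OF tendsto_diff[OF elim tendsto_const[of "u x"]]] by simp
      qed
      show "AE x in M. norm \<bar>\<phi> (r k) x - u x\<bar> \<le> z" for k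
        using ur
      proof eventually_elim
        case (elim x)
        then show ?case using \<phi>(2)[of "r k" x] by auto
      qed
    qed simp_all
    then show ?thesis by simp
  qed
  define E0 where "E0 = inf_value + lam * reaction u"
  have ne: "competitors u E0 n \<noteq> {}" for n
  proof -
    have e: "inverse (real (Suc n)) > 0" by simp
    have "(\<lambda>k. inf_value + inverse (real (Suc k)) + lam * (reaction u + C * (LINT x|M. \<bar>\<phi> (r k) x - u x\<bar>))) \<longlonglongrightarrow> inf_value + 0 + lam * (reaction u + C * 0)"
      by (intro tendsto_add tendsto_mult tendsto_const D0 LIMSEQ_inverse_real_of_nat)
    then have ev1: "\<forall>\<^sub>F k in sequentially. inf_value + inverse (real (Suc k)) + lam * (reaction u + C * (LINT x|M. \<bar>\<phi> (r k) x - u x\<bar>))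
        < E0 + inverse (real (Suc n))"
      using e by (intro order_tendstoD(2)) (auto simp: E0_def)
    have ev2: "\<forall>\<^sub>F k in sequentially. (LINT x|M. \<bar>\<phi> (r k) x - u x\<bar>) < inverse (real (Suc n))"
      by (rule order_tendstoD(2)[OF D0 e])
    from eventually_happens'[OF sequentially_bot eventually_conj[OF ev1 ev2]] obtain k where k: "inf_value + inverse (real (Suc k)) + lam * (reaction u + C * (LINT x|M. \<bar>\<phi> (r k) x - u x\<bar>))
        < E0 + inverse (real (Suc n))" "(LINT x|M. \<bar>\<phi> (r k) x - u x\<bar>) < inverse (real (Suc n))"
      by blast
    have "\<bar>reaction (\<phi> (r k)) - reaction u\<bar> \<le> C * (LINT x|M. \<bar>\<phi> (r k) x - u x\<bar>)"
      by (rule reaction_lipschitz[OF test_function_integrable(1)[OF \<phi>(1)] iu])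
    then have "lam * reaction (\<phi> (r k)) \<le> lam * (reaction u + C * (LINT x|M. \<bar>\<phi> (r k) x - u x\<bar>))"
      using lam_pos by (intro mult_left_mono) auto
    moreover have "inverse (real (Suc (r k))) \<le> inverse (real (Suc k))"
      using seq_suble[OF r(1), of k] by (intro le_imp_inverse_le) auto
    ultimately have "energy (grad (\<phi> (r k))) \<le> E0 + inverse (real (Suc n))"
      using \<phi>(3)[of "r k"] k(1) unfolding functional_def by linarith
    then have "\<phi> (r k) \<in> competitors u E0 n" using \<phi>(1,2) k(2) by (simp add: competitors_def del: of_nat_Suc)
    then show ?thesis by blast
  qed
  then have "competitors u (inf_value + lam * reaction u) n \<noteq> {}" for n by (simp add: E0_def)
  with mu ur show thesis by (rule that)
qed

definition midpoint_fun :: "('a \<Rightarrow> real) \<Rightarrow> ('a \<Rightarrow> real) \<Rightarrow> 'a \<Rightarrow> real" where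
  "midpoint_fun v w x = (1/2) * v x + (1/2) * w x"

lemma midpoint_test_function:
  assumes "v \<in> test_functions \<Omega>" "w \<in> test_functions \<Omega>"
  shows "midpoint_fun v w \<in> test_functions \<Omega>"
    "grad (midpoint_fun v w) x = (1/2) *\<^sub>R (grad v x + grad w x)"
proof -
  have "midpoint_fun v w = (\<lambda>x. (1/2) * v x + (1/2) * w x)" by (simp add: fun_eq_iff midpoint_fun_def)
  with test_functions_add[OF assms, of "1/2" "1/2"] show "midpoint_fun v w \<in> test_functions \<Omega>"
    "grad (midpoint_fun v w) x = (1/2) *\<^sub>R (grad v x + grad w x)"
    by (simp_all add: scaleR_add_right)
qed

lemma midpoint_competitor:
  assumes iu: "integrable M u" and v: "v \<in> competitors u E0 k" and w: "w \<in> competitors u E0 k"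
  shows "midpoint_fun v w \<in> competitors u E0 k"
proof -
  have vT: "v \<in> test_functions \<Omega>" and wT: "w \<in> test_functions \<Omega>" using v w by (simp_all add: competitors_def)
  have range: "0 \<le> midpoint_fun v w x \<and> midpoint_fun v w x \<le> z" for x
  proof -
    have "0 \<le> v x" "v x \<le> z" "0 \<le> w x" "w x \<le> z" using v w by (simp_all add: competitors_def)
    then show ?thesis by (simp add: midpoint_fun_def)
  qed
  have iv: "integrable M (\<lambda>x. \<bar>v x - u x\<bar>)" "integrable M (\<lambda>x. \<bar>w x - u x\<bar>)"
    by (intro integrable_abs Bochner_Integration.integrable_diff iu test_function_integrable vT wT)+
  have "(LINT x|M. \<bar>midpoint_fun v w x - u x\<bar>) \<le> (LINT x|M. (1/2) * \<bar>v x - u x\<bar> + (1/2) * \<bar>w x - u x\<bar>)"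
  proof (rule integral_mono)
    show "integrable M (\<lambda>x. \<bar>midpoint_fun v w x - u x\<bar>)"
      by (intro integrable_abs Bochner_Integration.integrable_diff iu test_function_integrable midpoint_test_function(1) vT wT)
    show "integrable M (\<lambda>x. (1/2) * \<bar>v x - u x\<bar> + (1/2) * \<bar>w x - u x\<bar>)"
      by (intro Bochner_Integration.integrable_add integrable_mult_right iv)
    show "\<bar>midpoint_fun v w x - u x\<bar> \<le> (1/2) * \<bar>v x - u x\<bar> + (1/2) * \<bar>w x - u x\<bar>" for x
    proof -
      have eq: "midpoint_fun v w x - u x = (v x - u x) / 2 + (w x - u x) / 2"
        by (simp add: midpoint_fun_def field_simps)
      show ?thesis
        using abs_triangle_ineq[of "(v x - u x) / 2" "(w x - u x) / 2"] unfolding eq by simp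
    qed
  qed
  also have "\<dots> = (1/2) * (LINT x|M. \<bar>v x - u x\<bar>) + (1/2) * (LINT x|M. \<bar>w x - u x\<bar>)"
    using iv by simp
  also have "\<dots> \<le> inverse (real (Suc k))" using v w by (simp add: competitors_def del: of_nat_Suc)
  finally have d: "(LINT x|M. \<bar>midpoint_fun v w x - u x\<bar>) \<le> inverse (real (Suc k))" .
  have "energy (grad (midpoint_fun v w)) = energy (\<lambda>x. (1 - 1/2) *\<^sub>R grad v x + (1/2) *\<^sub>R grad w x)"
    unfolding energy_def midpoint_test_function(2)[OF vT wT] by (simp add: scaleR_add_right)
  also have "\<dots> \<le> (1 - 1/2) * energy (grad v) + (1/2) * energy (grad w)"
    by (rule energy_convex[OF test_function_Lp(2)[OF vT p_pos(2)] test_function_Lp(2)[OF wT p_pos(2)]]) simp_all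
  also have "\<dots> \<le> E0 + inverse (real (Suc k))" using v w by (simp add: competitors_def del: of_nat_Suc)
  finally have "energy (grad (midpoint_fun v w)) \<le> E0 + inverse (real (Suc k))" .
  then show ?thesis using midpoint_test_function(1)[OF vT wT] range d by (simp add: competitors_def del: of_nat_Suc)
qed

text \<open>
  Near-minimisers of \<open>\<integral> |\<nabla>v|^p\<close> over the sets of competitors have gradients that form a Cauchy sequence.
\<close>

lemma competitors_with_convergent_gradients:
  assumes iu: "integrable M u" and ne: "\<And>n. competitors u E0 n \<noteq> {}"
  obtains v g where "\<And>k. v k \<in> competitors u E0 k" "Lp_fun M p g"
    "(\<lambda>k. LINT x|M. norm (grad (v k) x - g x) powr p) \<longlonglongrightarrow> 0"
proof -
  define J where "J = (\<lambda>v. LINT x|M. norm (grad v x) powr p)"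
  define Bd where "Bd = p / \<alpha> * (E0 + 1)"
  have JB: "J v \<le> Bd" if v: "v \<in> competitors u E0 0" for v
  proof -
    have "J v \<le> p / \<alpha> * energy (grad v)" unfolding J_def by (rule gradient_integral_le_energy) (use v in \<open>simp add: competitors_def\<close>)
    also have "\<dots> \<le> Bd" unfolding Bd_def
      using v \<alpha>0 p_pos(3) by (intro mult_left_mono) (auto simp: competitors_def)
    finally show ?thesis .
  qed
  have J0: "J v \<ge> 0" for v by (simp add: J_def)
  have "\<exists>v. (\<forall>k. v k \<in> competitors u E0 k) \<and>
    (\<forall>e>0. \<exists>N. \<forall>k\<ge>N. \<forall>m\<ge>N. (J (v k) + J (v m)) / 2 - J (midpoint_fun (v k) (v m)) < e)"
  proof (rule nested_midpoint_minimizers[of "competitors u E0" J Bd midpoint_fun])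
    fix v assume "\<And>k. v k \<in> competitors u E0 k"
      "\<And>e. e > 0 \<Longrightarrow> \<exists>N. \<forall>k\<ge>N. \<forall>m\<ge>N. (J (v k) + J (v m)) / 2 - J (midpoint_fun (v k) (v m)) < e"
    then show ?thesis by (intro exI[of _ v] conjI allI impI)
  qed (fact competitors_decreasing ne J0 JB midpoint_competitor[OF iu])+
  then obtain v where v: "\<And>k. v k \<in> competitors u E0 k"
    "\<And>e. e > 0 \<Longrightarrow> \<exists>N. \<forall>k\<ge>N. \<forall>m\<ge>N. (J (v k) + J (v m)) / 2 - J (midpoint_fun (v k) (v m)) < e"
    by blast
  have vT: "v k \<in> test_functions \<Omega>" for k using v(1)[of k] by (simp add: competitors_def)
  have LG: "Lp_fun M p (grad (v k))" for k by (rule test_function_Lp(2)[OF vT p_pos(2)])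
  have JvB: "J (v k) \<le> Bd" for k using JB competitors_decreasing[of 0 k] v(1)[of k] by blast
  have Bd0: "Bd \<ge> 0" using JvB[of 0] by (rule order_trans[rotated]) (simp add: J_def)
  have cau: "\<exists>N. \<forall>i\<ge>N. \<forall>j\<ge>N. (LINT x|M. norm (grad (v i) x - grad (v j) x) powr p) < e" if e: "e > 0" for e
  proof -
    \<comment> \<open>The summand 1 keeps the denominator of \<open>\<epsilon>\<close> positive when \<open>Bd = 0\<close>.\<close>
    define q where "q = 2 * Bd + 1"
    have q: "q > 0" using Bd0 by (simp add: q_def)
    define \<epsilon> where "\<epsilon> = e / (2 * q)"
    have \<epsilon>: "\<epsilon> > 0" using e q by (simp add: \<epsilon>_def)
    obtain c where c: "c \<ge> 0" "\<And>a b :: 'a. norm (a - b) powr p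
      \<le> \<epsilon> * (norm a powr p + norm b powr p)
        + c * ((norm a powr p + norm b powr p) / 2 - norm ((1/2) *\<^sub>R (a + b)) powr p)"
      using norm_powr_uniformly_convex[OF p1 \<epsilon>] by blast
    have "e / (2 * (c + 1)) > 0" using e c(1) by simp
    then obtain N where N: "\<forall>k\<ge>N. \<forall>m\<ge>N. (J (v k) + J (v m)) / 2 - J (midpoint_fun (v k) (v m)) < e / (2 * (c + 1))"
      using v(2) by blast
    have "(LINT x|M. norm (grad (v i) x - grad (v j) x) powr p) < e" if ij: "i \<ge> N" "j \<ge> N" for i j
    proof -
      let ?s = "\<lambda>x. norm (grad (v i) x) powr p + norm (grad (v j) x) powr p"
      let ?m = "\<lambda>x. norm (grad (midpoint_fun (v i) (v j)) x) powr p"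
      have i1: "integrable M (\<lambda>x. norm (grad (v i) x) powr p)" "integrable M (\<lambda>x. norm (grad (v j) x) powr p)"
        "integrable M ?m"
        by (rule Lp_funD(2)[OF LG] Lp_funD(2)[OF test_function_Lp(2)[OF midpoint_test_function(1)[OF vT vT] p_pos(2)]])+
      have iS: "integrable M ?s" using i1 by (intro Bochner_Integration.integrable_add)
      have "(LINT x|M. norm (grad (v i) x - grad (v j) x) powr p) \<le> (LINT x|M. \<epsilon> * ?s x + c * (?s x / 2 - ?m x))"
      proof (rule integral_mono)
        show "integrable M (\<lambda>x. norm (grad (v i) x - grad (v j) x) powr p)"
          by (rule Lp_funD(2)[OF Lp_fun_diff[OF p_pos(2) LG LG]])
        show "integrable M (\<lambda>x. \<epsilon> * ?s x + c * (?s x / 2 - ?m x))"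
          by (intro Bochner_Integration.integrable_add integrable_mult_right Bochner_Integration.integrable_diff
              integrable_divide iS i1(3))
        show "norm (grad (v i) x - grad (v j) x) powr p \<le> \<epsilon> * ?s x + c * (?s x / 2 - ?m x)" for x
          using c(2)[of "grad (v i) x" "grad (v j) x"] by (simp only: midpoint_test_function(2)[OF vT vT])
      qed
      also have "\<dots> = \<epsilon> * (J (v i) + J (v j)) + c * ((J (v i) + J (v j)) / 2 - J (midpoint_fun (v i) (v j)))"
        using i1 iS by (simp add: J_def)
      also have "\<dots> < e"
      proof -
        have "\<epsilon> * (J (v i) + J (v j)) \<le> \<epsilon> * (2 * Bd)" using JvB[of i] JvB[of j] \<epsilon> by (intro mult_left_mono) auto
        also have "\<dots> < \<epsilon> * q" using \<epsilon> by (simp add: q_def)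
        also have "\<dots> = e / 2" using q by (simp add: \<epsilon>_def)
        finally have 1: "\<epsilon> * (J (v i) + J (v j)) < e / 2" .
        have "c * ((J (v i) + J (v j)) / 2 - J (midpoint_fun (v i) (v j))) \<le> c * (e / (2 * (c + 1)))"
          using N ij c(1) by (intro mult_left_mono) (auto intro: less_imp_le)
        also have "\<dots> \<le> (c + 1) * (e / (2 * (c + 1)))" using e c(1) by (intro mult_right_mono) auto
        also have "\<dots> = e / 2"
        proof -
          define d where "d = c + 1"
          have "d > 0" using c(1) by (simp add: d_def)
          then show ?thesis unfolding d_def[symmetric] by simp
        qed
        finally show ?thesis using 1 by linarith
      qed
      finally show ?thesis .
    qed
    then show ?thesis by blast
  qed
  obtain r2 g where r2: "strict_mono (r2 :: nat \<Rightarrow> nat)" and Lg: "Lp_fun M p g"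
    and glim: "(\<lambda>k. LINT x|M. norm (grad (v (r2 k)) x - g x) powr p) \<longlonglongrightarrow> 0"
    by (rule Lp_Cauchy_limit[OF p_pos(1) LG cau]) blast+
  show thesis
  proof (rule that[of "\<lambda>k. v (r2 k)" g])
    show "v (r2 k) \<in> competitors u E0 k" for k
      using v(1)[of "r2 k"] competitors_decreasing[OF seq_suble[OF r2]] by blast
  qed (fact Lg glim)+
qed

text \<open>
  The competitors obtained above converge to \<open>u\<close> together with their gradients, so \<open>u\<close> belongs to the closure of
  the test functions, and \<open>energy_perturb\<close> bounds the energy of the limit gradient by \<open>E0\<close>.
\<close>

lemma minimizer_exists:
  obtains u g where "W0 p u g" "AE x in M. 0 \<le> u x \<and> u x \<le> z" "functional u g \<le> inf_value"
proof -
  obtain u where mu: "u \<in> borel_measurable M" and ur: "AE x in M. 0 \<le> u x \<and> u x \<le> z"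
    and ne: "\<And>n. competitors u (inf_value + lam * reaction u) n \<noteq> {}"
    by (rule limit_of_minimising_sequence) (rule that)
  define E0 where "E0 = inf_value + lam * reaction u"
  have Lu: "Lp_fun M p u"
    by (rule bounded_Lp_fun[OF mu _ p_pos(2), of z], rule AE_mp[OF ur]) (auto intro!: AE_I2)
  have iu: "integrable M u" by (rule Lp_fun_integrable[OF p_pos(1) Lu])
  obtain v g where v: "\<And>k. v k \<in> competitors u E0 k" and Lg: "Lp_fun M p g"
    and glim: "(\<lambda>k. LINT x|M. norm (grad (v k) x - g x) powr p) \<longlonglongrightarrow> 0"
    by (rule competitors_with_convergent_gradients[OF iu ne[folded E0_def]]) (rule that)
  have vT: "v k \<in> test_functions \<Omega>" for k using v[of k] by (simp add: competitors_def)
  have LG: "Lp_fun M p (grad (v k))" for k by (rule test_function_Lp(2)[OF vT p_pos(2)])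
  have ulim: "(\<lambda>k. LINT x|M. norm (u x - v k x) powr p) \<longlonglongrightarrow> 0"
  proof (rule Lim_null_comparison)
    show "(\<lambda>k. z powr (p - 1) * inverse (real (Suc k))) \<longlonglongrightarrow> 0"
      using tendsto_mult_right_zero[OF LIMSEQ_inverse_real_of_nat] by simp
    have "norm (LINT x|M. norm (u x - v k x) powr p) \<le> z powr (p - 1) * inverse (real (Suc k))" for k
    proof -
      have vk: "\<forall>x. 0 \<le> v k x \<and> v k x \<le> z"
        "(LINT x|M. \<bar>v k x - u x\<bar>) \<le> inverse (real (Suc k))"
        using v[of k] unfolding competitors_def by blast+
      have i: "integrable M (\<lambda>x. \<bar>v k x - u x\<bar>)"
        by (intro integrable_abs Bochner_Integration.integrable_diff iu test_function_integrable vT)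
      have "(LINT x|M. norm (u x - v k x) powr p) \<le> (LINT x|M. z powr (p - 1) * \<bar>v k x - u x\<bar>)"
      proof (rule integral_mono_AE)
        show "integrable M (\<lambda>x. norm (u x - v k x) powr p)"
          by (rule Lp_funD(2)[OF Lp_fun_diff[OF p_pos(2) Lu test_function_Lp(1)[OF vT p_pos(2)]]])
        show "integrable M (\<lambda>x. z powr (p - 1) * \<bar>v k x - u x\<bar>)" by (rule integrable_mult_right[OF i])
        show "AE x in M. norm (u x - v k x) powr p \<le> z powr (p - 1) * \<bar>v k x - u x\<bar>"
          using ur
        proof eventually_elim
          case (elim x)
          define d where "d = \<bar>v k x - u x\<bar>"
          have "0 \<le> v k x" "v k x \<le> z" using vk by auto
          with elim have d: "0 \<le> d" "d \<le> z" by (auto simp: d_def)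
          have "d powr p = d powr (p - 1) * d"
            using d(1) powr_add[of d "p - 1" 1] by simp
          also have "\<dots> \<le> z powr (p - 1) * d"
            using d p1 by (intro mult_right_mono powr_mono2) auto
          finally show ?case by (simp add: d_def abs_minus_commute)
        qed
      qed
      also have "\<dots> = z powr (p - 1) * (LINT x|M. \<bar>v k x - u x\<bar>)" by simp
      also have "\<dots> \<le> z powr (p - 1) * inverse (real (Suc k))"
        by (rule mult_left_mono[OF vk(2)]) simp
      finally show ?thesis by (simp add: abs_of_nonneg)
    qed
    then show "\<forall>\<^sub>F k in sequentially. norm (LINT x|M. norm (u x - v k x) powr p) \<le> z powr (p - 1) * inverse (real (Suc k))"
      by (intro always_eventually allI)
  qed
  have W: "W0 p u g"
    unfolding W0_def
    by (intro conjI exI[of _ "\<lambda>k. v k"] allI Lu Lg vT ulim) (use glim in \<open>simp add: norm_minus_commute\<close>)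
  have Eg: "energy (\<lambda>x. (1 - t) *\<^sub>R g x) \<le> E0" if t: "0 < t" "t < 1" for t
  proof -
    define c where "c = t * (\<beta> / p * ((1 - t) / t) powr p)"
    have "energy (\<lambda>x. (1 - t) *\<^sub>R g x) \<le> (E0 + inverse (real (Suc k))) + c * (LINT x|M. norm (grad (v k) x - g x) powr p)" for k
    proof -
      have "energy (\<lambda>x. (1 - t) *\<^sub>R g x) \<le> energy (grad (v k)) + c * (LINT x|M. norm (grad (v k) x - g x) powr p)"
        using energy_perturb[OF Lg LG t, of k] by (simp add: c_def norm_minus_commute)
      moreover have "energy (grad (v k)) \<le> E0 + inverse (real (Suc k))"
        using v[of k] unfolding competitors_def by blast
      ultimately show ?thesis by linarith
    qed
    moreover have "(\<lambda>k. (E0 + inverse (real (Suc k))) + c * (LINT x|M. norm (grad (v k) x - g x) powr p)) \<longlonglongrightarrow> (E0 + 0) + c * 0"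
      by (intro tendsto_add tendsto_mult tendsto_const glim LIMSEQ_inverse_real_of_nat)
    ultimately have "energy (\<lambda>x. (1 - t) *\<^sub>R g x) \<le> (E0 + 0) + c * 0" by (intro LIMSEQ_le_const) auto
    then show ?thesis by simp
  qed
  have "energy g \<le> E0"
  proof (rule LIMSEQ_le_const2[OF energy_shrink_tendsto[OF Lg]], intro exI allI impI)
    show "energy (\<lambda>x. (1 - inverse (real (Suc (Suc n)))) *\<^sub>R g x) \<le> E0" for n
      by (rule Eg) (simp_all add: inverse_less_1_iff)
  qed
  then have "functional u g \<le> inf_value" by (simp add: functional_def E0_def)
  with W ur show thesis by (rule that)
qed

end

section \<open>The Euler-Lagrange equation\<close>

context p_growth_energy
begin

text \<open>
  The upper bound uses that \<open>\<xi> + t \<eta>\<close> lies between \<open>\<xi>\<close> and \<open>\<xi> + \<eta>\<close>, the lower one that \<open>\<xi>\<close> lies between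
  \<open>\<xi> + t \<eta>\<close> and \<open>\<xi> - \<eta>\<close>.
\<close>

lemma \<Phi>_quotient_bound:
  assumes reg: "regular_at x" and t: "0 < t" "t \<le> 1"
  shows "\<bar>(\<Phi> x (\<xi> + t *\<^sub>R \<eta>) - \<Phi> x \<xi>) / t\<bar> \<le> \<Phi> x (\<xi> + \<eta>) + \<Phi> x (\<xi> - \<eta>)"
proof -
  note nn = \<Phi>_nonneg[OF reg]
  define A where "A = \<Phi> x (\<xi> + t *\<^sub>R \<eta>)"
  define B where "B = \<Phi> x \<xi>"
  have "(1 - t) *\<^sub>R \<xi> + t *\<^sub>R (\<xi> + \<eta>) = \<xi> + t *\<^sub>R \<eta>" by (simp add: algebra_simps)
  then have "A \<le> (1 - t) * B + t * \<Phi> x (\<xi> + \<eta>)"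
    using \<Phi>_convex[OF reg, of t \<xi> "\<xi> + \<eta>"] t by (simp add: A_def B_def)
  then have "A - B \<le> t * (\<Phi> x (\<xi> + \<eta>) - B)" by (simp add: algebra_simps)
  then have up: "(A - B) / t \<le> \<Phi> x (\<xi> + \<eta>) - B"
    using t by (simp add: pos_divide_le_eq mult.commute)
  \<comment> \<open>The weight for which \<open>\<xi>\<close> is a convex combination of \<open>\<xi> + t \<eta>\<close> and \<open>\<xi> - \<eta>\<close>.\<close>
  define s where "s = t / (1 + t)"
  have s: "0 \<le> s" "s \<le> 1" "1 - s = 1 / (1 + t)" using t by (simp_all add: s_def field_simps)
  have "(1 - s) *\<^sub>R (\<xi> + t *\<^sub>R \<eta>) + s *\<^sub>R (\<xi> - \<eta>) = \<xi>"
  proof -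
    have st: "s = (1 - s) * t" using s(3) by (simp add: s_def)
    have "(1 - s) *\<^sub>R (\<xi> + t *\<^sub>R \<eta>) + s *\<^sub>R (\<xi> - \<eta>) = \<xi> + ((1 - s) * t - s) *\<^sub>R \<eta>"
      by (simp add: algebra_simps)
    then show ?thesis using st by simp
  qed
  then have "B \<le> (1 - s) * A + s * \<Phi> x (\<xi> - \<eta>)"
    using \<Phi>_convex[OF reg s(1,2), of "\<xi> + t *\<^sub>R \<eta>" "\<xi> - \<eta>"] by (simp add: A_def B_def)
  then have "(1 + t) * B \<le> (1 + t) * ((1 - s) * A + s * \<Phi> x (\<xi> - \<eta>))"
    using t by (intro mult_left_mono) auto
  also have "\<dots> = ((1 + t) * (1 - s)) * A + ((1 + t) * s) * \<Phi> x (\<xi> - \<eta>)" by (simp add: algebra_simps)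
  also have "(1 + t) * (1 - s) = 1" using s(3) t by simp
  also have "(1 + t) * s = t" using t by (simp add: s_def)
  finally have "t * (B - \<Phi> x (\<xi> - \<eta>)) \<le> A - B" by (simp add: algebra_simps)
  then have low: "B - \<Phi> x (\<xi> - \<eta>) \<le> (A - B) / t"
    using t by (simp add: pos_le_divide_eq mult.commute)
  have "B \<ge> 0" by (simp add: B_def nn)
  then show ?thesis
    using up low nn[of "\<xi> + \<eta>"] nn[of "\<xi> - \<eta>"] unfolding A_def[symmetric] B_def[symmetric] by linarith
qed

end

lemma DERIV_imp_quotient_sequence:
  fixes h :: "real \<Rightarrow> real"
  assumes "(h has_real_derivative d) (at 0)"
  shows "(\<lambda>n. (h (inverse (real (Suc n))) - h 0) / inverse (real (Suc n))) \<longlonglongrightarrow> d"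
proof -
  have lim: "((\<lambda>t. (h t - h 0) / t) \<longlongrightarrow> d) (at 0)"
    using assms by (simp add: DERIV_def)
  have "filterlim (\<lambda>n. inverse (real (Suc n))) (at 0) sequentially"
    unfolding filterlim_at using LIMSEQ_inverse_real_of_nat by simp
  from filterlim_compose[OF lim this] show ?thesis .
qed

context truncated_problem
begin

text \<open>
  The one-sided derivative of the functional at a minimiser in an admissible direction is nonnegative.
  Dominated convergence identifies it, with \<open>\<Phi>_quotient_bound\<close> providing the majorant of the
  energy quotients and the Lipschitz bound of \<open>G\<close> that of the others.
\<close>

lemma variational_inequality:
  assumes W: "W0 p u g" and min: "functional u g \<le> inf_value" and V: "W0 p \<phi> \<eta>"
  shows "integrable M (\<lambda>x. a x (g x) \<bullet> \<eta> x)" "integrable M (\<lambda>x. fz (u x) * \<phi> x)"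
    "0 \<le> (LINT x|M. a x (g x) \<bullet> \<eta> x) - lam * (LINT x|M. fz (u x) * \<phi> x)"
proof -
  define t where "t = (\<lambda>n. inverse (real (Suc n)))"
  have t: "0 < t n" "t n \<le> 1" for n by (simp_all add: t_def inverse_le_1_iff)
  note Lu = W0_Lp[OF W] and Lv = W0_Lp[OF V]
  have iu: "integrable M u" and iv: "integrable M \<phi>"
    using Lu Lv by (auto intro: Lp_fun_integrable[OF p_pos(1)])
  define q where "q = (\<lambda>n x. (\<Phi> x (g x + t n *\<^sub>R \<eta> x) - \<Phi> x (g x)) / t n)"
  define r where "r = (\<lambda>n x. (G (u x + t n * \<phi> x) - G (u x)) / t n)"
  have Lt: "Lp_fun M p (\<lambda>x. g x + c *\<^sub>R \<eta> x)" for c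
    by (rule Lp_fun_add[OF p_pos(2) Lu(2) Lp_fun_scale[OF Lv(2)]])
  have it: "integrable M (\<lambda>x. u x + c * \<phi> x)" for c
    by (intro Bochner_Integration.integrable_add integrable_mult_right iu iv)
  have iq: "integrable M (q n)" for n
    unfolding q_def by (intro integrable_divide Bochner_Integration.integrable_diff energy_integrable Lt Lu(2))
  have ir: "integrable M (r n)" for n
    unfolding r_def by (intro integrable_divide Bochner_Integration.integrable_diff G_integrable it iu)
  have qlim: "AE x in M. (\<lambda>n. q n x) \<longlonglongrightarrow> a x (g x) \<bullet> \<eta> x"
    using AE_regular
  proof eventually_elim
    case (elim x)
    have "((\<lambda>s. \<Phi> x (g x + s *\<^sub>R \<eta> x)) has_real_derivative \<eta> x \<bullet> a x (g x + 0 *\<^sub>R \<eta> x)) (at 0)"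
      by (rule \<Phi>_ray_deriv[OF elim])
    from DERIV_imp_quotient_sequence[OF this] show ?case
      by (simp add: q_def t_def inner_commute del: of_nat_Suc)
  qed
  have rlim: "(\<lambda>n. r n x) \<longlonglongrightarrow> fz (u x) * \<phi> x" for x
  proof -
    have "((\<lambda>s. G (u x + s * \<phi> x)) has_real_derivative fz (u x + 0 * \<phi> x) * \<phi> x) (at 0)"
      by (rule DERIV_chain2[OF G_deriv]) (auto intro!: derivative_eq_intros)
    from DERIV_imp_quotient_sequence[OF this] show ?thesis
      by (simp add: r_def t_def del: of_nat_Suc)
  qed
  have qb: "AE x in M. norm (q n x) \<le> \<Phi> x (g x + 1 *\<^sub>R \<eta> x) + \<Phi> x (g x + (-1) *\<^sub>R \<eta> x)" for n
    using AE_regular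
  proof eventually_elim
    case (elim x)
    show ?case using \<Phi>_quotient_bound[OF elim t(1)[of n] t(2)[of n], of "g x" "\<eta> x"] by (simp add: q_def)
  qed
  have iqb: "integrable M (\<lambda>x. \<Phi> x (g x + 1 *\<^sub>R \<eta> x) + \<Phi> x (g x + (-1) *\<^sub>R \<eta> x))"
    by (intro Bochner_Integration.integrable_add energy_integrable Lt)
  have rb: "norm (r n x) \<le> C * \<bar>\<phi> x\<bar>" for n x
  proof -
    have "\<bar>G (u x + t n * \<phi> x) - G (u x)\<bar> \<le> C * \<bar>t n * \<phi> x\<bar>"
      using G_lipschitz[of "u x + t n * \<phi> x" "u x"] by simp
    also have "\<dots> = C * \<bar>\<phi> x\<bar> * t n" using t(1)[of n] by (simp add: abs_mult)
    finally show ?thesis using t(1)[of n] by (simp add: r_def abs_divide pos_divide_le_eq)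
  qed
  have irb: "integrable M (\<lambda>x. C * \<bar>\<phi> x\<bar>)" by (intro integrable_mult_right integrable_abs iv)
  have ma: "(\<lambda>x. a x (g x) \<bullet> \<eta> x) \<in> borel_measurable M"
    by (rule borel_measurable_inner[OF superposition_measurable(1)[OF Lp_funD(1)[OF Lu(2)]] Lp_funD(1)[OF Lv(2)]])
  have mf: "(\<lambda>x. fz (u x) * \<phi> x) \<in> borel_measurable M"
    by (rule borel_measurable_times[OF measurable_compose[OF Lp_funD(1)[OF Lu(1)] borel_measurable_continuous_onI[OF fz_cont]] Lp_funD(1)[OF Lv(1)]])
  show "integrable M (\<lambda>x. a x (g x) \<bullet> \<eta> x)"
    by (rule integrable_dominated_convergence[OF ma borel_measurable_integrable[OF iq] iqb qlim qb])
  show "integrable M (\<lambda>x. fz (u x) * \<phi> x)"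
    by (rule integrable_dominated_convergence[OF mf borel_measurable_integrable[OF ir] irb AE_I2[OF rlim] AE_I2[OF rb]])
  have "(\<lambda>n. LINT x|M. q n x) \<longlonglongrightarrow> (LINT x|M. a x (g x) \<bullet> \<eta> x)"
    by (rule integral_dominated_convergence[OF ma borel_measurable_integrable[OF iq] iqb qlim qb])
  moreover have "(\<lambda>n. LINT x|M. r n x) \<longlonglongrightarrow> (LINT x|M. fz (u x) * \<phi> x)"
    by (rule integral_dominated_convergence[OF mf borel_measurable_integrable[OF ir] irb AE_I2[OF rlim] AE_I2[OF rb]])
  ultimately have lim: "(\<lambda>n. (LINT x|M. q n x) - lam * (LINT x|M. r n x))
      \<longlonglongrightarrow> (LINT x|M. a x (g x) \<bullet> \<eta> x) - lam * (LINT x|M. fz (u x) * \<phi> x)"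
    by (intro tendsto_diff tendsto_mult tendsto_const)
  have "0 \<le> (LINT x|M. q n x) - lam * (LINT x|M. r n x)" for n
  proof -
    have Q: "(LINT x|M. q n x) = (energy (\<lambda>x. g x + t n *\<^sub>R \<eta> x) - energy g) / t n"
      unfolding q_def energy_def
      by (simp only: integral_divide_zero Bochner_Integration.integral_diff[OF energy_integrable[OF Lt] energy_integrable[OF Lu(2)]])
    have R: "(LINT x|M. r n x) = (reaction (\<lambda>x. u x + t n * \<phi> x) - reaction u) / t n"
      unfolding r_def reaction_def
      by (simp only: integral_divide_zero Bochner_Integration.integral_diff[OF G_integrable[OF it] G_integrable[OF iu]])
    have "W0 p (\<lambda>x. u x + t n * \<phi> x) (\<lambda>x. g x + t n *\<^sub>R \<eta> x)"
      using W0_add_scale[OF p_pos(2) W V, of "t n"] by simp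
    from inf_value_le_W0[OF this] min have "functional u g \<le> functional (\<lambda>x. u x + t n * \<phi> x) (\<lambda>x. g x + t n *\<^sub>R \<eta> x)" by simp
    then have "0 \<le> (functional (\<lambda>x. u x + t n * \<phi> x) (\<lambda>x. g x + t n *\<^sub>R \<eta> x) - functional u g) / t n"
      using t(1)[of n] by (intro divide_nonneg_pos) simp_all
    also have "\<dots> = (LINT x|M. q n x) - lam * (LINT x|M. r n x)"
      unfolding Q R functional_def by (simp add: diff_divide_distrib right_diff_distrib)
    finally show ?thesis .
  qed
  then show "0 \<le> (LINT x|M. a x (g x) \<bullet> \<eta> x) - lam * (LINT x|M. fz (u x) * \<phi> x)"
    by (intro LIMSEQ_le_const[OF lim]) blast
qed

lemma euler_lagrange:
  assumes W: "W0 p u g" and min: "functional u g \<le> inf_value" and V: "W0 p \<phi> \<eta>"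
  shows "(LINT x|M. a x (g x) \<bullet> \<eta> x) = lam * (LINT x|M. fz (u x) * \<phi> x)"
proof -
  have "W0 p (\<lambda>x. - \<phi> x) (\<lambda>x. - \<eta> x)"
  proof -
    have eq: "s + (- 2) *\<^sub>R s = - s" for s :: "'v::real_vector"
      by (simp add: scaleR_2)
    show ?thesis using W0_add_scale[OF p_pos(2) V V, of "- 2"] unfolding eq .
  qed
  from variational_inequality(3)[OF W min this] variational_inequality(3)[OF W min V]
  show ?thesis by simp
qed

end

section \<open>Bounded solutions below a zero of the reaction term\<close>

lemma primitive_eq_antiderivative:
  assumes "\<And>x. 0 \<le> x \<Longrightarrow> x \<le> s \<Longrightarrow> (G has_real_derivative f x) (at x)" "G 0 = 0" "0 \<le> s"
  shows "primitive f s = G s"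
proof -
  have "(f has_integral (G s - G 0)) {0..s}"
  proof (rule fundamental_theorem_of_calculus[OF assms(3)])
    fix x assume "x \<in> {0..s}"
    then have "(G has_real_derivative f x) (at x)" using assms(1) by simp
    then show "(G has_vector_derivative f x) (at x within {0..s})"
      unfolding has_real_derivative_iff_has_vector_derivative by (rule has_vector_derivative_at_within)
  qed
  then show ?thesis using assms(2) by (simp add: primitive_def integral_unique)
qed

context p_growth_energy
begin

text \<open>
  The comparison with \<open>\<gamma>\<kappa>\<close> is the minimality of \<open>u\<close> for the truncated functional, expressed through the
  primitive of \<open>f\<close> itself. The energy of \<open>u\<close> has been dropped, since it is nonnegative.
\<close>

lemma exists_bounded_solution:
  fixes f :: "real \<Rightarrow> real" and z lam :: real
  assumes f: "continuous_on UNIV f" "f 0 \<ge> 0" and z: "z > 0" "f z = 0" and lam: "lam > 0"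
  shows "\<exists>u. bounded_solution \<Omega> p a f lam u \<and> (AE x in M. 0 \<le> u x \<and> u x \<le> z) \<and>
    (\<lambda>x. primitive f (u x)) \<in> borel_measurable M \<and>
    (\<forall>\<gamma> \<kappa>. 0 < \<gamma> \<and> \<gamma> \<le> z \<and> \<kappa> \<in> test_functions \<Omega> \<and> (\<forall>x. 0 \<le> \<kappa> x \<and> \<kappa> x \<le> 1) \<longrightarrow>
       integrable M (\<lambda>x. primitive f (\<gamma> * \<kappa> x)) \<and>
       - lam * (LINT x|M. primitive f (u x)) \<le>
         \<gamma> powr p * (\<beta> / p * (LINT x|M. norm (grad \<kappa> x) powr p)) - lam * (LINT x|M. primitive f (\<gamma> * \<kappa> x)))"
proof -
  define fz where "fz = (\<lambda>s. f (max 0 (min z s)))"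
  have fzc: "continuous_on UNIV fz"
    unfolding fz_def by (intro continuous_on_compose2[OF f(1)] continuous_intros) simp
  obtain G where G: "\<And>s. (G has_real_derivative fz s) (at s)" "G 0 = 0"
    by (rule continuous_has_antiderivative[OF fzc]) blast
  have "compact (f ` {0..z})" by (rule compact_continuous_image[OF continuous_on_subset[OF f(1)]]) simp_all
  then obtain C where C: "\<And>s. s \<in> {0..z} \<Longrightarrow> \<bar>f s\<bar> \<le> C"
    using compact_imp_bounded[of "f ` {0..z}"] unfolding bounded_iff by fastforce
  have fzb: "\<bar>fz s\<bar> \<le> C" for s unfolding fz_def by (rule C) (use z in auto)
  have Gc: "G s \<le> G (max 0 (min z s))" for s
  proof -
    consider "s < 0" | "0 \<le> s" "s \<le> z" | "z < s" by linarith
    then show ?thesis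
    proof cases
      case 1
      have "G s \<le> G 0"
      proof (rule DERIV_nonneg_imp_nondecreasing[where f = G])
        show "\<exists>y. (G has_real_derivative y) (at x) \<and> 0 \<le> y" if "s \<le> x" "x \<le> 0" for x
          by (intro exI[of _ "fz x"] conjI G(1)) (use that z f(2) in \<open>simp add: fz_def min_def max_def\<close>)
      qed (use 1 in simp)
      then show ?thesis using 1 z by simp
    next
      case 2
      then show ?thesis by simp
    next
      case 3
      have "G s \<le> G z"
      proof (rule DERIV_nonpos_imp_nonincreasing[where f = G])
        show "\<exists>y. (G has_real_derivative y) (at x) \<and> y \<le> 0" if "z \<le> x" "x \<le> s" for x
          by (intro exI[of _ "fz x"] conjI G(1)) (use that z in \<open>simp add: fz_def min_def max_def\<close>)
      qed (use 3 in simp)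
      then show ?thesis using 3 z by simp
    qed
  qed
  interpret T: truncated_problem \<Omega> p \<alpha> \<beta> a \<Phi> G fz z lam C
    by unfold_locales (fact z(1) lam G(1) fzb fzc Gc)+
  have Gprim: "primitive f s = G s" if s: "0 \<le> s" "s \<le> z" for s
  proof (rule primitive_eq_antiderivative[where G = G])
    show "(G has_real_derivative f x) (at x)" if "0 \<le> x" "x \<le> s" for x
    proof -
      have "fz x = f x" using that s by (simp add: fz_def)
      then show ?thesis using G(1)[of x] by simp
    qed
  qed (fact G(2) s(1))+
  obtain u g0 where u: "W0 p u g0" "AE x in M. 0 \<le> u x \<and> u x \<le> z" "T.functional u g0 \<le> T.inf_value"
    by (rule T.minimizer_exists) blast
  note W1 = W0_imp_W1p_0[OF p_pos(1) u(1)]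
  define g where "g = weak_grad \<Omega> u"
  have W: "W0 p u g" unfolding g_def by (rule W1p_0_imp_W0[OF p_pos(1) W1(1)])
  have "energy g = energy g0"
    unfolding energy_def
  proof (rule integral_cong_AE)
    show "(\<lambda>x. \<Phi> x (g x)) \<in> borel_measurable M" "(\<lambda>x. \<Phi> x (g0 x)) \<in> borel_measurable M"
      by (intro superposition_measurable(2) Lp_funD(1)[OF W0_Lp(2)[OF W]] Lp_funD(1)[OF W0_Lp(2)[OF u(1)]])+
    show "AE x in M. \<Phi> x (g x) = \<Phi> x (g0 x)"
      using W1(2) by eventually_elim (simp add: g_def)
  qed
  with u(3) have min: "T.functional u g \<le> T.inf_value" by (simp add: T.functional_def)
  have mu: "u \<in> borel_measurable M" by (rule Lp_funD(1)[OF W0_Lp(1)[OF W]])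
  have "Linf_norm \<Omega> u \<le> ereal z"
    unfolding Linf_norm_def
  proof (rule esssup_I)
    show "(\<lambda>x. ereal \<bar>u x\<bar>) \<in> borel_measurable M" using mu by measurable
    show "AE x in M. ereal \<bar>u x\<bar> \<le> ereal z" using u(2) by eventually_elim simp
  qed
  then have "Linf_norm \<Omega> u < \<infinity>" by (rule le_less_trans) simp
  with mu have Linf: "u \<in> Linf_space \<Omega>" by (simp add: Linf_space_def)
  have fzu: "AE x in M. fz (u x) = f (u x)"
    using u(2) by eventually_elim (simp add: fz_def)
  have mfz: "(\<lambda>x. fz (u x)) \<in> borel_measurable M" and mfu: "(\<lambda>x. f (u x)) \<in> borel_measurable M"
    by (rule measurable_compose[OF mu borel_measurable_continuous_onI[OF fzc]]
        measurable_compose[OF mu borel_measurable_continuous_onI[OF f(1)]])+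
  have sol: "bounded_solution \<Omega> p a f lam u"
    unfolding bounded_solution_def
  proof (intro conjI ballI IntI W1(1) Linf)
    fix \<phi> assume "\<phi> \<in> W1p_0 \<Omega> p \<inter> Linf_space \<Omega>"
    then have V: "W0 p \<phi> (weak_grad \<Omega> \<phi>)" by (intro W1p_0_imp_W0[OF p_pos(1)]) simp
    note VI = T.variational_inequality[OF W min V]
    have m\<phi>: "\<phi> \<in> borel_measurable M" by (rule Lp_funD(1)[OF W0_Lp(1)[OF V]])
    have ae: "AE x in M. fz (u x) * \<phi> x = f (u x) * \<phi> x" using fzu by eventually_elim simp
    have m: "(\<lambda>x. fz (u x) * \<phi> x) \<in> borel_measurable M" "(\<lambda>x. f (u x) * \<phi> x) \<in> borel_measurable M"
      by (intro borel_measurable_times mfz mfu m\<phi>)+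
    show "integrable M (\<lambda>x. a x (weak_grad \<Omega> u x) \<bullet> weak_grad \<Omega> \<phi> x)"
      using VI(1) by (simp add: g_def)
    show "integrable M (\<lambda>x. f (u x) * \<phi> x)"
      using VI(2) integrable_cong_AE[OF m ae] by simp
    show "(LINT x|M. a x (weak_grad \<Omega> u x) \<bullet> weak_grad \<Omega> \<phi> x) = lam * (LINT x|M. f (u x) * \<phi> x)"
      using T.euler_lagrange[OF W min V] integral_cong_AE[OF m ae] by (simp add: g_def)
  qed
  have mG: "(\<lambda>x. G (u x)) \<in> borel_measurable M" by (rule T.G_measurable[OF mu])
  have aeF: "AE x in M. G (u x) = primitive f (u x)"
    using u(2) by eventually_elim (simp add: Gprim)
  have mF: "(\<lambda>x. primitive f (u x)) \<in> borel_measurable M"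
    by (rule measurable_lebesgue_on_AE[OF sets_\<Omega>(1) mG aeF])
  have Pu: "T.reaction u = (LINT x|M. primitive f (u x))"
    unfolding T.reaction_def by (rule integral_cong_AE[OF mG mF aeF])
  have "integrable M (\<lambda>x. primitive f (\<gamma> * \<kappa> x)) \<and>
       - lam * (LINT x|M. primitive f (u x)) \<le>
         \<gamma> powr p * (\<beta> / p * (LINT x|M. norm (grad \<kappa> x) powr p)) - lam * (LINT x|M. primitive f (\<gamma> * \<kappa> x))"
    if \<gamma>: "0 < \<gamma>" "\<gamma> \<le> z" and \<kappa>: "\<kappa> \<in> test_functions \<Omega>" "\<And>x. 0 \<le> \<kappa> x \<and> \<kappa> x \<le> 1" for \<gamma> \<kappa>
  proof -
    note S = test_functions_scale[OF \<kappa>(1), where c = \<gamma>]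
    have eq: "primitive f (\<gamma> * \<kappa> x) = G (\<gamma> * \<kappa> x)" for x
    proof (rule Gprim)
      show "0 \<le> \<gamma> * \<kappa> x" using \<gamma> \<kappa>(2)[of x] by simp
      have "\<gamma> * \<kappa> x \<le> \<gamma> * 1" using \<gamma> \<kappa>(2)[of x] by (intro mult_left_mono) auto
      then show "\<gamma> * \<kappa> x \<le> z" using \<gamma>(2) by simp
    qed
    have i: "integrable M (\<lambda>x. G (\<gamma> * \<kappa> x))"
      by (rule T.G_integrable[OF test_function_integrable(1)[OF S(1)]])
    have "- lam * T.reaction u \<le> T.functional u g"
      using energy_bounds(1)[OF W0_Lp(2)[OF W]] by (simp add: T.functional_def)
    also have "\<dots> \<le> T.inf_value" by (rule min)
    also have "\<dots> \<le> T.functional (\<lambda>x. \<gamma> * \<kappa> x) (grad (\<lambda>x. \<gamma> * \<kappa> x))" by (rule T.inf_value_le[OF S(1)])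
    also have "\<dots> \<le> \<beta> / p * (LINT x|M. norm (grad (\<lambda>x. \<gamma> * \<kappa> x) x) powr p) - lam * T.reaction (\<lambda>x. \<gamma> * \<kappa> x)"
      unfolding T.functional_def
      by (rule diff_right_mono[OF energy_bounds(3)[OF test_function_Lp(2)[OF S(1) p_pos(2)]]])
    also have "(LINT x|M. norm (grad (\<lambda>x. \<gamma> * \<kappa> x) x) powr p) = \<gamma> powr p * (LINT x|M. norm (grad \<kappa> x) powr p)"
      using \<gamma>(1) by (simp add: S(2) powr_mult)
    finally show ?thesis using i
      by (simp only: Pu) (simp add: eq T.reaction_def mult.left_commute)
  qed
  with sol u(2) mF show ?thesis by blast
qed

end


section \<open>Sequences of solutions\<close>

context bounded_open_set
begin

lemma measure_pos: "\<Omega> \<noteq> {} \<Longrightarrow> measure M (space M) > 0"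
proof -
  assume "\<Omega> \<noteq> {}"
  then have "\<not> negligible \<Omega>" using open_\<Omega> by (rule open_not_negligible[rotated])
  then have "measure lebesgue \<Omega> \<noteq> 0" by (simp add: negligible_iff_measure)
  then show ?thesis by (simp add: measure_restrict_space zero_less_measure_iff)
qed

text \<open>
  On \<open>T\<close> the integrand is \<open>F \<gamma>\<close>, elsewhere at least \<open>- MM * F \<gamma>\<close>; the measure of the complement of \<open>T\<close> is so
  small that half of the first contribution survives.
\<close>

lemma integral_cutoff_lower_bound:
  fixes F :: "real \<Rightarrow> real"
  assumes MM: "MM \<ge> 0" and T: "T \<in> sets M" "measure M (space M - T) * (1 + MM) \<le> measure M (space M) / 2"
    and \<kappa>: "\<And>x. 0 \<le> \<kappa> x \<and> \<kappa> x \<le> 1" "\<And>x. x \<in> T \<Longrightarrow> \<kappa> x = 1"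
    and \<gamma>: "\<gamma> > 0" and F: "F \<gamma> \<ge> 0" "\<And>t. 0 \<le> t \<Longrightarrow> t \<le> \<gamma> \<Longrightarrow> - MM * F \<gamma> \<le> F t"
    and int: "integrable M (\<lambda>x. F (\<gamma> * \<kappa> x))"
  shows "F \<gamma> * (measure M (space M) / 2) \<le> (LINT x|M. F (\<gamma> * \<kappa> x))"
proof -
  let ?V = "space M - T"
  have V: "?V \<in> sets M" using T(1) by (rule sets.compl_sets)
  have "F \<gamma> * (measure M (space M) / 2) \<le> F \<gamma> * (measure M (space M) - measure M ?V * (1 + MM))"
    using T(2) F(1) by (intro mult_left_mono) auto
  also have "\<dots> = (LINT x|M. F \<gamma> - (1 + MM) * F \<gamma> * indicator ?V x)"
  proof -
    have "(\<Omega> - T) \<inter> \<Omega> = \<Omega> - T" by blast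
    then show ?thesis using V by (simp add: algebra_simps emeasure_eq_measure)
  qed
  also have "\<dots> \<le> (LINT x|M. F (\<gamma> * \<kappa> x))"
  proof (rule integral_mono[OF _ int])
    show "integrable M (\<lambda>x. F \<gamma> - (1 + MM) * F \<gamma> * indicator ?V x)"
      using V by (intro Bochner_Integration.integrable_diff integrable_mult_right integrable_real_indicator)
        (simp_all add: emeasure_eq_measure)
    fix x assume x: "x \<in> space M"
    show "F \<gamma> - (1 + MM) * F \<gamma> * indicator ?V x \<le> F (\<gamma> * \<kappa> x)"
    proof (cases "x \<in> T")
      case True
      then show ?thesis using \<kappa>(2) by simp
    next
      case False
      have "\<gamma> * \<kappa> x \<le> \<gamma> * 1" using \<gamma> \<kappa>(1)[of x] by (intro mult_left_mono) auto
      moreover have "0 \<le> \<gamma> * \<kappa> x" using \<gamma> \<kappa>(1)[of x] by simp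
      ultimately have "- MM * F \<gamma> \<le> F (\<gamma> * \<kappa> x)" by (intro F(2)) auto
      then show ?thesis using x False by (simp add: algebra_simps)
    qed
  qed
  finally show ?thesis .
qed

lemma large_cutoff_exists:
  assumes ne: "\<Omega> \<noteq> {}" and MM: "MM \<ge> 0"
  obtains T \<kappa> where "T \<in> sets M" "measure M (space M - T) * (1 + MM) \<le> measure M (space M) / 2"
    "\<kappa> \<in> test_functions \<Omega>" "\<And>x. 0 \<le> \<kappa> x \<and> \<kappa> x \<le> 1" "\<And>x. x \<in> T \<Longrightarrow> \<kappa> x = 1"
proof -
  define m where "m = measure M (space M)"
  have m: "m > 0" unfolding m_def by (rule measure_pos[OF ne])
  define e where "e = m / (2 * (1 + MM))"
  have e: "e > 0" using m MM by (simp add: e_def)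
  obtain T where T: "closed T" "T \<subseteq> \<Omega>" "\<Omega> - T \<in> lmeasurable" "emeasure lebesgue (\<Omega> - T) < ennreal e"
    using sets_lebesgue_inner_closed[OF sets_\<Omega>(1) e] by blast
  have cT: "compact T"
    using T(1,2) bounded_subset[OF bounded_\<Omega>] by (simp add: compact_eq_bounded_closed)
  obtain \<kappa> where \<kappa>: "\<kappa> \<in> test_functions \<Omega>" "\<And>x. 0 \<le> \<kappa> x" "\<And>x. \<kappa> x \<le> 1" "\<And>x. x \<in> T \<Longrightarrow> \<kappa> x = 1"
    using smooth_cutoff_exists[OF cT open_\<Omega> T(2)] by blast
  have TM: "T \<in> sets M"
    using cT T(2) by (simp add: sets_restrict_space_iff fmeasurableD lmeasurable_compact)
  have "measure M (space M - T) = measure lebesgue (\<Omega> - T)"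
    by (simp add: measure_restrict_space)
  also have "\<dots> \<le> e"
    using T(3,4) e by (simp add: emeasure_eq_measure2 ennreal_less_iff)
  finally have "measure M (space M - T) * (1 + MM) \<le> e * (1 + MM)"
    using MM by (intro mult_right_mono) auto
  also have "\<dots> = m / 2"
  proof -
    define d where "d = 1 + MM"
    have "d > 0" using MM by (simp add: d_def)
    then show ?thesis by (simp add: e_def d_def[symmetric])
  qed
  finally have "measure M (space M - T) * (1 + MM) \<le> measure M (space M) / 2" by (simp add: m_def)
  then show thesis using that[OF TM _ \<kappa>(1)] \<kappa>(2-4) by blast
qed

end

text \<open>
  For \<open>L = \<infinity>\<close> every \<open>k > 0\<close> is admissible. This is the source of the two alternatives for the threshold
  of \<open>\<lambda>\<close>.
\<close>

lemma eventually_energy_negative: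
  fixes q :: "nat \<Rightarrow> real" and L :: ereal
  assumes q: "(\<lambda>n. ereal (q n)) \<longlonglongrightarrow> L" and L: "L > 0" and A: "A \<ge> 0" and k: "k > 0"
    and large: "L = \<infinity> \<or> ereal (A / k) < L"
  obtains \<delta> m0 where "\<delta> > 0" "\<And>m. m \<ge> m0 \<Longrightarrow> A - k * q m \<le> - \<delta> \<and> q m > 0"
proof -
  have "ereal (A / k) < L" using large by auto
  then obtain s where s: "ereal (A / k) < ereal s" "ereal s < L"
    using ereal_dense2 by blast
  have "\<forall>\<^sub>F n in sequentially. ereal s < ereal (q n)"
    by (rule order_tendstoD(1)[OF q s(2)])
  then obtain m0 where m0: "\<And>m. m \<ge> m0 \<Longrightarrow> s < q m"
    unfolding eventually_sequentially by auto
  \<comment> \<open>The number s is a level between the threshold and L that the quotients eventually exceed.\<close>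
  have As: "A / k < s" using s(1) by simp
  have A0: "0 \<le> A / k" using A k by simp
  show thesis
  proof (rule that[of "k * s - A" m0])
    show "k * s - A > 0" using As k by (simp add: pos_divide_less_eq mult.commute)
    show "A - k * q m \<le> - (k * s - A) \<and> q m > 0" if "m \<ge> m0" for m
    proof -
      have "k * s \<le> k * q m" using m0[OF that] k by (intro mult_left_mono) auto
      then show ?thesis using m0[OF that] As A0 by simp
    qed
  qed
qed

context p_growth_energy
begin

text \<open>
  The fact \<open>key\<close> below says that \<open>lam * \<integral> F(u) \<ge> \<delta> * \<gamma> m powr p\<close> for the solution \<open>u\<close> below a zero that
  exceeds \<open>\<gamma> m\<close>. For \<open>l = 0\<close> every zero exceeds some late \<open>\<gamma> m\<close>, so no solution is zero, and the zeros
  themselves bound the norms. For \<open>l = \<infinity>\<close> the solutions below late zeros have arbitrarily large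
  integrals of \<open>F(u)\<close>, so their norms leave every bounded interval; the finitely many zeros below
  \<open>\<gamma> m0\<close> are skipped.
\<close>

lemma solution_sequence_exists:
  fixes f :: "real \<Rightarrow> real" and zer \<gamma> :: "nat \<Rightarrow> real" and l :: ereal
  assumes ne: "\<Omega> \<noteq> {}" and l: "l \<in> {0, \<infinity>}"
    and f: "continuous_on UNIV f" "f 0 \<ge> 0"
    and zer: "\<And>n. zer n > 0" "(\<lambda>n. ereal (zer n)) \<longlonglongrightarrow> l" "\<And>n. f (zer n) = 0"
    and \<gamma>: "\<And>n. \<gamma> n > 0" "(\<lambda>n. ereal (\<gamma> n)) \<longlonglongrightarrow> l"
    and MM: "MM \<ge> 0" "\<And>n t. 0 \<le> t \<Longrightarrow> t \<le> \<gamma> n \<Longrightarrow> - MM * primitive f (\<gamma> n) \<le> primitive f t"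
    and T: "T \<in> sets M" "measure M (space M - T) * (1 + MM) \<le> measure M (space M) / 2"
    and \<kappa>: "\<kappa> \<in> test_functions \<Omega>" "\<And>x. 0 \<le> \<kappa> x \<and> \<kappa> x \<le> 1" "\<And>x. x \<in> T \<Longrightarrow> \<kappa> x = 1"
    and lam: "lam > 0"
    and \<delta>: "\<delta> > 0" "\<And>m. m \<ge> m0 \<Longrightarrow>
      \<beta> / p * (LINT x|M. norm (grad \<kappa> x) powr p)
        - lam * (measure M (space M) / 2) * (primitive f (\<gamma> m) / \<gamma> m powr p) \<le> - \<delta>
      \<and> primitive f (\<gamma> m) / \<gamma> m powr p > 0"
  shows "has_solution_sequence \<Omega> p a f lam l"
proof -
  let ?F = "primitive f" and ?\<mu> = "measure M (space M)"
  have \<mu>: "?\<mu> > 0" by (rule measure_pos[OF ne])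
  have "\<forall>n. \<exists>u. bounded_solution \<Omega> p a f lam u \<and> (AE x in M. 0 \<le> u x \<and> u x \<le> zer n) \<and>
      (\<lambda>x. ?F (u x)) \<in> borel_measurable M \<and>
      (\<forall>\<gamma> \<kappa>. 0 < \<gamma> \<and> \<gamma> \<le> zer n \<and> \<kappa> \<in> test_functions \<Omega> \<and> (\<forall>x. 0 \<le> \<kappa> x \<and> \<kappa> x \<le> 1) \<longrightarrow>
       integrable M (\<lambda>x. ?F (\<gamma> * \<kappa> x)) \<and>
       - lam * (LINT x|M. ?F (u x)) \<le>
         \<gamma> powr p * (\<beta> / p * (LINT x|M. norm (grad \<kappa> x) powr p)) - lam * (LINT x|M. ?F (\<gamma> * \<kappa> x)))"
    using exists_bounded_solution[OF f zer(1) zer(3) lam] by blast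
  from choice[OF this] obtain U where U: "\<And>n. bounded_solution \<Omega> p a f lam (U n)"
      "\<And>n. AE x in M. 0 \<le> U n x \<and> U n x \<le> zer n" "\<And>n. (\<lambda>x. ?F (U n x)) \<in> borel_measurable M"
    and Uen: "\<And>n \<gamma> \<kappa>. 0 < \<gamma> \<and> \<gamma> \<le> zer n \<and> \<kappa> \<in> test_functions \<Omega> \<and> (\<forall>x. 0 \<le> \<kappa> x \<and> \<kappa> x \<le> 1) \<longrightarrow>
       integrable M (\<lambda>x. ?F (\<gamma> * \<kappa> x)) \<and>
       - lam * (LINT x|M. ?F (U n x)) \<le>
         \<gamma> powr p * (\<beta> / p * (LINT x|M. norm (grad \<kappa> x) powr p)) - lam * (LINT x|M. ?F (\<gamma> * \<kappa> x))"
    by blast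
  have key: "\<delta> * \<gamma> m powr p \<le> lam * (LINT x|M. ?F (U n x))" if m: "m \<ge> m0" "\<gamma> m \<le> zer n" for m n
  proof -
    define gp where "gp = \<gamma> m powr p"
    have gp: "gp > 0" using \<gamma>(1)[of m] by (simp add: gp_def)
    define A where "A = \<beta> / p * (LINT x|M. norm (grad \<kappa> x) powr p)"
    have Fpos: "?F (\<gamma> m) > 0" using \<delta>(2)[OF m(1)] gp unfolding gp_def[symmetric]
      by (simp add: zero_less_divide_iff)
    have en: "integrable M (\<lambda>x. ?F (\<gamma> m * \<kappa> x))"
      "- lam * (LINT x|M. ?F (U n x)) \<le> gp * A - lam * (LINT x|M. ?F (\<gamma> m * \<kappa> x))"
      using Uen[of "\<gamma> m" n \<kappa>] \<gamma>(1)[of m] m(2) \<kappa>(1,2) by (simp_all add: gp_def A_def)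
    have "?F (\<gamma> m) * (?\<mu> / 2) \<le> (LINT x|M. ?F (\<gamma> m * \<kappa> x))"
      by (rule integral_cutoff_lower_bound[OF MM(1) T \<kappa>(2,3) \<gamma>(1) less_imp_le[OF Fpos] MM(2) en(1)])
    then have "lam * (?F (\<gamma> m) * (?\<mu> / 2)) \<le> lam * (LINT x|M. ?F (\<gamma> m * \<kappa> x))"
      using lam by (intro mult_left_mono) auto
    with en(2) have "- lam * (LINT x|M. ?F (U n x)) \<le> gp * A - lam * (?F (\<gamma> m) * (?\<mu> / 2))" by linarith
    also have "\<dots> = gp * (A - lam * (?\<mu> / 2) * (?F (\<gamma> m) / gp))"
      using gp by (simp add: right_diff_distrib)
    also have "\<dots> \<le> gp * (- \<delta>)"
      using \<delta>(2)[OF m(1)] gp by (intro mult_left_mono) (auto simp: gp_def A_def)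
    finally show ?thesis by (simp add: gp_def mult.commute)
  qed
  have mU: "U n \<in> borel_measurable M" for n
    using U(1)[of n] by (simp add: bounded_solution_def Linf_space_def)
  have mUe: "(\<lambda>x. ereal \<bar>U n x\<bar>) \<in> borel_measurable M" for n using mU[of n] by measurable
  have nontriv: "\<not> (AE x in M. U n x = 0)" if m: "m \<ge> m0" "\<gamma> m \<le> zer n" for m n
  proof
    assume "AE x in M. U n x = 0"
    then have "AE x in M. ?F (U n x) = 0" by eventually_elim (simp add: primitive_def)
    then have "(LINT x|M. ?F (U n x)) = 0" by (rule integral_eq_zero_AE)
    moreover have "\<delta> * \<gamma> m powr p > 0" using \<delta>(1) \<gamma>(1)[of m] by simp
    ultimately show False using key[OF m] by simp
  qed
  have AE0: "AE x in M. U n x \<ge> 0" for n using U(2)[of n] by eventually_elim simp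
  from l consider "l = 0" | "l = \<infinity>" by blast
  then show ?thesis
  proof cases
    case 1
    have g0: "\<gamma> \<longlonglongrightarrow> 0" using \<gamma>(2) 1 by (simp add: zero_ereal_def)
    have nt: "\<not> (AE x in M. U n x = 0)" for n
    proof -
      have "\<forall>\<^sub>F m in sequentially. \<gamma> m < zer n" by (rule order_tendstoD(2)[OF g0 zer(1)])
      then obtain N where "\<And>m. m \<ge> N \<Longrightarrow> \<gamma> m < zer n" unfolding eventually_sequentially by blast
      then have "\<gamma> (max N m0) \<le> zer n" by (simp add: less_imp_le)
      then show ?thesis by (intro nontriv[of "max N m0"]) simp_all
    qed
    have up: "Linf_norm \<Omega> (U n) \<le> ereal (zer n)" for n
      unfolding Linf_norm_def
    proof (rule esssup_I[OF mUe])
      show "AE x in M. ereal \<bar>U n x\<bar> \<le> ereal (zer n)" using U(2)[of n] by eventually_elim simp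
    qed
    have low: "0 \<le> Linf_norm \<Omega> (U n)" for n
    proof -
      have "emeasure M (space M) \<noteq> 0" using \<mu> by (simp add: emeasure_eq_measure)
      then have "0 = esssup M (\<lambda>_. 0 :: ereal)" by (rule esssup_const[symmetric])
      also have "\<dots> \<le> Linf_norm \<Omega> (U n)" unfolding Linf_norm_def by (rule esssup_mono) simp_all
      finally show ?thesis .
    qed
    have "(\<lambda>n. Linf_norm \<Omega> (U n)) \<longlonglongrightarrow> l"
    proof (rule tendsto_sandwich[where f = "\<lambda>_. 0" and h = "\<lambda>n. ereal (zer n)"])
      show "(\<lambda>_. 0) \<longlonglongrightarrow> l" using 1 by simp
    qed (use low up zer(2) in simp_all)
    then show ?thesis
      unfolding has_solution_sequence_def using U(1) AE0 nt by blast
  next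
    case 2
    obtain H where H: "\<And>x. (H has_real_derivative f x) (at x)" "H 0 = 0"
      by (rule continuous_has_antiderivative[OF f(1)]) blast
    have FH: "?F s = H s" if "0 \<le> s" for s
      by (rule primitive_eq_antiderivative[where G = H]) (rule H that)+
    have Hc: "continuous_on S H" for S
      by (intro continuous_at_imp_continuous_on ballI DERIV_isCont[OF H(1)])
    have big: "\<forall>\<^sub>F n in sequentially. ereal r < Linf_norm \<Omega> (U n)" for r
    proof -
      define B where "B = max r 1"
      have B: "B > 0" "r \<le> B" by (simp_all add: B_def)
      have "{0..B} \<noteq> {}" using B by simp
      then obtain s where s: "\<forall>t\<in>{0..B}. H t \<le> H s"
        using continuous_attains_sup[OF compact_Icc _ Hc, of 0 B] by blast
      define K where "K = max 0 (H s)"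
      have K: "K \<ge> 0" "\<And>t. 0 \<le> t \<Longrightarrow> t \<le> B \<Longrightarrow> ?F t \<le> K"
        using s by (auto simp: K_def FH le_max_iff_disj)
      \<comment> \<open>The maximum with 1 gives \<open>\<gamma> m \<le> \<gamma> m powr p\<close>.\<close>
      define R where "R = max 1 (lam * (K * ?\<mu>) / \<delta>)"
      have "\<forall>\<^sub>F m in sequentially. ereal R < ereal (\<gamma> m)"
        using \<gamma>(2) 2 by (intro order_tendstoD(1)) auto
      then obtain N where N: "\<And>m. m \<ge> N \<Longrightarrow> R < \<gamma> m" unfolding eventually_sequentially by auto
      define m where "m = max N m0"
      have m: "m \<ge> m0" "R < \<gamma> m" using N by (simp_all add: m_def)
      have g1: "1 \<le> \<gamma> m" and g2: "lam * (K * ?\<mu>) / \<delta> < \<gamma> m" using m(2) by (auto simp: R_def)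
      have "\<gamma> m powr 1 \<le> \<gamma> m powr p" by (rule powr_mono[OF p_pos(1) g1])
      then have "\<gamma> m \<le> \<gamma> m powr p" using \<gamma>(1)[of m] by simp
      with g2 have "lam * (K * ?\<mu>) / \<delta> < \<gamma> m powr p" by linarith
      then have strict: "lam * (K * ?\<mu>) < \<delta> * \<gamma> m powr p"
        using \<delta>(1) by (simp add: pos_divide_less_eq mult.commute)
      have "\<forall>\<^sub>F n in sequentially. ereal (\<gamma> m) < ereal (zer n)"
        using zer(2) 2 by (intro order_tendstoD(1)) auto
      then show ?thesis
      proof eventually_elim
        case (elim n)
        show ?case
        proof (rule ccontr)
          assume "\<not> ereal r < Linf_norm \<Omega> (U n)"
          then have le: "Linf_norm \<Omega> (U n) \<le> ereal B" using B(2) by (simp add: not_less order_trans)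
          have "AE x in M. ereal \<bar>U n x\<bar> \<le> Linf_norm \<Omega> (U n)"
            unfolding Linf_norm_def by (rule esssup_AE)
          with U(2)[of n] have ae: "AE x in M. ?F (U n x) \<le> K"
          proof eventually_elim
            case (elim x)
            then have "ereal \<bar>U n x\<bar> \<le> ereal B" using le by (blast intro: order_trans)
            then show ?case using elim(1) by (intro K(2)) auto
          qed
          have "(LINT x|M. ?F (U n x)) \<le> K * ?\<mu>"
          proof (cases "integrable M (\<lambda>x. ?F (U n x))")
            case True
            have "(LINT x|M. ?F (U n x)) \<le> (LINT x|M. K)"
              by (rule integral_mono_AE[OF True _ ae]) simp
            then show ?thesis by (simp add: mult.commute)
          next
            case False
            then show ?thesis using K(1) by (simp add: not_integrable_integral_eq)
          qed
          then have "lam * (LINT x|M. ?F (U n x)) \<le> lam * (K * ?\<mu>)"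
            using lam by (intro mult_left_mono) auto
          moreover have "\<delta> * \<gamma> m powr p \<le> lam * (LINT x|M. ?F (U n x))"
            using key[OF m(1)] elim by simp
          ultimately show False using strict by linarith
        qed
      qed
    qed
    have "\<forall>\<^sub>F n in sequentially. ereal (\<gamma> m0) < ereal (zer n)"
      using zer(2) 2 by (intro order_tendstoD(1)) auto
    then obtain N where N: "\<And>n. n \<ge> N \<Longrightarrow> \<gamma> m0 < zer n" unfolding eventually_sequentially by auto
    have lim: "(\<lambda>n. Linf_norm \<Omega> (U n)) \<longlonglongrightarrow> \<infinity>"
      unfolding tendsto_PInfty using big by blast
    have "(\<lambda>n. Linf_norm \<Omega> (U (n + N))) \<longlonglongrightarrow> l"
      using LIMSEQ_ignore_initial_segment[OF lim, of N] 2 by simp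
    moreover have "\<not> (AE x in M. U (n + N) x = 0)" for n
      by (rule nontriv[of m0]) (use N[of "n + N"] in simp_all)
    ultimately show ?thesis
      unfolding has_solution_sequence_def using U(1) AE0 by (intro exI[of _ "\<lambda>n. U (n + N)"]) simp
  qed
qed

end

theorem theorem3p1:
  fixes \<Omega> :: "'a::euclidean_space set"
    and p \<alpha> \<beta> M :: real
    and a :: "'a \<Rightarrow> 'a \<Rightarrow> 'a"
    and \<Phi> :: "'a \<Rightarrow> 'a \<Rightarrow> real"
    and f :: "real \<Rightarrow> real"
    and zer \<gamma> :: "nat \<Rightarrow> real"
    and l L :: ereal
  assumes "open \<Omega>" "connected \<Omega>" "\<Omega> \<noteq> {}" "bounded \<Omega>"
    and "1 < p"
    and "caratheodory_function \<Omega> a"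
    and "0 < \<alpha>" "\<alpha> \<le> \<beta>"
    and "AE x in lebesgue_on \<Omega>. (\<forall>\<xi>. GDERIV (\<Phi> x) \<xi> :> a x \<xi>) \<and> \<Phi> x 0 = 0"
    and "AE x in lebesgue_on \<Omega>. \<forall>\<xi>.
           \<alpha> / p * norm \<xi> powr p \<le> \<Phi> x \<xi> \<and> \<Phi> x \<xi> \<le> \<beta> / p * norm \<xi> powr p"
    and "AE x in lebesgue_on \<Omega>. strictly_convex_on UNIV (\<Phi> x)"
    and "l \<in> {0, \<infinity>}"
    and "continuous_on UNIV f" "f 0 \<ge> 0"
    and "\<forall>n. zer n > 0" "(\<lambda>n. ereal (zer n)) \<longlonglongrightarrow> l" "\<forall>n. f (zer n) = 0"
    and "\<forall>n. \<gamma> n > 0" "(\<lambda>n. ereal (\<gamma> n)) \<longlonglongrightarrow> l"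
    and "L > 0" "(\<lambda>n. ereal (primitive f (\<gamma> n) / \<gamma> n powr p)) \<longlonglongrightarrow> L"
    and "M \<ge> 0"
    and "\<forall>n. - (INF t\<in>{0..\<gamma> n}. primitive f t) \<le> M * primitive f (\<gamma> n)"
  shows "(\<exists>lambda_bar\<ge>0. \<forall>lam>lambda_bar. has_solution_sequence \<Omega> p a f lam l)
       \<and> (L = \<infinity> \<longrightarrow> (\<forall>lam>0. has_solution_sequence \<Omega> p a f lam l))"
proof -
  interpret p_growth_energy \<Omega> p \<alpha> \<beta> a \<Phi>
    by unfold_locales (fact assms)+
  define \<mu> where "\<mu> = measure (lebesgue_on \<Omega>) (space (lebesgue_on \<Omega>))"
  have \<mu>: "\<mu> > 0" unfolding \<mu>_def by (rule measure_pos[OF assms(3)])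
  have Fbelow: "- M * primitive f (\<gamma> n) \<le> primitive f t" if t: "0 \<le> t" "t \<le> \<gamma> n" for n t
  proof -
    obtain H where H: "\<And>x. (H has_real_derivative f x) (at x)" "H 0 = 0"
      by (rule continuous_has_antiderivative[OF assms(13)]) blast
    have FH: "primitive f s = H s" if "0 \<le> s" for s
      by (rule primitive_eq_antiderivative[where G = H]) (rule H that)+
    have "continuous_on {0..\<gamma> n} H"
      by (intro continuous_at_imp_continuous_on ballI DERIV_isCont[OF H(1)])
    then have "compact (H ` {0..\<gamma> n})" by (rule compact_continuous_image) simp
    then have "bdd_below (H ` {0..\<gamma> n})"
      by (intro bounded_imp_bdd_below compact_imp_bounded)
    moreover have "H ` {0..\<gamma> n} = primitive f ` {0..\<gamma> n}" by (intro image_cong refl) (simp add: FH)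
    ultimately have "(INF t\<in>{0..\<gamma> n}. primitive f t) \<le> primitive f t"
      using t by (intro cINF_lower) simp_all
    moreover have "- (INF t\<in>{0..\<gamma> n}. primitive f t) \<le> M * primitive f (\<gamma> n)"
      using assms(23) by blast
    ultimately show ?thesis by linarith
  qed
  obtain T \<kappa> where T: "T \<in> sets (lebesgue_on \<Omega>)"
      "measure (lebesgue_on \<Omega>) (space (lebesgue_on \<Omega>) - T) * (1 + M) \<le> measure (lebesgue_on \<Omega>) (space (lebesgue_on \<Omega>)) / 2"
    and \<kappa>: "\<kappa> \<in> test_functions \<Omega>" "\<And>x. 0 \<le> \<kappa> x \<and> \<kappa> x \<le> 1" "\<And>x. x \<in> T \<Longrightarrow> \<kappa> x = 1"
    by (rule large_cutoff_exists[OF assms(3,22)]) (rule that)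
  define A where "A = \<beta> / p * (LINT x|lebesgue_on \<Omega>. norm (grad \<kappa> x) powr p)"
  have A: "A \<ge> 0" using \<beta>_pos p_pos(3) by (simp add: A_def)
  have main: "has_solution_sequence \<Omega> p a f lam l"
    if lam: "lam > 0" and large: "L = \<infinity> \<or> ereal (A / (lam * (\<mu> / 2))) < L" for lam
  proof -
    have k: "lam * (\<mu> / 2) > 0" using lam \<mu> by simp
    obtain \<delta> m0 where \<delta>: "\<delta> > 0"
      "\<And>m. m \<ge> m0 \<Longrightarrow> A - lam * (\<mu> / 2) * (primitive f (\<gamma> m) / \<gamma> m powr p) \<le> - \<delta>
        \<and> primitive f (\<gamma> m) / \<gamma> m powr p > 0"
      by (rule eventually_energy_negative[OF assms(21,20) A k large]) (rule that)
    show ?thesis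
      by (rule solution_sequence_exists[OF assms(3,12,13,14) _ assms(16) _ _ assms(19,22) Fbelow T \<kappa> lam
            \<delta>[unfolded A_def \<mu>_def]])
        (use assms(15,17,18) in blast)+
  qed
  have inf: "\<forall>lam>0. has_solution_sequence \<Omega> p a f lam l" if "L = \<infinity>"
    using main that by blast
  have "\<exists>lambda_bar\<ge>0. \<forall>lam>lambda_bar. has_solution_sequence \<Omega> p a f lam l"
  proof (cases "L = \<infinity>")
    case True
    with inf show ?thesis by (intro exI[of _ 0]) simp
  next
    case False
    with assms(20) obtain L0 where L0: "L = ereal L0" "L0 > 0" by (cases L) auto
    \<comment> \<open>At this value of \<open>\<lambda>\<close> the limit \<open>A - \<lambda> (\<mu> / 2) L0\<close> of the bounds for the energy vanishes.\<close>
    define b where "b = A / (\<mu> / 2 * L0)"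
    have b: "b \<ge> 0" using A \<mu> L0 by (simp add: b_def)
    have "has_solution_sequence \<Omega> p a f lam l" if lam: "lam > b" for lam
    proof (rule main)
      show lp: "lam > 0" using lam b by linarith
      have "A < lam * (\<mu> / 2 * L0)"
        using lam \<mu> L0 unfolding b_def by (subst (asm) pos_divide_less_eq) simp_all
      then have "A / (lam * (\<mu> / 2)) < L0"
        using lp \<mu> by (subst pos_divide_less_eq) (simp_all add: ac_simps)
      then show "L = \<infinity> \<or> ereal (A / (lam * (\<mu> / 2))) < L" using L0 by simp
    qed
    with b show ?thesis by blast
  qed
  with inf show ?thesis by blast
qed

end
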